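(* Let $\pi$ be an irreducible representation of $C(SU_0(n+1))$ on a Hilbert space $\mathcal H$, let $Z_{i,j}=\pi(z_{i,j})$, let $r=\min\{i:1\le i\le n+1,\ Z_{n+1,i}\ne0\}$, and assume $r\le n$. Define $W:=W_{n+1,r}^*W_{n+1,r+1}$, $$Y^{(1)}_{i,j}=\begin{cases}Z_{i,j}&\text{if } j\notin\{r,r+1\},\\ Z_{i,r}W&\text{if } j=r,\\ W^*Z_{i,r+1}&\text{if } j=r+1,\end{cases}\qquad Y^{(2)}_{i,j}=\begin{cases}W&\text{if } i=j=r+1,\\ W^*&\text{if } i=j=r,\\ I-WW^*&\text{if } i,j\in\{r,r+1\},\ i\ne j,\\ I&\text{if } i=j\notin\{r,r+1\},\\ 0&\text{otherwise,}\end{cases}$$ for $1\le i,j\le n+1$. Then $Y^{(1)}_{i,j}\in\{W,W^*\}'$ (the commutant) for all $i,j$, and $$Z_{i,j}=\sum_{k=\min\{i,j\}}^{\max\{i,j\}}Y^{(1)}_{i,k}Y^{(2)}_{k,j}\qquad\text{for all } 1\le i,j\le n+1.$$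
   Context: Fix an integer $n\ge 2$. $C(SU_0(n+1))$ denotes the universal unital $C^*$-algebra generated by elements $z_{i,j}$, $1\le i,j\le n+1$, subject to the following relations (empty products are $1$): (1) $z_{i,j}z_{i,l}=0$ if $j<l$; (2) $z_{i,j}z_{k,j}=0$ if $i<k$; (3) $z_{i,l}z_{k,j}=z_{k,j}z_{i,l}$ if $i<k$ and $j<l$; (4) $z_{i,l}z_{k,j}=0$ if $i<k$, $j<l$ and $\max\{i,j\}\ge\min\{k,l\}$; (5) $z_{i,j}z_{k,l}-z_{k,l}z_{i,j}=z_{i,l}z_{k,j}$ if $i<k$, $j<l$ and $\max\{i,j\}+1=\min\{k,l\}$; (6) $z_{i,j}z_{k,l}=z_{k,l}z_{i,j}$ if $i<k$, $j<l$ and $\max\{i,j\}+1<\min\{k,l\}$; (7) $z_{1,1}z_{2,2}\cdots z_{n+1,n+1}=1$; (8) $z_{i,j}z_{r,s}^*=z_{r,s}^*z_{i,j}$ if $i\ne r$ and $j\neq s$; (9) $z_{r,s}^*=(z_{1,1}\cdots z_{s-1,s-1})(z_{s,s+1}z_{s+1,s+2}\cdots z_{r-1,r})(z_{r+1,r+1}\cdots z_{n+1,n+1})$ if $r>s$; $z_{r,s}^*=(z_{1,1}\cdots z_{r-1,r-1})(z_{r+1,r}z_{r+2,r+1}\cdots z_{s,s-1})(z_{s+1,s+1}\cdots z_{n+1,n+1})$ if $r<s$; $z_{r,r}^*=(z_{1,1}\cdots z_{r-1,r-1})(z_{r+1,r+1}\cdots z_{n+1,n+1})$. Representations are unital $*$-representations.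 Given a representation $\pi$ with $Z_{i,j}=\pi(z_{i,j})$, the operators $W_{i,j}$ ($1\le j\le i\le n+1$) are defined recursively by $W_{j,j}=Z_{n+1,j}$ and $$W_{i,j}=\sum_{k\in\mathbb N}Z_{n+1,i}^k\,W_{i-1,j}\,(Z_{n+1,i}^k)^*\qquad (j+1\le i\le n+1),$$ with $\mathbb N=\{0,1,2,\dots\}$, $Z^0=I$; the sums converge in the strong operator topology. (For irreducible $\pi$, $W_{n+1,r}=\lambda I$ for some $\lambda\in S^1$, so $W=\bar\lambda W_{n+1,r+1}$.) *)

theory Defs
  imports "HOL-Analysis.Analysis" "HOL-Algebra.Subrings"
begin

section \<open>Complex Hilbert spaces and their bounded operators\<close>

text \<open>The inner product is conjugate-linear in its first argument.\<close>

class complex_hilbert_space = banach +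
  fixes scaleC :: "complex \<Rightarrow> 'a \<Rightarrow> 'a" (infixr "*\<^sub>C" 75)
    and cinner :: "'a \<Rightarrow> 'a \<Rightarrow> complex"
  assumes scaleC_add_right: "c *\<^sub>C (x + y) = c *\<^sub>C x + c *\<^sub>C y"
    and scaleC_add_left: "(c + d) *\<^sub>C x = c *\<^sub>C x + d *\<^sub>C x"
    and scaleC_scaleC: "c *\<^sub>C (d *\<^sub>C x) = (c * d) *\<^sub>C x"
    and scaleC_one: "1 *\<^sub>C x = x"
    and scaleR_scaleC: "t *\<^sub>R x = complex_of_real t *\<^sub>C x"
    and cinner_commute: "cinner x y = cnj (cinner y x)"
    and cinner_add_right: "cinner x (y + w) = cinner x y + cinner x w"
    and cinner_scaleC_right: "cinner x (c *\<^sub>C y) = c * cinner x y"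
    and cinner_norm: "cinner x x = complex_of_real ((norm x)\<^sup>2)"

definition bounded_clinear :: "('h::complex_hilbert_space \<Rightarrow> 'h) \<Rightarrow> bool" where
  "bounded_clinear T \<longleftrightarrow> bounded_linear T \<and> (\<forall>c x. T (c *\<^sub>C x) = c *\<^sub>C T x)"

text \<open>The description is well-defined for bounded \<open>T\<close>, by the Riesz representation theorem.\<close>

definition hadj :: "('h::complex_hilbert_space \<Rightarrow> 'h) \<Rightarrow> ('h \<Rightarrow> 'h)" where
  "hadj T = (THE S. \<forall>x y. cinner (S x) y = cinner x (T y))"

definition commutant :: "('h::complex_hilbert_space \<Rightarrow> 'h) set \<Rightarrow> ('h \<Rightarrow> 'h) set" where
  "commutant M = {T. bounded_clinear T \<and> (\<forall>S\<in>M. T \<circ> S = S \<circ> T)}"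

definition closed_csubspace :: "'h::complex_hilbert_space set \<Rightarrow> bool" where
  "closed_csubspace K \<longleftrightarrow> closed K \<and> 0 \<in> K \<and> (\<forall>x\<in>K. \<forall>y\<in>K. x + y \<in> K) \<and>
     (\<forall>c. \<forall>x\<in>K. c *\<^sub>C x \<in> K)"


section \<open>Unital C*-algebras\<close>

record 'a cstar_alg = "'a ring" +
  cscale :: "complex \<Rightarrow> 'a \<Rightarrow> 'a"
  cstar :: "'a \<Rightarrow> 'a"
  cnorm :: "'a \<Rightarrow> real"

locale unital_cstar_algebra = ring A for A :: "'a cstar_alg" (structure) +
  assumes scale_closed: "x \<in> carrier A \<Longrightarrow> cscale A c x \<in> carrier A"
    and scale_add_right: "\<lbrakk>x \<in> carrier A; y \<in> carrier A\<rbrakk> \<Longrightarrow>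
      cscale A c (x \<oplus> y) = cscale A c x \<oplus> cscale A c y"
    and scale_add_left: "x \<in> carrier A \<Longrightarrow> cscale A (c + d) x = cscale A c x \<oplus> cscale A d x"
    and scale_scale: "x \<in> carrier A \<Longrightarrow> cscale A c (cscale A d x) = cscale A (c * d) x"
    and scale_one: "x \<in> carrier A \<Longrightarrow> cscale A 1 x = x"
    and scale_mult_left: "\<lbrakk>x \<in> carrier A; y \<in> carrier A\<rbrakk> \<Longrightarrow>
      cscale A c x \<otimes> y = cscale A c (x \<otimes> y)"
    and scale_mult_right: "\<lbrakk>x \<in> carrier A; y \<in> carrier A\<rbrakk> \<Longrightarrow>
      x \<otimes> cscale A c y = cscale A c (x \<otimes> y)"
    and star_closed: "x \<in> carrier A \<Longrightarrow> cstar A x \<in> carrier A"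
    and star_star: "x \<in> carrier A \<Longrightarrow> cstar A (cstar A x) = x"
    and star_add: "\<lbrakk>x \<in> carrier A; y \<in> carrier A\<rbrakk> \<Longrightarrow>
      cstar A (x \<oplus> y) = cstar A x \<oplus> cstar A y"
    and star_scale: "x \<in> carrier A \<Longrightarrow> cstar A (cscale A c x) = cscale A (cnj c) (cstar A x)"
    and star_mult: "\<lbrakk>x \<in> carrier A; y \<in> carrier A\<rbrakk> \<Longrightarrow>
      cstar A (x \<otimes> y) = cstar A y \<otimes> cstar A x"
    and norm_eq_zero: "x \<in> carrier A \<Longrightarrow> cnorm A x = 0 \<longleftrightarrow> x = \<zero>"
    and norm_triangle: "\<lbrakk>x \<in> carrier A; y \<in> carrier A\<rbrakk> \<Longrightarrow>
      cnorm A (x \<oplus> y) \<le> cnorm A x + cnorm A y"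
    and norm_scale: "x \<in> carrier A \<Longrightarrow> cnorm A (cscale A c x) = cmod c * cnorm A x"
    and norm_mult: "\<lbrakk>x \<in> carrier A; y \<in> carrier A\<rbrakk> \<Longrightarrow>
      cnorm A (x \<otimes> y) \<le> cnorm A x * cnorm A y"
    and cstar_identity: "x \<in> carrier A \<Longrightarrow> cnorm A (cstar A x \<otimes> x) = (cnorm A x)\<^sup>2"
    and complete: "\<lbrakk>\<And>k::nat. s k \<in> carrier A;
        \<And>e. e > 0 \<Longrightarrow> \<exists>N. \<forall>k\<ge>N. \<forall>m\<ge>N. cnorm A (s k \<ominus> s m) < e\<rbrakk> \<Longrightarrow>
      \<exists>x\<in>carrier A. (\<lambda>k. cnorm A (s k \<ominus> x)) \<longlonglongrightarrow> 0"

definition cstar_subalgebra :: "'a set \<Rightarrow> 'a cstar_alg \<Rightarrow> bool" where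
  "cstar_subalgebra S A \<longleftrightarrow> subring S A \<and>
     (\<forall>c. \<forall>x\<in>S. cscale A c x \<in> S) \<and> (\<forall>x\<in>S. cstar A x \<in> S) \<and>
     (\<forall>s x. (\<forall>k::nat. s k \<in> S) \<and> x \<in> carrier A \<and> (\<lambda>k. cnorm A (s k \<ominus>\<^bsub>A\<^esub> x)) \<longlonglongrightarrow> 0
        \<longrightarrow> x \<in> S)"

definition unital_star_hom :: "'a cstar_alg \<Rightarrow> 'b cstar_alg \<Rightarrow> ('a \<Rightarrow> 'b) set" where
  "unital_star_hom A B = {h \<in> ring_hom A B.
     (\<forall>c. \<forall>x\<in>carrier A. h (cscale A c x) = cscale B c (h x)) \<and>
     (\<forall>x\<in>carrier A. h (cstar A x) = cstar B (h x))}"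

definition bounded_ops :: "('h::complex_hilbert_space \<Rightarrow> 'h) cstar_alg" where
  "bounded_ops = \<lparr>carrier = {T. bounded_clinear T}, mult = (\<lambda>S T. S \<circ> T), one = id,
     zero = (\<lambda>x. 0), add = (\<lambda>S T x. S x + T x),
     cscale = (\<lambda>c T x. c *\<^sub>C T x), cstar = hadj, cnorm = onorm\<rparr>"

definition representation ::
  "'a cstar_alg \<Rightarrow> ('a \<Rightarrow> 'h::complex_hilbert_space \<Rightarrow> 'h) \<Rightarrow> bool" where
  "representation A \<pi> \<longleftrightarrow> \<pi> \<in> unital_star_hom A bounded_ops"

definition irreducible_representation ::
  "'a cstar_alg \<Rightarrow> ('a \<Rightarrow> 'h::complex_hilbert_space \<Rightarrow> 'h) \<Rightarrow> bool" where
  "irreducible_representation A \<pi> \<longleftrightarrow> representation A \<pi> \<and> (\<exists>x::'h. x \<noteq> 0) \<and>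
     (\<forall>K. closed_csubspace K \<and> (\<forall>a\<in>carrier A. \<pi> a ` K \<subseteq> K) \<longrightarrow> K = {0} \<or> K = UNIV)"


section \<open>The C*-algebra of the crystallized quantum group\<close>

text \<open>The ordered product \<open>f a \<otimes> f (a + 1) \<otimes> \<dots> \<otimes> f b\<close>; it is the unit if \<open>a > b\<close>.\<close>

definition oprod :: "'a cstar_alg \<Rightarrow> (nat \<Rightarrow> 'a) \<Rightarrow> nat \<Rightarrow> nat \<Rightarrow> 'a" where
  "oprod A f a b = foldr (\<otimes>\<^bsub>A\<^esub>) (map f [a..<Suc b]) \<one>\<^bsub>A\<^esub>"

text \<open>
  The last three clauses, for \<open>cstar A (z r s)\<close>, index the middle product by the row of its
  factors: \<open>z s (s+1) \<otimes> \<dots> \<otimes> z (r-1) r\<close> if \<open>r > s\<close>, and \<open>z (r+1) r \<otimes> \<dots> \<otimes> z s (s-1)\<close> if \<open>r < s\<close>.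
\<close>

definition SU0_relations :: "nat \<Rightarrow> 'a cstar_alg \<Rightarrow> (nat \<Rightarrow> nat \<Rightarrow> 'a) \<Rightarrow> bool" where
  "SU0_relations n A z \<longleftrightarrow>
    (\<forall>i\<in>{1..n+1}. \<forall>j\<in>{1..n+1}. z i j \<in> carrier A) \<and>
    (\<forall>i\<in>{1..n+1}. \<forall>j\<in>{1..n+1}. \<forall>l\<in>{1..n+1}. j < l \<longrightarrow>
       z i j \<otimes>\<^bsub>A\<^esub> z i l = \<zero>\<^bsub>A\<^esub>) \<and>
    (\<forall>i\<in>{1..n+1}. \<forall>k\<in>{1..n+1}. \<forall>j\<in>{1..n+1}. i < k \<longrightarrow>
       z i j \<otimes>\<^bsub>A\<^esub> z k j = \<zero>\<^bsub>A\<^esub>) \<and>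
    (\<forall>i\<in>{1..n+1}. \<forall>k\<in>{1..n+1}. \<forall>j\<in>{1..n+1}. \<forall>l\<in>{1..n+1}. i < k \<and> j < l \<longrightarrow>
       z i l \<otimes>\<^bsub>A\<^esub> z k j = z k j \<otimes>\<^bsub>A\<^esub> z i l \<and>
       (max i j \<ge> min k l \<longrightarrow> z i l \<otimes>\<^bsub>A\<^esub> z k j = \<zero>\<^bsub>A\<^esub>) \<and>
       (max i j + 1 = min k l \<longrightarrow>
          z i j \<otimes>\<^bsub>A\<^esub> z k l \<ominus>\<^bsub>A\<^esub> z k l \<otimes>\<^bsub>A\<^esub> z i j = z i l \<otimes>\<^bsub>A\<^esub> z k j) \<and>
       (max i j + 1 < min k l \<longrightarrow> z i j \<otimes>\<^bsub>A\<^esub> z k l = z k l \<otimes>\<^bsub>A\<^esub> z i j)) \<and>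
    oprod A (\<lambda>m. z m m) 1 (n+1) = \<one>\<^bsub>A\<^esub> \<and>
    (\<forall>i\<in>{1..n+1}. \<forall>j\<in>{1..n+1}. \<forall>r\<in>{1..n+1}. \<forall>s\<in>{1..n+1}. i \<noteq> r \<and> j \<noteq> s \<longrightarrow>
       z i j \<otimes>\<^bsub>A\<^esub> cstar A (z r s) = cstar A (z r s) \<otimes>\<^bsub>A\<^esub> z i j) \<and>
    (\<forall>r\<in>{1..n+1}. \<forall>s\<in>{1..n+1}.
       (r > s \<longrightarrow> cstar A (z r s) =
          oprod A (\<lambda>m. z m m) 1 (s-1) \<otimes>\<^bsub>A\<^esub> oprod A (\<lambda>m. z m (m+1)) s (r-1)
            \<otimes>\<^bsub>A\<^esub> oprod A (\<lambda>m. z m m) (r+1) (n+1)) \<and>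
       (r < s \<longrightarrow> cstar A (z r s) =
          oprod A (\<lambda>m. z m m) 1 (r-1) \<otimes>\<^bsub>A\<^esub> oprod A (\<lambda>m. z m (m-1)) (r+1) s
            \<otimes>\<^bsub>A\<^esub> oprod A (\<lambda>m. z m m) (s+1) (n+1)) \<and>
       (r = s \<longrightarrow> cstar A (z r s) =
          oprod A (\<lambda>m. z m m) 1 (r-1) \<otimes>\<^bsub>A\<^esub> oprod A (\<lambda>m. z m m) (r+1) (n+1)))"

text \<open>
  The predicate says that \<open>(A, z)\<close> is the universal unital C*-algebra on these generators and
  relations.  HOL cannot quantify over the type of the test algebra \<open>B\<close>, so \<open>B\<close> ranges over all
  C*-algebras whose carrier is a subset of the type \<open>'a\<close> that houses \<open>A\<close>.  This loses nothing:
  replacing \<open>B\<close> by the C*-subalgebra generated by the \<open>w i j\<close>, one may assume that \<open>B\<close> is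
  separable, hence of cardinality at most that of the continuum, and a nonzero \<open>A\<close> is at least
  that large, so \<open>B\<close> has an isomorphic copy inside \<open>'a\<close>.  (If \<open>'a\<close> is too small to contain a
  nonzero C*-algebra, the zero algebra satisfies the predicate, but it has no unital
  representation on a nonzero Hilbert space.)
\<close>

definition universal_CSU0 :: "nat \<Rightarrow> 'a cstar_alg \<Rightarrow> (nat \<Rightarrow> nat \<Rightarrow> 'a) \<Rightarrow> bool" where
  "universal_CSU0 n A z \<longleftrightarrow>
     unital_cstar_algebra A \<and> SU0_relations n A z \<and>
     (\<forall>S. cstar_subalgebra S A \<and> (\<forall>i\<in>{1..n+1}. \<forall>j\<in>{1..n+1}. z i j \<in> S) \<longrightarrow> S = carrier A) \<and>
     (\<forall>(B::'a cstar_alg) w. unital_cstar_algebra B \<and> SU0_relations n B w \<longrightarrow>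
        (\<exists>\<phi>\<in>unital_star_hom A B. \<forall>i\<in>{1..n+1}. \<forall>j\<in>{1..n+1}. \<phi> (z i j) = w i j))"


section \<open>The operators of the factorization\<close>

text \<open>
  Only the entries with \<open>1 \<le> j \<le> i \<le> n + 1\<close> are meaningful.  The series is summed pointwise in the
  norm of the Hilbert space, that is, in the strong operator topology.
\<close>

function Wop :: "nat \<Rightarrow> (nat \<Rightarrow> nat \<Rightarrow> 'h::complex_hilbert_space \<Rightarrow> 'h) \<Rightarrow> nat \<Rightarrow> nat \<Rightarrow> 'h \<Rightarrow> 'h" where
  "i \<le> j \<Longrightarrow> Wop n Z i j = Z (n+1) j"
| "j < i \<Longrightarrow> Wop n Z i j =
     (\<lambda>x. \<Sum>k. (Z (n+1) i ^^ k) (Wop n Z (i-1) j (hadj (Z (n+1) i ^^ k) x)))"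
  by (force simp: not_le)+
termination by (relation "Wellfounded.measure (\<lambda>(n, Z, i, j). i)") auto

definition Y1 :: "nat \<Rightarrow> ('h::complex_hilbert_space \<Rightarrow> 'h) \<Rightarrow> (nat \<Rightarrow> nat \<Rightarrow> 'h \<Rightarrow> 'h) \<Rightarrow>
    nat \<Rightarrow> nat \<Rightarrow> 'h \<Rightarrow> 'h" where
  "Y1 r W Z i j =
     (if j = r then Z i r \<circ> W else if j = r + 1 then hadj W \<circ> Z i (r+1) else Z i j)"

definition Y2 :: "nat \<Rightarrow> ('h::complex_hilbert_space \<Rightarrow> 'h) \<Rightarrow> nat \<Rightarrow> nat \<Rightarrow> 'h \<Rightarrow> 'h" where
  "Y2 r W i j =
     (if i = r + 1 \<and> j = r + 1 then W
      else if i = r \<and> j = r then hadj W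
      else if i \<in> {r, r + 1} \<and> j \<in> {r, r + 1} then (\<lambda>x. x - W (hadj W x))
      else if i = j then id
      else (\<lambda>x. 0))"

end

theory Submission
  imports Defs
begin

text \<open>
  Write \<open>N = n + 1\<close>, let \<open>a l = Z N l\<close> be the last row and \<open>Q l = (a l)\<^sup>\<star> * a l\<close>.  The relations give
  \<open>Q N = 1\<close> and \<open>Q l - a l * (a l)\<^sup>\<star> = Q (l - 1)\<close>, so every \<open>Q l\<close> is a projection and \<open>a l\<close> acts on the range of
  \<open>Q l\<close> as an isometry whose defect space is the range of \<open>Q (l - 1)\<close> (\<open>Q_step\<close>, \<open>Q_idem\<close>).  Iterated Wold
  decompositions suggest a basis-like picture: the space should be spanned by the vectors
  \<open>a N ^ k\<^sub>N \<dots> a (r+1) ^ k\<^sub>r\<^sub>+\<^sub>1\<close> applied to the range of \<open>Q r\<close>, on which \<open>a r\<close> is unitary.  This span is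
  invariant under the representation, and irreducibility makes it everything (\<open>generated_UNIV\<close>).  Invariance
  passes from the generators to the whole algebra because representations of C*-algebras are contractive
  (\<open>contractive\<close>).

  The main tool is a uniqueness principle (\<open>vanishI\<close>): an operator that vanishes on the range of \<open>Q s\<close>, where
  \<open>s \<ge> r\<close>, and can be moved past each \<open>a l\<close> with \<open>l > s\<close> is zero.  It turns every operator identity below into
  a computation with the defining relations.

  In this picture \<open>V = W\<^sub>N\<^sub>,\<^sub>r\<close> applies \<open>a r\<close> to the range of \<open>Q r\<close> and leaves the exponents alone, while
  \<open>X = W\<^sub>N\<^sub>,\<^sub>r\<^sub>+\<^sub>1\<close> raises the exponent \<open>k\<^sub>r\<^sub>+\<^sub>1\<close> by one; both are strong limits that are controlled on the
  spanning vectors (\<open>amplification\<close>).  \<open>V\<close> is a unitary that commutes with the representation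
  (\<open>central_Z\<close>), so that \<open>W = V\<^sup>\<star> * X\<close> and the isometry \<open>X\<close> have the same commutant among the operators
  that commute with \<open>V\<close>, and \<open>G = 1 - X * X\<^sup>\<star> = 1 - W * W\<^sup>\<star>\<close> is the projection onto \<open>k\<^sub>r\<^sub>+\<^sub>1 = 0\<close>.
  It remains to see how each \<open>Z i j\<close> depends on the exponent \<open>k\<^sub>r\<^sub>+\<^sub>1\<close>.  Columns other than \<open>r\<close> and
  \<open>r + 1\<close> do not involve it (\<open>good_other_columns\<close>).  In the two exceptional columns an entry of a row \<open>i \<le> r\<close> is
  treated directly (\<open>upper_kills_G\<close>, \<open>good_upper_r\<close>, \<open>good_upper_Suc_r\<close>, \<open>columns_link\<close>).  For \<open>r < i < N\<close> the
  relations for the adjoints write \<open>(Z i r)\<^sup>\<star>\<close> and \<open>(Z i (r + 1))\<^sup>\<star>\<close> as \<open>D * Z r (r + 1) * H\<close> and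
  \<open>D * Z r r * H\<close> with the same \<open>D\<close> and \<open>H\<close>, both of them in the commutant of \<open>X\<close> (\<open>lower_columns\<close>), which
  reduces these rows to row \<open>r\<close>.

  One difficulty recurs.  No relation describes the commutator of \<open>Z i j\<close> with \<open>a l\<close> when \<open>j < l \<le> i < N\<close>.  The proofs
  avoid it in two ways: for \<open>i < N\<close>, \<open>(Z i j)\<^sup>\<star>\<close> commutes with \<open>a l\<close> for every \<open>l \<noteq> j\<close>, and for \<open>i > j\<close> it is a product of
  entries on and above the diagonal, for which the range of such \<open>l\<close> is empty.
\<close>

section \<open>Adjoints in complex Hilbert spaces\<close>

lemma cinner_add_left: "cinner (x + y) (w::'h::complex_hilbert_space) = cinner x w + cinner y w"
  by (metis cinner_add_right cinner_commute complex_cnj_add)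

lemma cinner_scaleC_left: "cinner (c *\<^sub>C x) (w::'h::complex_hilbert_space) = cnj c * cinner x w"
  by (metis cinner_commute cinner_scaleC_right complex_cnj_mult)

lemma cinner_zero_right [simp]: "cinner x (0::'h::complex_hilbert_space) = 0"
  using cinner_add_right[of x 0 0] by simp

lemma cinner_zero_left [simp]: "cinner 0 (x::'h::complex_hilbert_space) = 0"
  by (metis cinner_commute cinner_zero_right complex_cnj_zero)

lemma cinner_minus_right: "cinner x (- y::'h::complex_hilbert_space) = - cinner x y"
  using cinner_add_right[of x y "-y"] by (intro minus_unique[symmetric]) simp

lemma cinner_minus_left: "cinner (- x) (y::'h::complex_hilbert_space) = - cinner x y"
  by (metis cinner_commute cinner_minus_right complex_cnj_minus)

lemma cinner_diff_right: "cinner x (y - w::'h::complex_hilbert_space) = cinner x y - cinner x w"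
  using cinner_add_right[of x y "-w"] by (simp add: cinner_minus_right)

lemma cinner_diff_left: "cinner (x - y) (w::'h::complex_hilbert_space) = cinner x w - cinner y w"
  using cinner_add_left[of x "-y" w] by (simp add: cinner_minus_left)

lemmas cinner_distribs = cinner_add_left cinner_add_right cinner_diff_left cinner_diff_right

lemma Re_cinner_commute: "Re (cinner x (y::'h::complex_hilbert_space)) = Re (cinner y x)"
  by (metis cinner_commute cnj.simps(1))

lemma norm_sq_cinner: "(norm (x::'h::complex_hilbert_space))\<^sup>2 = Re (cinner x x)"
  by (simp add: cinner_norm)

lemma norm_add_sq:
  "(norm (x + y::'h::complex_hilbert_space))\<^sup>2 = (norm x)\<^sup>2 + (norm y)\<^sup>2 + 2 * Re (cinner x y)"
  unfolding norm_sq_cinner by (simp add: cinner_distribs Re_cinner_commute[of y x])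

lemma norm_diff_sq:
  "(norm (x - y::'h::complex_hilbert_space))\<^sup>2 = (norm x)\<^sup>2 + (norm y)\<^sup>2 - 2 * Re (cinner x y)"
  unfolding norm_sq_cinner by (simp add: cinner_distribs Re_cinner_commute[of y x])

lemma scaleC_zero_right [simp]: "c *\<^sub>C (0::'h::complex_hilbert_space) = 0"
  using scaleC_add_right[of c 0 0] by simp

lemma norm_scaleC: "norm (c *\<^sub>C (x::'h::complex_hilbert_space)) = cmod c * norm x"
proof -
  have "complex_of_real ((norm (c *\<^sub>C x))\<^sup>2) = cinner (c *\<^sub>C x) (c *\<^sub>C x)"
    by (simp only: cinner_norm)
  also have "\<dots> = (c * cnj c) * cinner x x"
    by (simp add: cinner_scaleC_left cinner_scaleC_right mult_ac)
  also have "\<dots> = (c * cnj c) * complex_of_real ((norm x)\<^sup>2)"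
    by (simp only: cinner_norm)
  also have "\<dots> = complex_of_real ((cmod c * norm x)\<^sup>2)"
    by (simp only: complex_norm_square[symmetric] power_mult_distrib of_real_mult of_real_power)
  finally have "(norm (c *\<^sub>C x))\<^sup>2 = (cmod c * norm x)\<^sup>2"
    by (simp only: of_real_eq_iff)
  then show ?thesis by (simp add: power2_eq_iff_nonneg)
qed

lemma Re_cinner_le: "Re (cinner x (y::'h::complex_hilbert_space)) \<le> norm x * norm y"
proof -
  have "(norm (x + y))\<^sup>2 \<le> (norm x + norm y)\<^sup>2"
    by (intro power_mono norm_triangle_ineq) auto
  then show ?thesis by (simp add: norm_add_sq power2_sum)
qed

lemma cmod_cinner_le: "cmod (cinner x (y::'h::complex_hilbert_space)) \<le> norm x * norm y"
proof (cases "cinner x y = 0")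
  case False
  \<comment> \<open>Rotate \<open>y\<close> so that the inner product becomes its absolute value.\<close>
  define c where "c = cnj (sgn (cinner x y))"
  have "Re (cinner x (c *\<^sub>C y)) \<le> norm x * norm (c *\<^sub>C y)" by (rule Re_cinner_le)
  moreover have "norm (c *\<^sub>C y) = norm y"
    using False by (simp add: norm_scaleC c_def norm_sgn)
  moreover have "cinner x (c *\<^sub>C y) = of_real (cmod (cinner x y))"
  proof -
    have "c * cinner x y = (cinner x y * cnj (cinner x y)) / of_real (cmod (cinner x y))"
      by (simp add: c_def sgn_eq mult.commute)
    also have "\<dots> = of_real (cmod (cinner x y))"
      using False by (simp add: complex_norm_square[symmetric] power2_eq_square)
    finally show ?thesis by (simp add: cinner_scaleC_right)
  qed
  ultimately show ?thesis by simp
qed simp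

lemma cinner_eqI: "(\<And>y::'h::complex_hilbert_space. cinner x y = cinner x' y) \<Longrightarrow> x = x'"
proof -
  assume a: "\<And>y::'h. cinner x y = cinner x' y"
  have "cinner (x - x') (x - x') = 0" using a by (simp add: cinner_diff_left)
  then show ?thesis by (simp add: cinner_norm)
qed

text \<open>The Riesz vector of a functional \<open>f\<close> minimizes \<open>\<parallel>x\<parallel>\<^sup>2 - 2 Re (f x)\<close>: by the parallelogram law
  minimizing sequences are Cauchy, and stationarity at the minimum is the representation of \<open>f\<close>.\<close>

lemma Riesz_representation:
  fixes f :: "'h::complex_hilbert_space \<Rightarrow> complex"
  assumes bl: "bounded_linear f" and cl: "\<And>c x. f (c *\<^sub>C x) = c * f x"
  shows "\<exists>v. \<forall>x. f x = cinner v x"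
proof -
  interpret f: bounded_linear f by (rule bl)
  obtain B where B: "\<And>x. cmod (f x) \<le> B * norm x"
    using f.bounded by (metis mult.commute)
  define J where "J x = (norm x)\<^sup>2 - 2 * Re (f x)" for x
  have Jlow: "J x \<ge> - B\<^sup>2" for x
  proof -
    have "Re (f x) \<le> B * norm x" using B[of x] complex_Re_le_cmod order_trans by blast
    moreover have "0 \<le> (norm x)\<^sup>2 - 2 * (B * norm x) + B\<^sup>2"
      using zero_le_power2[of "norm x - B"] by (simp add: power2_diff algebra_simps)
    ultimately show ?thesis unfolding J_def by linarith
  qed
  define m where "m = (INF x. J x)"
  have bdd: "bdd_below (range J)" using Jlow by (auto intro!: bdd_belowI)
  have m_le: "m \<le> J x" for x unfolding m_def by (rule cINF_lower[OF bdd]) simp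
  have "\<exists>x. J x < m + 1 / Suc k" for k :: nat
  proof -
    have "Inf (range J) < m + 1 / Suc k" by (simp add: m_def)
    then show ?thesis using cINF_less_iff[OF _ bdd] by blast
  qed
  then obtain s where s: "\<And>k::nat. J (s k) < m + 1 / Suc k" by metis
  have par: "(norm (x - y))\<^sup>2 = 2 * J x + 2 * J y - 4 * J ((1/2) *\<^sub>R (x + y))" for x y
  proof -
    have n: "(norm ((1/2) *\<^sub>R (x + y)))\<^sup>2 = (norm (x + y))\<^sup>2 / 4"
      by (simp add: power_divide)
    have r: "Re (f ((1/2) *\<^sub>R (x + y))) = (Re (f x) + Re (f y)) / 2"
      by (simp add: f.scaleR f.add)
    show ?thesis unfolding J_def n r norm_add_sq norm_diff_sq
      by (simp add: field_simps)
  qed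
  have est: "(norm (s k - s l))\<^sup>2 \<le> 2 / Suc k + 2 / Suc l" for k l
    using par[of "s k" "s l"] m_le[of "(1/2) *\<^sub>R (s k + s l)"] s[of k] s[of l] by simp
  have "Cauchy s"
  proof (rule metric_CauchyI)
    fix e :: real assume e: "e > 0"
    obtain M :: nat where M: "4 / e\<^sup>2 < of_nat M" using reals_Archimedean2 by blast
    have "norm (s k - s l) < e" if "k \<ge> M" "l \<ge> M" for k l
    proof -
      have e2: "e\<^sup>2 > 0" using e by simp
      have "4 < of_nat M * e\<^sup>2" using M e2 by (simp add: divide_less_eq)
      then have *: "2 / real (Suc i) < e\<^sup>2 / 2" if "i \<ge> M" for i
      proof -
        have "4 < real (Suc i) * e\<^sup>2"
          using \<open>4 < of_nat M * e\<^sup>2\<close> that e2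
          by (meson le_Suc_eq mult_right_mono of_nat_le_iff order_less_le_trans less_imp_le)
        then show ?thesis by (simp add: field_simps)
      qed
      have "(norm (s k - s l))\<^sup>2 < e\<^sup>2" using est[of k l] *[OF that(1)] *[OF that(2)] by linarith
      then show ?thesis using e by (simp add: power2_less_imp_less)
    qed
    then show "\<exists>M. \<forall>k\<ge>M. \<forall>l\<ge>M. dist (s k) (s l) < e" by (auto simp: dist_norm)
  qed
  then obtain v where v: "s \<longlonglongrightarrow> v" using Cauchy_convergent convergent_def by blast
  have "(\<lambda>k. J (s k)) \<longlonglongrightarrow> J v"
    unfolding J_def by (intro tendsto_intros f.tendsto v)
  moreover have "(\<lambda>k. m + 1 / real (Suc k)) \<longlonglongrightarrow> m + 0"
    by (intro tendsto_intros LIMSEQ_Suc[OF lim_1_over_n])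
  ultimately have "J v \<le> m + 0"
    by (rule LIMSEQ_le) (use s less_imp_le in blast)
  then have Jv: "J v \<le> J x" for x using m_le[of x] by linarith
  have re: "Re (f x) = Re (cinner v x)" for x
  proof (rule ccontr)
    assume ne: "Re (f x) \<noteq> Re (cinner v x)"
    define d where "d = Re (f x) - Re (cinner v x)"
    have d: "d \<noteq> 0" using ne by (simp add: d_def)
    \<comment> \<open>For small \<open>t\<close> of the sign of \<open>d\<close> the linear term \<open>2 * t * d\<close> beats the quadratic one.\<close>
    define t where "t = d / ((norm x)\<^sup>2 + 1)"
    have cR: "cinner v (t *\<^sub>R x) = of_real t * cinner v x"
      by (simp add: scaleR_scaleC cinner_scaleC_right)
    have "J (v + t *\<^sub>R x) = J v + t\<^sup>2 * (norm x)\<^sup>2 - 2 * t * d"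
      by (simp add: J_def norm_add_sq f.add f.scaleR cR d_def power_mult_distrib algebra_simps)
    then have "2 * t * d \<le> t\<^sup>2 * (norm x)\<^sup>2" using Jv[of "v + t *\<^sub>R x"] by simp
    moreover have "t\<^sup>2 * (norm x)\<^sup>2 \<le> t\<^sup>2 * ((norm x)\<^sup>2 + 1)" by (simp add: mult_left_mono)
    moreover have "t\<^sup>2 * ((norm x)\<^sup>2 + 1) = t * d"
    proof -
      have "(norm x)\<^sup>2 + 1 \<noteq> 0" by (metis add_nonneg_pos zero_le_power2 zero_less_one less_irrefl)
      then show ?thesis by (simp add: t_def power2_eq_square)
    qed
    moreover have "t * d > 0"
    proof -
      have "(norm x)\<^sup>2 + 1 > 0" by (simp add: add_nonneg_pos)
      moreover have "d * d > 0" using d by (simp add: zero_less_mult_iff) linarith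
      ultimately show ?thesis by (simp add: t_def)
    qed
    ultimately show False by linarith
  qed
  have "f x = cinner v x" for x
  proof (rule complex_eqI)
    show "Re (f x) = Re (cinner v x)" by (rule re)
    have "Re (f (\<i> *\<^sub>C x)) = Re (cinner v (\<i> *\<^sub>C x))" by (rule re)
    then show "Im (f x) = Im (cinner v x)" by (simp add: cl cinner_scaleC_right)
  qed
  then show ?thesis by blast
qed

lemma bounded_clinear_bound:
  assumes "bounded_clinear T"
  obtains B where "B \<ge> 0" "\<And>x. norm (T x) \<le> B * norm x"
proof -
  have "bounded_linear T" using assms by (simp add: bounded_clinear_def)
  then obtain B where "B > 0" "\<And>x. norm (T x) \<le> norm x * B"
    using bounded_linear.pos_bounded by blast
  then show ?thesis using that[of B] by (simp add: mult.commute)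
qed

lemma bounded_clinearI:
  assumes "\<And>x y. T (x + y) = T x + T y" "\<And>c x. T (c *\<^sub>C x) = c *\<^sub>C T x"
    and "\<And>x. norm (T x) \<le> B * norm x"
  shows "bounded_clinear T"
  unfolding bounded_clinear_def
proof
  show "bounded_linear T"
    by (rule bounded_linear_intro[of _ B]) (auto simp: assms scaleR_scaleC mult.commute)
qed (simp add: assms)

lemma adjoint_exists:
  fixes T :: "'h::complex_hilbert_space \<Rightarrow> 'h"
  assumes T: "bounded_clinear T"
  obtains S where "bounded_clinear S" "\<And>x y. cinner (S x) y = cinner x (T y)"
proof -
  obtain B where B: "B \<ge> 0" "\<And>x. norm (T x) \<le> B * norm x" using bounded_clinear_bound[OF T] by blast
  have T1: "T (x + y) = T x + T y" "T (c *\<^sub>C x) = c *\<^sub>C T x" for x y c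
    using T by (auto simp: bounded_clinear_def bounded_linear.axioms linear_simps)
  have "\<exists>v. \<forall>y. cinner x (T y) = cinner v y" for x
  proof (rule Riesz_representation)
    show "bounded_linear (\<lambda>y. cinner x (T y))"
    proof (rule bounded_linear_intro[of _ "norm x * B"])
      fix y z :: 'h and t :: real
      show "cinner x (T (y + z)) = cinner x (T y) + cinner x (T z)"
        by (simp add: T1 cinner_add_right)
      show "cinner x (T (t *\<^sub>R y)) = t *\<^sub>R cinner x (T y)"
        by (simp add: T1 scaleR_scaleC cinner_scaleC_right scaleR_conv_of_real)
      have "cmod (cinner x (T y)) \<le> norm x * norm (T y)" by (rule cmod_cinner_le)
      also have "\<dots> \<le> norm x * (B * norm y)" by (simp add: B mult_left_mono)
      finally show "norm (cinner x (T y)) \<le> norm y * (norm x * B)" by (simp add: mult_ac)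
    qed
  qed (simp add: T1 cinner_scaleC_right)
  then obtain S where S: "\<And>x y. cinner x (T y) = cinner (S x) y" by metis
  have "bounded_clinear S"
  proof (rule bounded_clinearI[of _ B])
    show "S (x + y) = S x + S y" for x y
      by (rule cinner_eqI) (simp add: S[symmetric] cinner_add_left)
    show "S (c *\<^sub>C x) = c *\<^sub>C S x" for c x
      by (rule cinner_eqI) (simp add: S[symmetric] cinner_scaleC_left)
    show "norm (S x) \<le> B * norm x" for x
    proof (cases "S x = 0")
      case False
      have "(norm (S x))\<^sup>2 = Re (cinner x (T (S x)))" by (simp add: norm_sq_cinner S)
      also have "\<dots> \<le> norm x * norm (T (S x))" by (rule Re_cinner_le)
      also have "\<dots> \<le> norm x * (B * norm (S x))" by (simp add: B mult_left_mono)
      finally have "norm (S x) * norm (S x) \<le> (B * norm x) * norm (S x)"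
        by (simp add: power2_eq_square mult_ac)
      then show ?thesis using False by simp
    qed (use B in auto)
  qed
  with S show ?thesis using that by metis
qed

text \<open>Since the adjoint is specified by \<open>THE\<close>, its properties need both existence and uniqueness.\<close>

lemma hadj_eqI:
  assumes "\<And>x y. cinner (S x) y = cinner x (T y)"
  shows "hadj T = S"
  unfolding hadj_def
proof (rule the_equality)
  fix S' assume a: "\<forall>x y. cinner (S' x) y = cinner x (T y)"
  show "S' = S" by (rule ext, rule cinner_eqI) (simp add: a assms)
qed (simp add: assms)

lemma bounded_clinear_hadj: "bounded_clinear T \<Longrightarrow> bounded_clinear (hadj T)"
  and cinner_hadj: "bounded_clinear T \<Longrightarrow> cinner (hadj T x) y = cinner x (T y)"
  by (metis adjoint_exists hadj_eqI)+


section \<open>The ring of bounded operators\<close>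

text \<open>Bounded operators form a type of their own so that the noncommutative ring simplification
  rules apply to them.  The type is not an instance of \<open>ring_1\<close>, because \<open>0 = 1\<close> on the zero space.\<close>

typedef (overloaded) 'h bop = "{T :: 'h::complex_hilbert_space \<Rightarrow> 'h. bounded_clinear T}"
  morphisms app Bop
  by (rule exI[of _ "\<lambda>x. 0"]) (auto intro!: bounded_clinearI[of _ 0])

setup_lifting type_definition_bop

instantiation bop :: (complex_hilbert_space) "{ring, monoid_mult}"
begin

lift_definition zero_bop :: "'a bop" is "\<lambda>x. 0"
  by (auto intro!: bounded_clinearI[of _ 0])
lift_definition one_bop :: "'a bop" is "\<lambda>x. x"
  by (auto intro!: bounded_clinearI[of _ 1])
lift_definition plus_bop :: "'a bop \<Rightarrow> 'a bop \<Rightarrow> 'a bop" is "\<lambda>S T x. S x + T x"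
  by (auto simp: bounded_clinear_def scaleC_add_right intro: bounded_linear_add)
lift_definition uminus_bop :: "'a bop \<Rightarrow> 'a bop" is "\<lambda>T x. - T x"
proof -
  fix T :: "'a \<Rightarrow> 'a" assume T: "bounded_clinear T"
  have neg: "c *\<^sub>C (- y) = - (c *\<^sub>C y)" for c and y :: 'a
    using scaleC_add_right[of c y "-y"] by (intro minus_unique[symmetric]) simp
  show "bounded_clinear (\<lambda>x. - T x)"
    using T by (auto simp: bounded_clinear_def neg intro: bounded_linear_minus)
qed
lift_definition minus_bop :: "'a bop \<Rightarrow> 'a bop \<Rightarrow> 'a bop" is "\<lambda>S T x. S x - T x"
proof -
  fix S T :: "'a \<Rightarrow> 'a" assume T: "bounded_clinear S" "bounded_clinear T"
  have neg: "c *\<^sub>C (z - y) = c *\<^sub>C z - c *\<^sub>C y" for c and y z :: 'a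
    using scaleC_add_right[of c "z - y" y] by (simp add: algebra_simps)
  show "bounded_clinear (\<lambda>x. S x - T x)"
    using T by (auto simp: bounded_clinear_def neg intro: bounded_linear_sub)
qed
lift_definition times_bop :: "'a bop \<Rightarrow> 'a bop \<Rightarrow> 'a bop" is "\<lambda>S T x. S (T x)"
  by (auto simp: bounded_clinear_def intro: bounded_linear_compose)

instance
proof
  fix S T R :: "'a bop"
  show "(S + T) * R = S * R + T * R" by transfer auto
  show "S * (T + R) = S * T + S * R"
    by transfer (auto simp: bounded_clinear_def linear_simps)
qed (transfer; auto)+

end

lift_definition adj :: "'h::complex_hilbert_space bop \<Rightarrow> 'h bop" ("_\<^sup>\<star>" [1000] 1000) is hadj
  by (rule bounded_clinear_hadj)

lemma app_simps [simp]:
  "app 0 x = 0" "app 1 x = x" "app (S + T) x = app S x + app T x" "app (S - T) x = app S x - app T x"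
  "app (- T) x = - app T x" "app (S * T) x = app S (app T x)"
  by (transfer, simp)+

lemma bounded_clinear_app: "bounded_clinear (app T)"
  by transfer

lemma bounded_linear_app: "bounded_linear (app T)"
  using bounded_clinear_app by (auto simp: bounded_clinear_def)

lemma app_linear [simp]:
  "app T 0 = 0" "app T (x + y) = app T x + app T y" "app T (x - y) = app T x - app T y"
  "app T (- x) = - app T x" "app T (c *\<^sub>C x) = c *\<^sub>C app T x"
  using bounded_linear_app[of T] bounded_clinear_app[of T]
  by (auto simp: linear_simps bounded_clinear_def)

lemma bop_eqI: "(\<And>x. app S x = app T x) \<Longrightarrow> S = T"
  by (metis app_inject ext)

lemma cinner_adj: "cinner (app (T\<^sup>\<star>) x) y = cinner x (app T y)"
  by transfer (rule cinner_hadj)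

lemma cinner_adj': "cinner x (app (T\<^sup>\<star>) y) = cinner (app T x) y"
  by (metis cinner_adj cinner_commute)

lemma adj_eqI: "(\<And>x y. cinner (app S x) y = cinner x (app T y)) \<Longrightarrow> T\<^sup>\<star> = S"
  by (rule bop_eqI, rule cinner_eqI) (simp add: cinner_adj)

lemma adj_adj [simp]: "T\<^sup>\<star>\<^sup>\<star> = T"
  by (rule adj_eqI) (simp add: cinner_adj')

lemma adj_mult [simp]: "(S * T)\<^sup>\<star> = T\<^sup>\<star> * S\<^sup>\<star>"
  by (rule adj_eqI) (simp add: cinner_adj)

lemma adj_add [simp]: "(S + T)\<^sup>\<star> = S\<^sup>\<star> + T\<^sup>\<star>"
  and adj_diff [simp]: "(S - T)\<^sup>\<star> = S\<^sup>\<star> - T\<^sup>\<star>"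
  and adj_one [simp]: "1\<^sup>\<star> = 1"
  and adj_zero [simp]: "0\<^sup>\<star> = 0"
  by (rule adj_eqI; simp add: cinner_adj cinner_distribs)+

lemma adj_eq_iff: "S\<^sup>\<star> = T\<^sup>\<star> \<longleftrightarrow> S = T"
  by (metis adj_adj)

lemma norm_app_sq: "(norm (app T x))\<^sup>2 = Re (cinner x (app (T\<^sup>\<star> * T) x))"
  by (simp add: norm_sq_cinner cinner_adj')

lemma adj_mult_self_eq_0D: "T\<^sup>\<star> * T = 0 \<Longrightarrow> T = 0"
proof (rule bop_eqI)
  fix x assume "T\<^sup>\<star> * T = 0"
  then have "(norm (app T x))\<^sup>2 = 0" by (simp only: norm_app_sq app_simps cinner_zero_right) simp
  then show "app T x = app 0 x" by simp
qed

lemma closed_csubspace_vimage: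
  assumes K: "closed_csubspace K"
  shows "closed_csubspace (app T -` K)"
  using K unfolding closed_csubspace_def
  by (auto intro!: closed_vimage linear_continuous_on continuous_on_subset
      simp: bounded_linear_app linear_continuous_on)

lemma closed_csubspace_eqs: "closed_csubspace {x. app S x = app T x}"
  unfolding closed_csubspace_def
  by (auto intro!: closed_Collect_eq linear_continuous_on bounded_linear_app)

lemma closed_csubspace_uminus:
  assumes "closed_csubspace K" "x \<in> K"
  shows "- x \<in> K"
proof -
  have "- x = complex_of_real (-1) *\<^sub>C x" by (simp only: scaleR_scaleC[symmetric]) simp
  then show ?thesis using assms unfolding closed_csubspace_def by metis
qed

lemma app_eq_zero_iff: "app T = (\<lambda>x. 0) \<longleftrightarrow> T = 0"
  by (auto intro!: bop_eqI simp: fun_eq_iff)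

lemma adj_uminus [simp]: "(- S)\<^sup>\<star> = - S\<^sup>\<star>"
  by (rule adj_eqI) (simp add: cinner_adj cinner_minus_left cinner_minus_right)

lemma app_bound:
  obtains c where "c \<ge> 0" "\<And>x. norm (app T x) \<le> c * norm x"
  using bounded_clinear_bound[OF bounded_clinear_app] by blast

lemma norm_adj_le:
  assumes "\<And>x. norm (app T x) \<le> c * norm x"
  shows "norm (app (T\<^sup>\<star>) x) \<le> c * norm x"
proof (cases "app (T\<^sup>\<star>) x = 0")
  case True
  have "0 \<le> norm (app T x)" by simp
  also have "\<dots> \<le> c * norm x" by (rule assms)
  finally show ?thesis using True by simp
next
  case False
  have "(norm (app (T\<^sup>\<star>) x))\<^sup>2 = Re (cinner x (app T (app (T\<^sup>\<star>) x)))" by (simp add: norm_app_sq)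
  also have "\<dots> \<le> norm x * norm (app T (app (T\<^sup>\<star>) x))" by (rule Re_cinner_le)
  also have "\<dots> \<le> norm x * (c * norm (app (T\<^sup>\<star>) x))" by (intro mult_left_mono assms) simp
  finally have "norm (app (T\<^sup>\<star>) x) * norm (app (T\<^sup>\<star>) x) \<le> (c * norm x) * norm (app (T\<^sup>\<star>) x)"
    by (simp add: power2_eq_square mult_ac)
  then show ?thesis using False by simp
qed

lemma app_power: "app T ^^ k = app (T ^ k)"
  by (induction k) (auto simp: fun_eq_iff)

lemma hadj_app: "hadj (app T) = app (T\<^sup>\<star>)"
  by (simp add: adj.rep_eq)

lemma bounded_linear_scaleC: "bounded_linear (\<lambda>x :: 'h::complex_hilbert_space. d *\<^sub>C x)"
  by (rule bounded_linear_intro[of _ "cmod d"])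
    (simp_all add: scaleC_add_right scaleR_scaleC scaleC_scaleC mult.commute norm_scaleC)

lemma adj_sum_squares_eq_0D:
  assumes "S\<^sup>\<star> * S + T\<^sup>\<star> * T = 0"
  shows "S = 0"
proof (rule bop_eqI)
  fix x
  have "(norm (app S x))\<^sup>2 + (norm (app T x))\<^sup>2 = Re (cinner x (app (S\<^sup>\<star> * S + T\<^sup>\<star> * T) x))"
    by (simp only: norm_app_sq app_simps cinner_add_right) simp
  also have "\<dots> = 0" unfolding assms by simp
  finally have "(norm (app S x))\<^sup>2 = 0" by (smt (verit) zero_le_power2)
  then show "app S x = app 0 x" by simp
qed

lemma projection_range_eq:
  assumes P: "P = a\<^sup>\<star> * a" "P * P = P"
  shows "a * P = a"
proof -
  have "(a - a * P)\<^sup>\<star> * (a - a * P) = (1 - P) * P * (1 - P)"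
    by (simp add: P algebra_simps)
  also have "\<dots> = 0" using P(2) by (simp add: algebra_simps)
  finally show ?thesis using adj_mult_self_eq_0D by fastforce
qed

text \<open>Compressed to the complement of \<open>P\<close>, the identity \<open>a a\<^sup>\<star> + b\<^sup>\<star> b = P\<close> exhibits zero as a sum of two positive
  operators; so the range of \<open>a\<close> lies below \<open>P\<close>, and a difference of nested projections is a projection.\<close>

lemma projection_defect:
  assumes P: "P = a\<^sup>\<star> * a" "P * P = P" and defect: "P - a * a\<^sup>\<star> = b\<^sup>\<star> * b"
  shows "P * a = a" and "(b\<^sup>\<star> * b) * (b\<^sup>\<star> * b) = b\<^sup>\<star> * b"
proof -
  have sP: "P\<^sup>\<star> = P" by (simp add: P(1))
  have aP: "a * P = a" by (rule projection_range_eq[OF P])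
  have Pas: "P * a\<^sup>\<star> = a\<^sup>\<star>" using arg_cong[OF aP, of adj] by (simp add: sP)
  have "(a\<^sup>\<star> * (1 - P))\<^sup>\<star> * (a\<^sup>\<star> * (1 - P)) + (b * (1 - P))\<^sup>\<star> * (b * (1 - P))
      = (1 - P) * (a * a\<^sup>\<star> + b\<^sup>\<star> * b) * (1 - P)"
    by (simp add: sP algebra_simps)
  also have "\<dots> = (1 - P) * P * (1 - P)" by (simp add: defect[symmetric])
  also have "\<dots> = 0" using P(2) by (simp add: algebra_simps)
  finally have "a\<^sup>\<star> * (1 - P) = 0" by (rule adj_sum_squares_eq_0D)
  from arg_cong[OF this, of adj] show Pa: "P * a = a" by (simp add: sP algebra_simps)
  have asP: "a\<^sup>\<star> * P = a\<^sup>\<star>" using arg_cong[OF Pa, of adj] by (simp add: sP)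
  have 1: "P * (a * a\<^sup>\<star>) = a * a\<^sup>\<star>" by (simp add: Pa mult.assoc[symmetric])
  have 2: "a * a\<^sup>\<star> * P = a * a\<^sup>\<star>" by (simp add: asP mult.assoc)
  have "a * a\<^sup>\<star> * (a * a\<^sup>\<star>) = a * P * a\<^sup>\<star>" by (simp add: P(1) mult.assoc)
  then have 3: "a * a\<^sup>\<star> * (a * a\<^sup>\<star>) = a * a\<^sup>\<star>" by (simp add: aP)
  show "(b\<^sup>\<star> * b) * (b\<^sup>\<star> * b) = b\<^sup>\<star> * b"
    unfolding defect[symmetric] left_diff_distrib right_diff_distrib P(2) 1 2 3 by simp
qed


section \<open>Ordered products\<close>

lemma commute_mult_right:
  "\<lbrakk>S * A = A * S; S * B = B * S\<rbrakk> \<Longrightarrow> S * (A * B) = A * B * (S :: 'a::semigroup_mult)"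
  by (metis mult.assoc)

lemma commute_mult_left:
  "\<lbrakk>A * S = S * A; B * S = S * B\<rbrakk> \<Longrightarrow> A * B * S = S * (A * (B :: 'a::semigroup_mult))"
  by (metis mult.assoc)

definition seg :: "(nat \<Rightarrow> 'a::monoid_mult) \<Rightarrow> nat \<Rightarrow> nat \<Rightarrow> 'a" where
  "seg f a b = prod_list (map f [a..<Suc b])"

lemma seg_empty [simp]: "b < a \<Longrightarrow> seg f a b = 1"
  by (simp add: seg_def)

lemma seg_last: "a \<le> Suc b \<Longrightarrow> seg f a (Suc b) = seg f a b * f (Suc b)"
  by (simp add: seg_def)

lemma seg_first: "a \<le> b \<Longrightarrow> seg f a b = f a * seg f (a + 1) b"
  by (simp add: seg_def upt_conv_Cons del: upt_Suc)

lemma seg_split: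
  assumes "a \<le> b + 1" "b \<le> c"
  shows "seg f a c = seg f a b * seg f (b + 1) c"
proof -
  have "[a..<Suc c] = [a..<Suc b] @ [Suc b..<Suc c]"
    using assms upt_add_eq_append[of a "Suc b" "c - b"] by simp
  then show ?thesis by (simp add: seg_def del: upt_Suc)
qed

lemma prod_list_closed:
  assumes "P 1" "\<And>x y. P x \<Longrightarrow> P y \<Longrightarrow> P (x * y)" "\<And>x. x \<in> set xs \<Longrightarrow> P x"
  shows "P (prod_list xs)"
  using assms(3) by (induction xs) (auto intro: assms(1,2))

lemma seg_closed:
  assumes "P 1" "\<And>x y. P x \<Longrightarrow> P y \<Longrightarrow> P (x * y)" "\<And>m. a \<le> m \<Longrightarrow> m \<le> b \<Longrightarrow> P (f m)"
  shows "P (seg f a b)"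
  unfolding seg_def by (rule prod_list_closed) (auto simp del: upt_Suc intro: assms)

lemma seg_commute:
  assumes "\<And>m. a \<le> m \<Longrightarrow> m \<le> b \<Longrightarrow> f m * c = c * f m"
  shows "seg f a b * c = c * seg f a b"
  by (rule seg_closed[where P = "\<lambda>x. x * c = c * x"]) (simp_all add: assms, metis mult.assoc)


section \<open>The last row\<close>

text \<open>The locale collects the relations of the crystallized algebra, as relations between operators,
  with \<open>N\<close> for \<open>n + 1\<close>.\<close>

locale crystal_relations =
  fixes N :: nat and Z :: "nat \<Rightarrow> nat \<Rightarrow> 'h::complex_hilbert_space bop"
  assumes N_pos: "1 \<le> N"
    and row_zero: "\<lbrakk>1 \<le> i; i \<le> N; 1 \<le> j; j < l; l \<le> N\<rbrakk> \<Longrightarrow> Z i j * Z i l = 0"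
    and col_zero: "\<lbrakk>1 \<le> i; i < k; k \<le> N; 1 \<le> j; j \<le> N\<rbrakk> \<Longrightarrow> Z i j * Z k j = 0"
    and anti_comm: "\<lbrakk>1 \<le> i; i < k; k \<le> N; 1 \<le> j; j < l; l \<le> N\<rbrakk> \<Longrightarrow> Z i l * Z k j = Z k j * Z i l"
    and anti_zero: "\<lbrakk>1 \<le> i; i < k; k \<le> N; 1 \<le> j; j < l; l \<le> N; min k l \<le> max i j\<rbrakk> \<Longrightarrow>
      Z i l * Z k j = 0"
    and cross: "\<lbrakk>1 \<le> i; i < k; k \<le> N; 1 \<le> j; j < l; l \<le> N; max i j + 1 = min k l\<rbrakk> \<Longrightarrow>
      Z i j * Z k l - Z k l * Z i j = Z i l * Z k j"
    and diag_comm: "\<lbrakk>1 \<le> i; i < k; k \<le> N; 1 \<le> j; j < l; l \<le> N; max i j + 1 < min k l\<rbrakk> \<Longrightarrow>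
      Z i j * Z k l = Z k l * Z i j"
    and diag_one: "seg (\<lambda>m. Z m m) 1 N = 1"
    and star_comm: "\<lbrakk>1 \<le> i; i \<le> N; 1 \<le> j; j \<le> N; 1 \<le> k; k \<le> N; 1 \<le> l; l \<le> N; i \<noteq> k; j \<noteq> l\<rbrakk> \<Longrightarrow>
      Z i j * (Z k l)\<^sup>\<star> = (Z k l)\<^sup>\<star> * Z i j"
    and star_lower: "\<lbrakk>1 \<le> j; j < i; i \<le> N\<rbrakk> \<Longrightarrow> (Z i j)\<^sup>\<star> =
      seg (\<lambda>m. Z m m) 1 (j - 1) * seg (\<lambda>m. Z m (m + 1)) j (i - 1) * seg (\<lambda>m. Z m m) (i + 1) N"
    and star_diag: "\<lbrakk>1 \<le> i; i \<le> N\<rbrakk> \<Longrightarrow> (Z i i)\<^sup>\<star> =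
      seg (\<lambda>m. Z m m) 1 (i - 1) * seg (\<lambda>m. Z m m) (i + 1) N"
begin

\<comment> \<open>Indices keep the forms \<open>1\<close> and \<open>j - 1\<close> in which they occur in the relations.\<close>
declare One_nat_def [simp del]

abbreviation a :: "nat \<Rightarrow> 'h bop" where "a l \<equiv> Z N l"
abbreviation D :: "nat \<Rightarrow> 'h bop" where "D k \<equiv> seg (\<lambda>m. Z m m) 1 k"
abbreviation E :: "nat \<Rightarrow> 'h bop" where "E k \<equiv> seg (\<lambda>m. Z m m) k N"
abbreviation U :: "nat \<Rightarrow> nat \<Rightarrow> 'h bop" where "U j i \<equiv> seg (\<lambda>m. Z m (m + 1)) j i"

definition Q :: "nat \<Rightarrow> 'h bop" where "Q l = (a l)\<^sup>\<star> * a l"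

text \<open>Relations between a row \<open>i < N\<close> and the last row.  The commutator of \<open>Z i j\<close> with \<open>a l\<close> is
  the subject of no relation if \<open>j < l \<le> i\<close>; for \<open>i \<le> j\<close> this range is empty.\<close>

lemma a_row: "\<lbrakk>1 \<le> j; j < l; l \<le> N\<rbrakk> \<Longrightarrow> a j * a l = 0"
  using row_zero N_pos by blast

lemma Z_a_same: "\<lbrakk>1 \<le> i; i < N; 1 \<le> j; j \<le> N\<rbrakk> \<Longrightarrow> Z i j * a j = 0"
  using col_zero by blast

lemma Z_a_below: "\<lbrakk>1 \<le> i; i < N; 1 \<le> l; l < j; j \<le> N\<rbrakk> \<Longrightarrow> Z i j * a l = a l * Z i j"
  using anti_comm by blast

lemma Z_a_below_zero: "\<lbrakk>1 \<le> i; i < N; 1 \<le> l; l < j; j \<le> i\<rbrakk> \<Longrightarrow> Z i j * a l = 0"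
  using anti_zero[of i N l j] by simp

lemma Z_a_next:
  assumes "1 \<le> i" "i \<le> j" "j < N"
  shows "Z i j * a (j + 1) = a (j + 1) * Z i j + Z i (j + 1) * a j"
  using cross[of i N j "j + 1"] assms by (simp add: algebra_simps)

lemma Z_a_above: "\<lbrakk>1 \<le> i; i \<le> j; j + 1 < l; l \<le> N\<rbrakk> \<Longrightarrow> Z i j * a l = a l * Z i j"
  using diag_comm[of i N j l] by simp

lemma Z_a_adj: "\<lbrakk>1 \<le> i; i < N; 1 \<le> j; j \<le> N; 1 \<le> l; l \<le> N; l \<noteq> j\<rbrakk> \<Longrightarrow> Z i j * (a l)\<^sup>\<star> = (a l)\<^sup>\<star> * Z i j"
  using star_comm[of i j N l] by simp

lemma Zadj_a:
  assumes "1 \<le> i" "i < N" "1 \<le> j" "j \<le> N" "1 \<le> l" "l \<le> N" "l \<noteq> j"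
  shows "(Z i j)\<^sup>\<star> * a l = a l * (Z i j)\<^sup>\<star>"
  using arg_cong[OF Z_a_adj[OF assms], of adj] by simp

text \<open>This is the relation for the adjoints in the last row; for \<open>j = N\<close> the product \<open>U N (N - 1)\<close> is empty.\<close>

lemma a_adj: "\<lbrakk>1 \<le> j; j \<le> N\<rbrakk> \<Longrightarrow> (a j)\<^sup>\<star> = D (j - 1) * U j (N - 1)"
  using star_lower[of j N] star_diag[of N] N_pos by (cases "j = N") auto

lemma Q_top: "Q N = 1"
proof -
  obtain M where M: "N = Suc M" using N_pos by (cases N) auto
  have "Q N = D (N - 1) * Z N N" unfolding Q_def using a_adj[of N] N_pos by simp
  also have "\<dots> = D N" using seg_last[of 1 M "\<lambda>m. Z m m"] by (simp add: M)
  finally show ?thesis using diag_one by simp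
qed

lemma a_1_normal: "a 1 * (a 1)\<^sup>\<star> = Q 1"
proof -
  have "U 1 (N - 1) * a 1 = a 1 * U 1 (N - 1)"
    by (rule seg_commute) (rule Z_a_below, auto)
  then show ?thesis using a_adj[of 1] N_pos by (simp add: Q_def)
qed

text \<open>Moving \<open>a j\<close> through \<open>(a j)\<^sup>\<star> = D (j - 1) * U j (N - 1)\<close> costs a single commutator, with
  \<open>Z (j - 1) (j - 1)\<close>, and that commutator produces \<open>(a (j - 1))\<^sup>\<star> * a (j - 1)\<close>.\<close>

lemma Q_step:
  assumes j: "2 \<le> j" "j \<le> N"
  shows "Q j - a j * (a j)\<^sup>\<star> = Q (j - 1)"
proof -
  obtain k where k: "j = Suc (Suc k)" using j by (metis Suc_le_D numeral_2_eq_2 Suc_le_mono)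
  let ?U = "U j (N - 1)" and ?z = "Z (j - 1) (j - 1)"
  have U1: "?U * a j = a j * ?U" by (rule seg_commute) (rule Z_a_below, use j in auto)
  have U2: "?U * a (j - 1) = a (j - 1) * ?U" by (rule seg_commute) (rule Z_a_below, use j in auto)
  have D: "D k * a j = a j * D k" by (rule seg_commute) (rule Z_a_above, use j k in auto)
  have Dj: "D (j - 1) = D k * ?z" by (simp add: k seg_last)
  have z: "?z * a j = a j * ?z + Z (j - 1) j * a (j - 1)"
    using Z_a_next[of "j - 1" "j - 1"] j by simp
  have U: "U (j - 1) (N - 1) = Z (j - 1) j * ?U"
    using seg_first[of "j - 1" "N - 1" "\<lambda>m. Z m (m + 1)"] j by simp
  have "a j * (a j)\<^sup>\<star> = D k * (a j * ?z) * ?U"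
    using j by (simp add: a_adj Dj mult.assoc[symmetric] D)
  also have "a j * ?z = ?z * a j - Z (j - 1) j * a (j - 1)" by (simp add: z)
  also have "D k * (?z * a j - Z (j - 1) j * a (j - 1)) * ?U
      = D (j - 1) * (a j * ?U) - D k * Z (j - 1) j * (a (j - 1) * ?U)"
    by (simp add: Dj algebra_simps)
  also have "\<dots> = D (j - 1) * ?U * a j - D k * (Z (j - 1) j * ?U) * a (j - 1)"
    by (simp only: U1[symmetric] U2[symmetric] mult.assoc)
  also have "D (j - 1) * ?U = (a j)\<^sup>\<star>" using a_adj[of j] j by simp
  also have "D k * (Z (j - 1) j * ?U) = (a (j - 1))\<^sup>\<star>"
    using a_adj[of "j - 1", unfolded U] j by (simp add: k)
  finally show ?thesis by (simp add: Q_def)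
qed

lemma Q_adj [simp]: "(Q l)\<^sup>\<star> = Q l"
  by (simp add: Q_def)

text \<open>Downward induction from \<open>Q N = 1\<close>: by \<open>Q_step\<close> the defect of \<open>a (l + 1)\<close> has the form \<open>b\<^sup>\<star> * b\<close>,
  as \<open>projection_defect\<close> requires.\<close>

lemma Q_idem:
  assumes "1 \<le> l" "l \<le> N"
  shows "Q l * Q l = Q l"
  using assms(2,1)
proof (induction l rule: inc_induct)
  case base
  show ?case by (simp add: Q_top)
next
  case (step l)
  show ?case
    using projection_defect(2)[of "Q (Suc l)" "a (Suc l)" "a l"] step Q_step[of "Suc l"]
    by (simp add: Q_def)
qed

lemma a_Q_same: "\<lbrakk>1 \<le> l; l \<le> N\<rbrakk> \<Longrightarrow> a l * Q l = a l"
  by (rule projection_range_eq) (auto simp: Q_def Q_idem[unfolded Q_def])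

lemma Q_a_same:
  assumes "1 \<le> l" "l \<le> N"
  shows "Q l * a l = a l"
proof (cases "l = 1")
  case True
  have "Q 1 * a 1 = a 1 * (a 1)\<^sup>\<star> * a 1" by (simp only: a_1_normal)
  also have "\<dots> = a 1 * Q 1" by (simp only: Q_def mult.assoc)
  finally have "Q 1 * a 1 = a 1 * Q 1" .
  then show ?thesis using a_Q_same[of 1] assms True by simp
next
  case False
  then show ?thesis
    using projection_defect(1)[of "Q l" "a l" "a (l - 1)"] assms Q_step[of l] Q_idem[of l]
    by (simp add: Q_def)
qed

lemma aadj_Q_same: "\<lbrakk>1 \<le> l; l \<le> N\<rbrakk> \<Longrightarrow> (a l)\<^sup>\<star> * Q l = (a l)\<^sup>\<star>"
  using arg_cong[OF Q_a_same, of l adj] by simp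

lemma Q_aadj_same: "\<lbrakk>1 \<le> l; l \<le> N\<rbrakk> \<Longrightarrow> Q l * (a l)\<^sup>\<star> = (a l)\<^sup>\<star>"
  using arg_cong[OF a_Q_same, of l adj] by simp

lemma Q_mono:
  assumes "1 \<le> l" "l \<le> m" "m \<le> N"
  shows "Q l * Q m = Q l"
  using assms(2,3)
proof (induction m rule: dec_induct)
  case base
  then show ?case using assms by (simp add: Q_idem)
next
  case (step m)
  have e: "Q m = Q (Suc m) - a (Suc m) * (a (Suc m))\<^sup>\<star>" using Q_step[of "Suc m"] step assms by simp
  have "Q m * Q (Suc m) = Q m"
    unfolding e using step assms Q_idem[of "Suc m"] aadj_Q_same[of "Suc m"]
    by (simp add: mult.assoc left_diff_distrib)
  then show ?case using step by (metis Suc_leD mult.assoc)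
qed

lemma Q_mono': "\<lbrakk>1 \<le> l; l \<le> m; m \<le> N\<rbrakk> \<Longrightarrow> Q m * Q l = Q l"
  using arg_cong[OF Q_mono, of l m adj] by simp

text \<open>The range of \<open>a j\<close> is orthogonal to the range of \<open>Q (j - 1)\<close>, which contains the ranges of all \<open>a l\<close>
  with \<open>l < j\<close>.\<close>

lemma aadj_a_diff:
  assumes "1 \<le> l" "l \<le> N" "1 \<le> j" "j \<le> N" "l \<noteq> j"
  shows "(a l)\<^sup>\<star> * a j = 0"
proof -
  have *: "(a l)\<^sup>\<star> * a j = 0" if "1 \<le> l" "l < j" "j \<le> N" for l j
  proof -
    have "Q (j - 1) * a j = (Q j - a j * (a j)\<^sup>\<star>) * a j" using Q_step[of j] that by simp
    also have "\<dots> = Q j * a j - a j * Q j" by (simp add: Q_def algebra_simps)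
    finally have "Q (j - 1) * a j = 0" using that by (simp add: Q_a_same a_Q_same)
    moreover have "(a l)\<^sup>\<star> = (a l)\<^sup>\<star> * Q (j - 1)"
    proof -
      have "Q l * Q (j - 1) = Q l" using that by (intro Q_mono) auto
      moreover have "(a l)\<^sup>\<star> = (a l)\<^sup>\<star> * Q l" using that aadj_Q_same by simp
      ultimately show ?thesis by (metis mult.assoc)
    qed
    ultimately show ?thesis by (metis mult.assoc mult_zero_right)
  qed
  show ?thesis
  proof (cases "l < j")
    case False
    then show ?thesis using arg_cong[OF *[of j l], of adj] assms by simp
  qed (use * assms in auto)
qed

lemma Q_a: "\<lbrakk>1 \<le> j; j \<le> l; l \<le> N\<rbrakk> \<Longrightarrow> Q l * a j = a j"
  using Q_a_same[of j] Q_mono'[of j l] mult.assoc[of "Q l" "Q j" "a j"] by simp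

lemma a_Q: "\<lbrakk>1 \<le> j; j \<le> l; l \<le> N\<rbrakk> \<Longrightarrow> a j * Q l = a j"
  using a_Q_same[of j] Q_mono[of j l] mult.assoc[of "a j" "Q j" "Q l"] by simp

lemma Q_a_zero: "\<lbrakk>1 \<le> l; l < j; j \<le> N\<rbrakk> \<Longrightarrow> Q l * a j = 0"
  by (simp add: Q_def mult.assoc a_row)

text \<open>The range projections \<open>a l * (a l)\<^sup>\<star>\<close> add up to the identity, because \<open>Q l - Q (l - 1)\<close> telescopes.\<close>

lemma row_total:
  assumes "\<And>l. \<lbrakk>1 \<le> l; l \<le> N\<rbrakk> \<Longrightarrow> (a l)\<^sup>\<star> * T = 0"
  shows "T = 0"
proof -
  have "Q m * T = 0" if "1 \<le> m" "m \<le> N" for m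
    using that
  proof (induction m rule: dec_induct)
    case base
    show ?case using assms[of 1] N_pos by (simp only: a_1_normal[symmetric] mult.assoc) simp
  next
    case (step m)
    have "Q (Suc m) = Q m + a (Suc m) * (a (Suc m))\<^sup>\<star>"
      using Q_step[of "Suc m"] step by (simp add: algebra_simps)
    then show ?case using step assms[of "Suc m"] by (simp add: distrib_right mult.assoc)
  qed
  from this[of N] show ?thesis using N_pos by (simp add: Q_top)
qed

lemma Zadj_a_top: "\<lbrakk>1 \<le> i; i < N\<rbrakk> \<Longrightarrow> (Z i N)\<^sup>\<star> * a N = 0"
proof (rule row_total)
  fix l assume i: "1 \<le> i" "i < N" and l: "1 \<le> l" "l \<le> N"
  show "(a l)\<^sup>\<star> * ((Z i N)\<^sup>\<star> * a N) = 0"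
  proof (cases "l = N")
    case True
    have "(a N)\<^sup>\<star> * (Z i N)\<^sup>\<star> = 0" using arg_cong[OF Z_a_same[of i N], of adj] i by simp
    then show ?thesis using True by (metis mult.assoc mult_zero_left)
  next
    case False
    then have "(a l)\<^sup>\<star> * (Z i N)\<^sup>\<star> = (Z i N)\<^sup>\<star> * (a l)\<^sup>\<star>"
      using arg_cong[OF Z_a_below[of i l N], of adj] i l by simp
    then show ?thesis using aadj_a_diff[of l N] l False by (simp add: mult.assoc[symmetric]) (simp add: mult.assoc)
  qed
qed

text \<open>The product of \<open>(Z i j)\<^sup>\<star>\<close> with \<open>a j\<close> appears in none of the relations; it is found by
  multiplying with all \<open>(a l)\<^sup>\<star>\<close> from the left.\<close>

lemma Zadj_a_same:
  assumes i: "1 \<le> i" "i \<le> j" "j < N"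
  shows "(Z i j)\<^sup>\<star> * a j = a (j + 1) * Q j * (Z i (j + 1))\<^sup>\<star>"
proof -
  let ?T = "(Z i j)\<^sup>\<star> * a j - a (j + 1) * Q j * (Z i (j + 1))\<^sup>\<star>"
  have "?T = 0"
  proof (rule row_total)
    fix l assume l: "1 \<le> l" "l \<le> N"
    have ne: "(a l)\<^sup>\<star> * (a (j + 1) * Q j * (Z i (j + 1))\<^sup>\<star>) = 0" if "l \<noteq> j + 1"
      using aadj_a_diff[of l "j + 1"] that l i by (simp add: mult.assoc[symmetric])
    have comm: "(a l)\<^sup>\<star> * ((Z i j)\<^sup>\<star> * a j) = 0" if "Z i j * a l = a l * Z i j" "l \<noteq> j"
    proof -
      have "(a l)\<^sup>\<star> * (Z i j)\<^sup>\<star> = (Z i j)\<^sup>\<star> * (a l)\<^sup>\<star>" using arg_cong[OF that(1), of adj] by simp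
      then have "(a l)\<^sup>\<star> * ((Z i j)\<^sup>\<star> * a j) = (Z i j)\<^sup>\<star> * ((a l)\<^sup>\<star> * a j)" by (simp add: mult.assoc[symmetric])
      then show ?thesis using aadj_a_diff[of l j] that l i by simp
    qed
    consider "l < j" | "l = j" | "l = j + 1" | "l > j + 1" by linarith
    then show "(a l)\<^sup>\<star> * ?T = 0"
    proof cases
      case 1
      then show ?thesis using ne comm Z_a_below[of i l j] l i by (simp add: right_diff_distrib)
    next
      case 2
      have "(a j)\<^sup>\<star> * (Z i j)\<^sup>\<star> = 0" using arg_cong[OF Z_a_same[of i j], of adj] i by simp
      then show ?thesis using ne 2 by (simp add: right_diff_distrib mult.assoc[symmetric])
    next
      case 3
      have "(a (j+1))\<^sup>\<star> * (Z i j)\<^sup>\<star> = (Z i j)\<^sup>\<star> * (a (j+1))\<^sup>\<star> + (a j)\<^sup>\<star> * (Z i (j+1))\<^sup>\<star>"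
        using arg_cong[OF Z_a_next[of i j], of adj] i by (simp add: algebra_simps)
      then have "(a (j+1))\<^sup>\<star> * ((Z i j)\<^sup>\<star> * a j) = (Z i j)\<^sup>\<star> * ((a (j+1))\<^sup>\<star> * a j) + (a j)\<^sup>\<star> * ((Z i (j+1))\<^sup>\<star> * a j)"
        by (simp add: mult.assoc[symmetric] distrib_right)
      also have "\<dots> = Q j * (Z i (j+1))\<^sup>\<star>"
        using aadj_a_diff[of "j+1" j] Zadj_a[of i "j+1" j] i by (simp add: Q_def mult.assoc)
      finally have 4: "(a (j+1))\<^sup>\<star> * ((Z i j)\<^sup>\<star> * a j) = Q j * (Z i (j+1))\<^sup>\<star>" .
      have "(a (j+1))\<^sup>\<star> * (a (j + 1) * Q j * (Z i (j + 1))\<^sup>\<star>) = (Q (j+1) * Q j) * (Z i (j + 1))\<^sup>\<star>"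
        by (simp add: Q_def mult.assoc)
      then show ?thesis using 3 4 Q_mono'[of j "j+1"] i by (simp add: right_diff_distrib)
    next
      case 4
      then show ?thesis using ne comm Z_a_above[of i j l] l i by (simp add: right_diff_distrib)
    qed
  qed
  then show ?thesis by simp
qed

end


section \<open>Generation from the range of the first nonzero entry\<close>

text \<open>Irreducibility is stated for the generators and their adjoints, which is what can be computed with;
  \<open>invariant_if_generators_invariant\<close> links it to the whole algebra.\<close>

locale crystal_irrep = crystal_relations N Z
  for N and Z :: "nat \<Rightarrow> nat \<Rightarrow> 'h::complex_hilbert_space bop" +
  fixes r :: nat
  assumes r_pos: "1 \<le> r" and r_less: "r < N" and a_r_nonzero: "a r \<noteq> 0"
    and a_below: "\<lbrakk>1 \<le> l; l < r\<rbrakk> \<Longrightarrow> a l = 0"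
    and irreducible: "\<lbrakk>closed_csubspace K;
      \<And>i j x. \<lbrakk>1 \<le> i; i \<le> N; 1 \<le> j; j \<le> N; x \<in> K\<rbrakk> \<Longrightarrow>
        app (Z i j) x \<in> K \<and> app ((Z i j)\<^sup>\<star>) x \<in> K\<rbrakk> \<Longrightarrow> K = {0} \<or> K = UNIV"
begin

lemma Q_below: "\<lbrakk>1 \<le> l; l < r\<rbrakk> \<Longrightarrow> Q l = 0"
  by (simp add: Q_def a_below)

lemma a_r_normal: "a r * (a r)\<^sup>\<star> = Q r"
proof (cases "r = 1")
  case False
  then have "Q (r - 1) = 0" using Q_below r_pos by simp
  then show ?thesis using Q_step[of r] r_pos r_less False by simp
qed (use a_1_normal in simp)

text \<open>When \<open>r = j + 1\<close> the commutator contains the factor \<open>a j\<close>, which is zero because \<open>j < r\<close>.\<close>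

lemma Z_a_r:
  assumes "1 \<le> i" "i \<le> j" "i < N" "j \<le> N" "j \<noteq> r"
  shows "Z i j * a r = a r * Z i j"
proof -
  consider "r < j" | "j + 1 = r" | "j + 1 < r" using assms by linarith
  then show ?thesis
  proof cases
    case 1
    then show ?thesis using Z_a_below assms r_pos by simp
  next
    case 2
    then have "j < N" "a j = 0" using a_below assms r_less by auto
    then show ?thesis using Z_a_next[of i j] assms 2 by simp
  next
    case 3
    then show ?thesis using Z_a_above assms r_less by simp
  qed
qed

text \<open>The vectors \<open>a l\<^sub>1 \<dots> a l\<^sub>m x\<close> with \<open>l\<^sub>i > r\<close> and \<open>x\<close> in the range of \<open>Q r\<close> span \<open>generated\<close>.\<close>

definition generating :: "'h set \<Rightarrow> bool" where
  "generating S \<longleftrightarrow> closed_csubspace S \<and> (\<forall>x. app (Q r) x \<in> S) \<and>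
     (\<forall>l\<in>{r<..N}. \<forall>x\<in>S. app (a l) x \<in> S)"

definition generated :: "'h set" where
  "generated = \<Inter>{S. generating S}"

lemma generated_least: "generating S \<Longrightarrow> generated \<subseteq> S"
  by (auto simp: generated_def)

lemma generating_generated: "generating generated"
proof -
  have "closed (\<Inter>{S. generating S})"
    by (rule closed_Inter) (auto simp: generating_def closed_csubspace_def)
  moreover have "\<forall>x\<in>generated. \<forall>y\<in>generated. x + y \<in> generated"
    by (auto simp: generated_def) (auto simp: generating_def closed_csubspace_def)
  moreover have "\<forall>c. \<forall>x\<in>generated. c *\<^sub>C x \<in> generated"
    by (auto simp: generated_def) (auto simp: generating_def closed_csubspace_def)
  moreover have "0 \<in> generated" "\<forall>x. app (Q r) x \<in> generated"
    by (auto simp: generated_def) (auto simp: generating_def closed_csubspace_def)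
  moreover have "\<forall>l\<in>{r<..N}. \<forall>x\<in>generated. app (a l) x \<in> generated"
    by (auto simp: generated_def) (auto simp: generating_def)
  ultimately show ?thesis by (simp add: generating_def closed_csubspace_def generated_def)
qed

definition preserves :: "'h bop \<Rightarrow> bool" where
  "preserves T \<longleftrightarrow> (\<forall>x\<in>generated. app T x \<in> generated)"

lemma generated_add: "x \<in> generated \<Longrightarrow> y \<in> generated \<Longrightarrow> x + y \<in> generated"
  and generated_zero: "0 \<in> generated"
  and generated_Q: "app (Q r) x \<in> generated"
  and generated_a: "r < l \<Longrightarrow> l \<le> N \<Longrightarrow> x \<in> generated \<Longrightarrow> app (a l) x \<in> generated"
  using generating_generated by (auto simp: generating_def closed_csubspace_def)

lemma preserves_mult: "preserves S \<Longrightarrow> preserves T \<Longrightarrow> preserves (S * T)"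
  and preserves_zero: "preserves 0"
  and preserves_one: "preserves 1"
  by (auto simp: preserves_def generated_add generated_zero)

lemma preserves_a:
  assumes "1 \<le> l" "l \<le> N"
  shows "preserves (a l)"
proof -
  consider "l < r" | "l = r" | "r < l" by linarith
  then show ?thesis
  proof cases
    case 2
    have "a r = Q r * a r" using Q_a_same r_pos r_less by simp
    then have "app (a r) x = app (Q r) (app (a r) x)" for x by (metis app_simps(6))
    then show ?thesis unfolding preserves_def 2 using generated_Q by metis
  qed (use assms a_below preserves_zero generated_a in \<open>auto simp: preserves_def generated_zero\<close>)
qed

text \<open>An operator preserves \<open>generated\<close> if it can be moved past each \<open>a l\<close>, up to an error term that
  preserves \<open>generated\<close>, or is absorbed by \<open>a l\<close>.\<close>

lemma preservesI:
  assumes step: "\<And>l. \<lbrakk>r \<le> l; l \<le> N\<rbrakk> \<Longrightarrow> \<exists>B. preserves B \<and> (T * a l = a l * T + B \<or> T * a l = B)"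
  shows "preserves T"
proof -
  have step': "app T (app (a l) x) \<in> generated"
    if l: "r \<le> l" "l \<le> N" and x: "x \<in> generated" and y: "app (a l) (app T x) \<in> generated" for l x
  proof -
    obtain B where B: "preserves B" "T * a l = a l * T + B \<or> T * a l = B" using step l by force
    have "app T (app (a l) x) = app (a l) (app T x) + app B x \<or> app T (app (a l) x) = app B x"
      using B(2) by (metis app_simps(3,6))
    then show ?thesis using B(1) x y by (auto simp: preserves_def generated_add)
  qed
  have Q_a_r: "app (Q r) (app (a r) x) = app (a r) x" for x
    using Q_a_same[of r] r_pos r_less by (metis app_simps(6) less_imp_le)
  let ?S = "generated \<inter> app T -` generated"
  have "generating ?S"
    unfolding generating_def
  proof (intro conjI ballI allI)
    have "closed_csubspace (app T -` generated)" "closed_csubspace generated"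
      using generating_generated closed_csubspace_vimage by (auto simp: generating_def)
    then show "closed_csubspace ?S" by (auto simp: closed_csubspace_def)
    show "app (Q r) x \<in> ?S" for x
    proof -
      have x: "app (Q r) x = app (a r) (app ((a r)\<^sup>\<star>) x)" by (metis a_r_normal app_simps(6))
      have "app (Q r) (app ((a r)\<^sup>\<star>) x) = app ((a r)\<^sup>\<star>) x"
        using Q_aadj_same[of r] r_pos r_less by (metis app_simps(6) less_imp_le)
      then have "app ((a r)\<^sup>\<star>) x \<in> generated" by (metis generated_Q)
      moreover have "app (a r) (app T (app ((a r)\<^sup>\<star>) x)) \<in> generated" by (metis generated_Q Q_a_r)
      ultimately have "app T (app (Q r) x) \<in> generated"
        unfolding x using step'[of r] r_less by simp
      then show ?thesis using generated_Q by simp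
    qed
    fix l x assume l: "l \<in> {r<..N}" and x: "x \<in> ?S"
    then show "app (a l) x \<in> ?S" using step'[of l x] generated_a by simp
  qed
  then show ?thesis using generated_least by (force simp: preserves_def)
qed

lemma preserves_Q:
  assumes l: "1 \<le> l" "l \<le> N"
  shows "preserves (Q l)"
proof (rule preservesI)
  fix m assume m: "r \<le> m" "m \<le> N"
  show "\<exists>B. preserves B \<and> (Q l * a m = a m * Q l + B \<or> Q l * a m = B)"
  proof (cases "m \<le> l")
    case True
    then have "Q l * a m = a m" using Q_a[of m l] m l r_pos by simp
    then show ?thesis using preserves_a[of m] m r_pos by auto
  next
    case False
    then have "Q l * a m = 0" using Q_a_zero[of l m] m l by simp
    then show ?thesis using preserves_zero by auto
  qed
qed

lemma preserves_aadj:
  assumes l: "1 \<le> l" "l \<le> N"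
  shows "preserves ((a l)\<^sup>\<star>)"
proof (rule preservesI)
  fix m assume m: "r \<le> m" "m \<le> N"
  have "preserves ((a l)\<^sup>\<star> * a m)"
    using aadj_a_diff[of l m] preserves_Q[of l] preserves_zero m l r_pos
    by (cases "l = m") (auto simp: Q_def)
  then show "\<exists>B. preserves B \<and> ((a l)\<^sup>\<star> * a m = a m * (a l)\<^sup>\<star> + B \<or> (a l)\<^sup>\<star> * a m = B)"
    by blast
qed

text \<open>The error term in moving \<open>Z i j\<close> or its adjoint past \<open>a (j + 1)\<close> or \<open>a j\<close> involves column \<open>j + 1\<close> of
  the same row; hence the induction goes from the last column to the left.\<close>

lemma preserves_upper:
  assumes "i \<le> j" "j \<le> N" "1 \<le> i" "i < N"
  shows "preserves (Z i j) \<and> preserves ((Z i j)\<^sup>\<star>)"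
  using assms(2,1)
proof (induction j rule: inc_induct)
  case base
  show ?case
  proof
    show "preserves (Z i N)"
    proof (rule preservesI)
      fix l assume l: "r \<le> l" "l \<le> N"
      have "Z i N * a l = a l * Z i N + 0 \<or> Z i N * a l = 0"
        using Z_a_below[of i l N] Z_a_same[of i N] assms l r_pos by (cases "l = N") auto
      then show "\<exists>B. preserves B \<and> (Z i N * a l = a l * Z i N + B \<or> Z i N * a l = B)"
        using preserves_zero by blast
    qed
    show "preserves ((Z i N)\<^sup>\<star>)"
    proof (rule preservesI)
      fix l assume l: "r \<le> l" "l \<le> N"
      have "(Z i N)\<^sup>\<star> * a l = a l * (Z i N)\<^sup>\<star> + 0 \<or> (Z i N)\<^sup>\<star> * a l = 0"
        using Zadj_a[of i N l] Zadj_a_top[of i] assms l r_pos by (cases "l = N") auto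
      then show "\<exists>B. preserves B \<and> ((Z i N)\<^sup>\<star> * a l = a l * (Z i N)\<^sup>\<star> + B \<or> (Z i N)\<^sup>\<star> * a l = B)"
        using preserves_zero by blast
    qed
  qed
next
  case (step j)
  then have j: "i \<le> j" "j < N" "1 \<le> j" using assms by auto
  have IH: "preserves (Z i (j + 1))" "preserves ((Z i (j + 1))\<^sup>\<star>)"
    using step j by (simp_all add: Suc_eq_plus1[symmetric])
  show ?case
  proof
    show "preserves (Z i j)"
    proof (rule preservesI)
      fix l assume l: "r \<le> l" "l \<le> N"
      consider "l < j" | "l = j" | "l = j + 1" | "j + 1 < l" by linarith
      then show "\<exists>B. preserves B \<and> (Z i j * a l = a l * Z i j + B \<or> Z i j * a l = B)"
      proof cases
        case 3
        then show ?thesis using Z_a_next[of i j] preserves_mult[OF IH(1) preserves_a[of j]] j assms by auto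
      qed (use Z_a_below[of i l j] Z_a_same[of i j] Z_a_above[of i j l] j l assms r_pos
            in \<open>auto intro!: exI[of _ 0] preserves_zero\<close>)
    qed
    show "preserves ((Z i j)\<^sup>\<star>)"
    proof (rule preservesI)
      fix l assume l: "r \<le> l" "l \<le> N"
      show "\<exists>B. preserves B \<and> ((Z i j)\<^sup>\<star> * a l = a l * (Z i j)\<^sup>\<star> + B \<or> (Z i j)\<^sup>\<star> * a l = B)"
      proof (cases "l = j")
        case True
        have "preserves (a (j + 1) * Q j * (Z i (j + 1))\<^sup>\<star>)"
          using IH j by (intro preserves_mult preserves_a preserves_Q) auto
        then show ?thesis using Zadj_a_same[of i j] True assms j by auto
      qed (use Zadj_a[of i j l] l j assms r_pos in \<open>auto intro!: exI[of _ 0] preserves_zero\<close>)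
    qed
  qed
qed

text \<open>Below the diagonal the relation for \<open>(Z i j)\<^sup>\<star>\<close> reduces the claim to entries on and above it.\<close>

lemma preserves_Z:
  assumes "1 \<le> i" "i \<le> N" "1 \<le> j" "j \<le> N"
  shows "preserves (Z i j) \<and> preserves ((Z i j)\<^sup>\<star>)"
proof -
  let ?P = "\<lambda>T. preserves T \<and> preserves (T\<^sup>\<star>)"
  have P_mult: "?P S \<Longrightarrow> ?P T \<Longrightarrow> ?P (S * T)" for S T by (simp add: preserves_mult)
  have up: "?P (Z i j)" if "1 \<le> i" "i \<le> j" "j \<le> N" for i j
    using preserves_upper[of i j] preserves_a[of N] preserves_aadj[of N] that by (cases "i = N") auto
  have seg: "?P (seg f k l)" if "\<And>m. k \<le> m \<Longrightarrow> m \<le> l \<Longrightarrow> ?P (f m)" for f k l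
    by (rule seg_closed[where P = ?P]) (use that in \<open>simp_all add: preserves_one preserves_mult\<close>)
  show ?thesis
  proof (cases "i \<le> j")
    case False
    have "?P (D (j - 1) * U j (i - 1) * E (i + 1))"
      by (intro P_mult seg up) (use assms False in auto)
    then have "?P ((Z i j)\<^sup>\<star>)" using star_lower[of j i] False assms by simp
    then show ?thesis by simp
  qed (use up assms in auto)
qed

text \<open>Hence \<open>generated\<close> is a nonzero invariant subspace, and irreducibility makes it everything.\<close>

lemma generated_UNIV: "generated = UNIV"
proof -
  have "generated = {0} \<or> generated = UNIV"
    by (rule irreducible)
      (use generating_generated preserves_Z in \<open>auto simp: generating_def preserves_def\<close>)
  moreover have "Q r \<noteq> 0" using a_Q_same[of r] a_r_nonzero r_pos r_less by auto
  then obtain x where "app (Q r) x \<noteq> 0" using bop_eqI[of "Q r" 0] by auto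
  ultimately show ?thesis using generated_Q by blast
qed

lemma generating_UNIV: "generating S \<Longrightarrow> S = UNIV"
  using generated_least generated_UNIV by blast

text \<open>The kernel of \<open>C\<close> is a closed subspace.  It contains the range of \<open>Q s\<close>, hence the ranges of \<open>Q r\<close> and of all
  \<open>a l\<close> with \<open>l \<le> s\<close>, and by \<open>step\<close> it is invariant under the other \<open>a l\<close>; so it is generating.\<close>

lemma vanishI:
  assumes s: "r \<le> s" "s \<le> N" and base: "C * Q s = 0"
    and step: "\<And>l. \<lbrakk>s < l; l \<le> N\<rbrakk> \<Longrightarrow> \<exists>L. C * a l = L * C"
  shows "C = 0"
proof -
  have low: "C * a l = 0" if "1 \<le> l" "l \<le> s" for l
    using Q_a[of l s] that s base by (metis mult.assoc mult_zero_left)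
  have Qr: "C * Q r = 0" using low[of r] s r_pos by (metis a_r_normal mult.assoc mult_zero_left)
  have "generating {x. app C x = app 0 x}"
    unfolding generating_def
  proof (intro conjI allI ballI)
    show "closed_csubspace {x. app C x = app 0 x}" by (rule closed_csubspace_eqs)
    show "app (Q r) x \<in> {x. app C x = app 0 x}" for x
      using arg_cong[OF Qr, of "\<lambda>T. app T x"] by simp
    fix l x assume l: "l \<in> {r<..N}" and x: "x \<in> {x. app C x = app 0 x}"
    have "\<exists>L. C * a l = L * C" using step[of l] low[of l] l r_pos
      by (cases "s < l") (auto intro: exI[of _ 0])
    then obtain L where "C * a l = L * C" by blast
    from arg_cong[OF this, of "\<lambda>T. app T x"] show "app (a l) x \<in> {x. app C x = app 0 x}" using x by simp
  qed
  from generating_UNIV[OF this] show "C = 0" by (intro bop_eqI) blast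
qed

end


section \<open>Strong limits\<close>

text \<open>With a uniform bound, strong convergence has to be checked on a total set only.\<close>

lemma closed_csubspace_convergent:
  fixes T :: "nat \<Rightarrow> 'h::complex_hilbert_space bop"
  assumes c: "\<And>k x. norm (app (T k) x) \<le> c * norm x"
  shows "closed_csubspace {x. convergent (\<lambda>k. app (T k) x)}"
  unfolding closed_csubspace_def
proof (intro conjI ballI allI)
  let ?S = "{x. convergent (\<lambda>k. app (T k) x)}"
  show "closed ?S"
    unfolding closure_subset_eq[symmetric]
  proof (rule subsetI)
    fix x assume x: "x \<in> closure ?S"
    have "Cauchy (\<lambda>k. app (T k) x)"
    proof (rule metric_CauchyI)
      fix e :: real assume e: "e > 0"
      define d where "d = e / (3 * (\<bar>c\<bar> + 1))"
      have d: "d > 0" "\<bar>c\<bar> * d < e / 3" using e by (auto simp: d_def field_simps)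
      obtain y where y: "y \<in> ?S" "dist y x < d" using x d(1) closure_approachable by blast
      have close: "dist (app (T k) x) (app (T k) y) < e / 3" for k
      proof -
        have "dist (app (T k) x) (app (T k) y) = norm (app (T k) (x - y))" by (simp add: dist_norm)
        also have "\<dots> \<le> c * norm (x - y)" by (rule c)
        also have "\<dots> \<le> \<bar>c\<bar> * d"
          using y(2) by (intro mult_mono) (auto simp: dist_norm norm_minus_commute)
        finally show ?thesis using d by simp
      qed
      have "Cauchy (\<lambda>k. app (T k) y)" using y(1) by (simp add: convergent_Cauchy)
      then obtain M where M: "\<And>k l. k \<ge> M \<Longrightarrow> l \<ge> M \<Longrightarrow> dist (app (T k) y) (app (T l) y) < e / 3"
        using e metric_CauchyD[of _ "e / 3"] by force
      have "dist (app (T k) x) (app (T l) x) < e" if "k \<ge> M" "l \<ge> M" for k l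
      proof -
        have "dist (app (T k) x) (app (T l) x) \<le> dist (app (T k) x) (app (T k) y)
            + dist (app (T k) y) (app (T l) y) + dist (app (T l) y) (app (T l) x)"
          by (metis dist_triangle_le order_refl add_right_mono dist_triangle order_trans)
        then show ?thesis using close[of k] close[of l] M[OF that] by (simp add: dist_commute)
      qed
      then show "\<exists>M. \<forall>k\<ge>M. \<forall>l\<ge>M. dist (app (T k) x) (app (T l) x) < e" by blast
    qed
    then show "x \<in> ?S" by (simp add: Cauchy_convergent)
  qed
next
  fix d and x assume "x \<in> {x. convergent (\<lambda>k. app (T k) x)}"
  then obtain y where y: "(\<lambda>k. app (T k) x) \<longlonglongrightarrow> y" by (auto simp: convergent_def)
  from bounded_linear.tendsto[OF bounded_linear_scaleC y] show "d *\<^sub>C x \<in> {x. convergent (\<lambda>k. app (T k) x)}"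
    by (auto simp: convergent_def)
qed (auto intro: convergent_add convergent_const)

lemma strong_limit:
  fixes T :: "nat \<Rightarrow> 'h::complex_hilbert_space bop"
  assumes c: "\<And>k x. norm (app (T k) x) \<le> c * norm x"
    and conv: "\<And>x. convergent (\<lambda>k. app (T k) x)"
  obtains L where "\<And>x. (\<lambda>k. app (T k) x) \<longlonglongrightarrow> app L x"
proof -
  obtain f where f: "\<And>x. (\<lambda>k. app (T k) x) \<longlonglongrightarrow> f x" using conv unfolding convergent_def by metis
  have "bounded_clinear f"
  proof (rule bounded_clinearI)
    show "f (x + y) = f x + f y" for x y
      using tendsto_add[OF f f, of x y] f[of "x + y"] LIMSEQ_unique by simp
    show "f (d *\<^sub>C x) = d *\<^sub>C f x" for d x
      using LIMSEQ_unique[OF f[of "d *\<^sub>C x"]] bounded_linear.tendsto[OF bounded_linear_scaleC f[of x]]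
      by simp
    show "norm (f x) \<le> c * norm x" for x
      by (rule LIMSEQ_le_const2[OF tendsto_norm[OF f]]) (use c in blast)
  qed
  then have "app (Bop f) = f" by (simp add: Bop_inverse)
  then show thesis using that[of "Bop f"] f by simp
qed

context crystal_relations begin

lemma norm_Q_le:
  assumes "1 \<le> l" "l \<le> N"
  shows "norm (app (Q l) x) \<le> norm x"
proof -
  have "(norm (app (Q l) x))\<^sup>2 = Re (cinner x (app (Q l) x))"
    using Q_idem[OF assms] by (simp add: norm_app_sq del: app_simps(6))
  then have "(norm (x - app (Q l) x))\<^sup>2 = (norm x)\<^sup>2 - (norm (app (Q l) x))\<^sup>2"
    by (simp add: norm_diff_sq)
  then have "(norm (app (Q l) x))\<^sup>2 \<le> (norm x)\<^sup>2" using zero_le_power2[of "norm (x - app (Q l) x)"] by linarith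
  then show ?thesis by (simp add: power2_le_iff_abs_le)
qed

lemma norm_a_le:
  assumes "1 \<le> l" "l \<le> N"
  shows "norm (app (a l) x) \<le> norm x"
proof -
  have "(norm (app (a l) x))\<^sup>2 = (norm (app (Q l) x))\<^sup>2"
    using Q_idem[OF assms] by (simp add: norm_app_sq Q_def[symmetric] del: app_simps(6))
  then show ?thesis using norm_Q_le[OF assms, of x] by (simp add: power2_eq_iff_nonneg)
qed

end

context crystal_irrep begin

text \<open>The series \<open>\<Sum>k. \<alpha>\<^sup>k S (\<alpha>\<^sup>\<star>)\<^sup>k\<close> with \<open>\<alpha> = a m\<close>: its terms have orthogonal ranges, so the partial sums are
  bounded by the norm of \<open>S\<close>, and on the vectors that generate the space they become stationary.\<close>

lemma amplification:
  assumes m: "r < m" "m \<le> N" and S: "Q (m - 1) * S = S" "S * Q (m - 1) = S"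
  obtains L where "L = S + a m * L * (a m)\<^sup>\<star>"
    "\<And>x. (\<Sum>k. (app (a m) ^^ k) (app S (hadj (app (a m) ^^ k) x))) = app L x"
proof -
  let ?\<alpha> = "a m"
  define T where "T k = (\<Sum>t<k. ?\<alpha> ^ t * S * (?\<alpha> ^ t)\<^sup>\<star>)" for k
  have T_0: "T 0 = 0" by (simp add: T_def)
  have T_Suc: "T (Suc k) = S + ?\<alpha> * T k * ?\<alpha>\<^sup>\<star>" for k
    unfolding T_def sum.lessThan_Suc_shift by (simp add: sum_distrib_left sum_distrib_right mult.assoc)
  have m1: "1 \<le> m" "1 \<le> m - 1" "m - 1 < m" "m - 1 \<le> N" using m r_pos by auto
  have Q\<alpha>: "Q (m - 1) * ?\<alpha> = 0" using Q_a_zero[of "m - 1" m] m m1 by simp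
  have S\<alpha>: "S * ?\<alpha> = 0" by (metis S(2) Q\<alpha> mult.assoc mult_zero_right)
  have Qm: "Q m = Q (m - 1) + ?\<alpha> * ?\<alpha>\<^sup>\<star>" using Q_step[of m] m m1 by (simp add: diff_eq_eq)
  have SQ: "S * Q m = S"
    using S(2) Q_mono[of "m - 1" m] m m1 by (metis mult.assoc less_imp_le)
  obtain c where c: "c \<ge> 0" "\<And>x. norm (app S x) \<le> c * norm x" using app_bound[of S] by blast
  have bound: "norm (app (T k) x) \<le> c * norm x" for k x
  proof (induction k arbitrary: x)
    case 0
    then show ?case using c(1) by (simp add: T_0)
  next
    case (Suc k)
    let ?y = "app (T k) (app (?\<alpha>\<^sup>\<star>) x)"
    have "app S x = app (Q (m - 1)) (app S x)" by (metis S(1) app_simps(6))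
    then have "cinner (app S x) (app ?\<alpha> ?y) = cinner (app S x) (app (Q (m - 1) * ?\<alpha>) ?y)"
      by (metis cinner_adj Q_adj app_simps(6))
    then have orth: "cinner (app S x) (app ?\<alpha> ?y) = 0" by (simp add: Q\<alpha> del: app_simps(6))
    have "norm (app ?\<alpha> ?y) \<le> c * norm (app (?\<alpha>\<^sup>\<star>) x)"
      using norm_a_le[of m ?y] Suc[of "app (?\<alpha>\<^sup>\<star>) x"] m m1 by linarith
    then have 1: "(norm (app ?\<alpha> ?y))\<^sup>2 \<le> c\<^sup>2 * (norm (app (?\<alpha>\<^sup>\<star>) x))\<^sup>2"
      by (metis power_mono norm_ge_zero power_mult_distrib)
    have "norm (app S x) \<le> c * norm (app (Q (m - 1)) x)" using c(2)[of "app (Q (m - 1)) x"] by (metis S(2) app_simps(6))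
    then have 2: "(norm (app S x))\<^sup>2 \<le> c\<^sup>2 * (norm (app (Q (m - 1)) x))\<^sup>2"
      by (metis power_mono norm_ge_zero power_mult_distrib)
    have "(norm (app (Q (m - 1)) x))\<^sup>2 + (norm (app (?\<alpha>\<^sup>\<star>) x))\<^sup>2
        = Re (cinner x (app (Q (m - 1) + ?\<alpha> * ?\<alpha>\<^sup>\<star>) x))"
      using Q_idem[of "m - 1"] m1 m
      by (simp add: norm_app_sq cinner_add_right del: app_simps(6))
    also have "\<dots> = (norm (app (Q m) x))\<^sup>2"
      using Q_idem[of m] m m1 by (simp add: norm_app_sq Qm[symmetric] del: app_simps)
    also have "\<dots> \<le> (norm x)\<^sup>2" using norm_Q_le[of m x] m m1 by (simp add: power_mono)
    finally have 3: "(norm (app (Q (m - 1)) x))\<^sup>2 + (norm (app (?\<alpha>\<^sup>\<star>) x))\<^sup>2 \<le> (norm x)\<^sup>2" .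
    have "(norm (app (T (Suc k)) x))\<^sup>2 = (norm (app S x))\<^sup>2 + (norm (app ?\<alpha> ?y))\<^sup>2"
      by (simp add: T_Suc norm_add_sq orth)
    also have "\<dots> \<le> c\<^sup>2 * ((norm (app (Q (m - 1)) x))\<^sup>2 + (norm (app (?\<alpha>\<^sup>\<star>) x))\<^sup>2)"
      using 1 2 by (simp add: distrib_left)
    also have "\<dots> \<le> c\<^sup>2 * (norm x)\<^sup>2" using 3 by (intro mult_left_mono) auto
    finally have "(norm (app (T (Suc k)) x))\<^sup>2 \<le> (c * norm x)\<^sup>2" by (simp add: power_mult_distrib)
    then show ?case using c(1) by (simp add: power2_le_iff_abs_le abs_mult)
  qed
  have stationary: "convergent (\<lambda>k. app (T k) (app B x))" if "?\<alpha>\<^sup>\<star> * B = 0" for B x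
  proof -
    have "T (Suc k) * B = S * B" for k using that by (simp add: T_Suc distrib_right mult.assoc)
    then have "app (T (Suc k)) (app B x) = app S (app B x)" for k by (metis app_simps(6))
    then have "convergent (\<lambda>k. app (T (Suc k)) (app B x))" by (simp add: convergent_const)
    then show ?thesis by (simp only: convergent_Suc_iff[of "\<lambda>k. app (T k) (app B x)"])
  qed
  have TQ: "T k * Q m = T k" for k
  proof (induction k)
    case (Suc k)
    have "?\<alpha>\<^sup>\<star> * Q m = ?\<alpha>\<^sup>\<star>" using aadj_Q_same m m1 by simp
    then show ?case by (simp add: T_Suc distrib_right SQ mult.assoc)
  qed (simp add: T_0)
  have "generating {x. convergent (\<lambda>k. app (T k) x)}"
    unfolding generating_def
  proof (intro conjI allI ballI)
    show "closed_csubspace {x. convergent (\<lambda>k. app (T k) x)}" by (rule closed_csubspace_convergent[OF bound])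
    have "?\<alpha>\<^sup>\<star> * Q r = 0"
      using aadj_a_diff[of m r] m m1 r_pos r_less by (simp add: a_r_normal[symmetric] mult.assoc[symmetric])
    then show "app (Q r) x \<in> {x. convergent (\<lambda>k. app (T k) x)}" for x using stationary by simp
    fix l x assume l: "l \<in> {r<..N}" and x: "x \<in> {x. convergent (\<lambda>k. app (T k) x)}"
    show "app (a l) x \<in> {x. convergent (\<lambda>k. app (T k) x)}"
    proof (cases "l = m")
      case True
      have "T (Suc k) * ?\<alpha> = ?\<alpha> * T k" for k
        using TQ[of k] by (simp add: T_Suc distrib_right S\<alpha> mult.assoc Q_def[symmetric])
      then have eq: "app (T (Suc k)) (app ?\<alpha> x) = app ?\<alpha> (app (T k) x)" for k by (metis app_simps(6))
      obtain y where "(\<lambda>k. app (T k) x) \<longlonglongrightarrow> y" using x by (auto simp: convergent_def)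
      then have "(\<lambda>k. app ?\<alpha> (app (T k) x)) \<longlonglongrightarrow> app ?\<alpha> y"
        by (rule bounded_linear.tendsto[OF bounded_linear_app])
      then have "convergent (\<lambda>k. app (T (Suc k)) (app ?\<alpha> x))" unfolding eq convergent_def by blast
      then show ?thesis using True by (simp only: convergent_Suc_iff[of "\<lambda>k. app (T k) (app ?\<alpha> x)"]) simp
    qed (use stationary aadj_a_diff[of m l] l m m1 r_pos in simp)
  qed
  then have conv: "convergent (\<lambda>k. app (T k) x)" for x using generating_UNIV by blast
  obtain L where L: "\<And>x. (\<lambda>k. app (T k) x) \<longlonglongrightarrow> app L x" using strong_limit[OF bound conv] by blast
  have "app L x = app (S + ?\<alpha> * L * ?\<alpha>\<^sup>\<star>) x" for x
  proof -
    have "(\<lambda>k. app S x + app ?\<alpha> (app (T k) (app (?\<alpha>\<^sup>\<star>) x))) \<longlonglongrightarrow> app S x + app ?\<alpha> (app L (app (?\<alpha>\<^sup>\<star>) x))"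
      by (intro tendsto_add tendsto_const bounded_linear.tendsto[OF bounded_linear_app] L)
    then have "(\<lambda>k. app (T (Suc k)) x) \<longlonglongrightarrow> app S x + app ?\<alpha> (app L (app (?\<alpha>\<^sup>\<star>) x))" by (simp add: T_Suc)
    then show ?thesis using LIMSEQ_unique[OF LIMSEQ_Suc[OF L[of x]]] by simp
  qed
  then have 1: "L = S + ?\<alpha> * L * ?\<alpha>\<^sup>\<star>" by (rule bop_eqI)
  have 2: "(\<Sum>k. (app ?\<alpha> ^^ k) (app S (hadj (app ?\<alpha> ^^ k) x))) = app L x" for x
  proof -
    have "app (T k) x = (\<Sum>t<k. app (?\<alpha> ^ t) (app S (app ((?\<alpha> ^ t)\<^sup>\<star>) x)))" for k
      by (induction k) (simp_all add: T_def)
    then have "(\<lambda>k. app (?\<alpha> ^ k) (app S (app ((?\<alpha> ^ k)\<^sup>\<star>) x))) sums app L x"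
      using L[of x] by (simp add: sums_def)
    then show ?thesis by (simp add: app_power hadj_app sums_iff)
  qed
  show thesis by (rule that[OF 1 2])
qed

text \<open>The relations that determine \<open>Wop\<close>: it extends \<open>a j\<close> from the range of \<open>Q j\<close> to the range of \<open>Q i\<close> by
  commuting with the intermediate shifts and their adjoints.  They follow from the fixed point equation
  \<open>T = S + a m * T * (a m)\<^sup>\<star>\<close> of the limit.\<close>

lemma Wop_bop:
  assumes N: "N = n + 1" and j: "r \<le> j" "j \<le> i" "i \<le> N"
  shows "\<exists>T. Wop n (\<lambda>i j. app (Z i j)) i j = app T \<and> T * Q j = a j \<and> Q i * T = T \<and> T * Q i = T \<and>
    (\<forall>l. j < l \<and> l \<le> i \<longrightarrow> T * a l = a l * T \<and> T * (a l)\<^sup>\<star> = (a l)\<^sup>\<star> * T)"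
  using j(2,3)
proof (induction i rule: dec_induct)
  case base
  show ?case using N j r_pos a_Q_same[of j] Q_a_same[of j] base by (intro exI[of _ "a j"]) auto
next
  case (step i)
  define m where "m = Suc i"
  have m: "r < m" "m \<le> N" "j < m" "m - 1 = i" "1 \<le> m" "1 \<le> j" "1 \<le> i" using step j r_pos by (auto simp: m_def)
  let ?\<alpha> = "a m"
  obtain S where S: "Wop n (\<lambda>i j. app (Z i j)) i j = app S" "S * Q j = a j" "Q i * S = S" "S * Q i = S"
    "\<And>l. j < l \<Longrightarrow> l \<le> i \<Longrightarrow> S * a l = a l * S" "\<And>l. j < l \<Longrightarrow> l \<le> i \<Longrightarrow> S * (a l)\<^sup>\<star> = (a l)\<^sup>\<star> * S"
    using step m by auto
  obtain T where T: "T = S + ?\<alpha> * T * ?\<alpha>\<^sup>\<star>"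
    "\<And>x. (\<Sum>k. (app ?\<alpha> ^^ k) (app S (hadj (app ?\<alpha> ^^ k) x))) = app T x"
    by (rule amplification[of m S]) (use m S in auto)
  have W: "Wop n (\<lambda>i j. app (Z i j)) m j = app T"
    using T(2) m by (simp add: Wop.simps(2) S(1) N fun_eq_iff)
  have T_mult: "T * B = S * B + ?\<alpha> * (T * (?\<alpha>\<^sup>\<star> * B))" for B
  proof -
    have "T * B = (S + ?\<alpha> * T * ?\<alpha>\<^sup>\<star>) * B" using T(1) by simp
    then show ?thesis by (simp only: distrib_right mult.assoc)
  qed
  have mult_T: "B * T = B * S + B * ?\<alpha> * (T * ?\<alpha>\<^sup>\<star>)" for B
  proof -
    have "B * T = B * (S + ?\<alpha> * T * ?\<alpha>\<^sup>\<star>)" using T(1) by simp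
    then show ?thesis by (simp only: distrib_left mult.assoc)
  qed
  have Qi\<alpha>: "Q i * ?\<alpha> = 0" using Q_a_zero[of i m] m by simp
  have S\<alpha>: "S * ?\<alpha> = 0" using mult.assoc[of S "Q i" ?\<alpha>] by (simp add: S(4) Qi\<alpha>)
  have \<alpha>Qi: "?\<alpha>\<^sup>\<star> * Q i = 0" using arg_cong[OF Qi\<alpha>, of adj] by simp
  have \<alpha>S: "?\<alpha>\<^sup>\<star> * S = 0" using mult.assoc[of "?\<alpha>\<^sup>\<star>" "Q i" S] by (simp add: S(3) \<alpha>Qi)
  have "?\<alpha>\<^sup>\<star> * Q j = 0" using arg_cong[OF Q_a_zero[of j m], of adj] m by simp
  then have 1: "T * Q j = a j" using T_mult[of "Q j"] S(2) by simp
  have "Q m * S = Q m * Q i * S" by (simp add: mult.assoc S(3))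
  then have "Q m * S = S" using Q_mono'[of i m] m S(3) by (simp add: m_def)
  then have 2: "Q m * T = T" using mult_T[of "Q m"] Q_a_same[of m] m T(1) by (simp add: mult.assoc)
  have "S * Q m = S * (Q i * Q m)" by (simp add: mult.assoc[symmetric] S(4))
  then have "S * Q m = S" using Q_mono[of i m] m S(4) by (simp add: m_def)
  then have 3: "T * Q m = T" using T_mult[of "Q m"] aadj_Q_same[of m] m T(1) by (simp add: mult.assoc)
  have 4: "T * a l = a l * T \<and> T * (a l)\<^sup>\<star> = (a l)\<^sup>\<star> * T" if l: "j < l" "l \<le> m" for l
  proof (cases "l = m")
    case True
    have "T * ?\<alpha> = ?\<alpha> * T" using T_mult[of ?\<alpha>] 3 by (simp add: S\<alpha> Q_def[symmetric])
    moreover have "?\<alpha>\<^sup>\<star> * T = T * ?\<alpha>\<^sup>\<star>"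
    proof -
      have "?\<alpha>\<^sup>\<star> * T = Q m * T * ?\<alpha>\<^sup>\<star>" using mult_T[of "?\<alpha>\<^sup>\<star>"] by (simp add: \<alpha>S Q_def mult.assoc)
      then show ?thesis by (simp add: 2)
    qed
    ultimately show ?thesis using True by simp
  next
    case False
    then have li: "l \<le> i" "1 \<le> l" "l < m" using l m by (auto simp: m_def)
    have z: "?\<alpha>\<^sup>\<star> * a l = 0" "(a l)\<^sup>\<star> * ?\<alpha> = 0" "a l * ?\<alpha> = 0"
      using aadj_a_diff[of m l] aadj_a_diff[of l m] a_row[of l m] li m by auto
    have z': "?\<alpha>\<^sup>\<star> * (a l)\<^sup>\<star> = 0" using arg_cong[OF z(3), of adj] by simp
    show ?thesis
      using T_mult[of "a l"] T_mult[of "(a l)\<^sup>\<star>"] mult_T[of "a l"] mult_T[of "(a l)\<^sup>\<star>"] S(5,6)[OF l(1) li(1)]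
      by (simp add: z z')
  qed
  show ?case using W 1 2 3 4 by (auto simp: m_def[symmetric] intro!: exI[of _ T])
qed

end


section \<open>Splitting off the isometry\<close>

text \<open>\<open>V\<close> and \<open>X\<close> stand for the operators \<open>W\<^sub>N\<^sub>,\<^sub>r\<close> and \<open>W\<^sub>N\<^sub>,\<^sub>r\<^sub>+\<^sub>1\<close>, which are determined by these relations
  because of \<open>vanishI\<close>.\<close>

locale crystal_factor = crystal_irrep N Z r
  for N and Z :: "nat \<Rightarrow> nat \<Rightarrow> 'h::complex_hilbert_space bop" and r +
  fixes V X :: "'h bop"
  assumes V_a: "\<lbrakk>r < l; l \<le> N\<rbrakk> \<Longrightarrow> V * a l = a l * V"
    and V_aadj: "\<lbrakk>r < l; l \<le> N\<rbrakk> \<Longrightarrow> V * (a l)\<^sup>\<star> = (a l)\<^sup>\<star> * V"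
    and V_Q_r: "V * Q r = a r"
    and X_a: "\<lbrakk>r + 1 < l; l \<le> N\<rbrakk> \<Longrightarrow> X * a l = a l * X"
    and X_aadj: "\<lbrakk>r + 1 < l; l \<le> N\<rbrakk> \<Longrightarrow> X * (a l)\<^sup>\<star> = (a l)\<^sup>\<star> * X"
    and X_Q: "X * Q (r + 1) = a (r + 1)"
begin

abbreviation b :: "'h bop" where "b \<equiv> a (r + 1)"
abbreviation P :: "'h bop" where "P \<equiv> Q (r + 1)"

lemma mult_left_eq: "S * T = R \<Longrightarrow> S * (T * C) = R * (C :: 'h bop)"
  by (simp add: mult.assoc[symmetric])

lemma P_split: "P = b * b\<^sup>\<star> + a r * (a r)\<^sup>\<star>"
  using Q_step[of "r + 1"] r_pos r_less by (simp add: a_r_normal algebra_simps)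

lemma P_minus: "P - b * b\<^sup>\<star> = Q r"
  using Q_step[of "r + 1"] r_pos r_less by simp

lemma P_a: "P * b = b" "P * a r = a r" "b * P = b" "a r * P = a r" "b\<^sup>\<star> * P = b\<^sup>\<star>" "P * b\<^sup>\<star> = b\<^sup>\<star>"
  "a r * b = 0" "b\<^sup>\<star> * a r = 0" "(a r)\<^sup>\<star> * b = 0" "P * Q r = Q r" "Q r * P = Q r" "P * P = P"
  using Q_a[of "r+1" "r+1"] Q_a[of r "r+1"] a_Q[of "r+1" "r+1"] a_Q[of r "r+1"] a_row[of r "r+1"]
    aadj_a_diff[of "r+1" r] aadj_a_diff[of r "r+1"] r_pos r_less aadj_Q_same[of "r+1"] Q_aadj_same[of "r+1"]
    Q_mono[of r "r+1"] Q_mono'[of r "r+1"] Q_idem[of "r+1"]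
  by simp_all

lemma Qr_a: "Q r * a r = a r" "a r * Q r = a r" "(a r)\<^sup>\<star> * a r = Q r" "b\<^sup>\<star> * b = P"
  "(a r)\<^sup>\<star> * Q r = (a r)\<^sup>\<star>" "Q r * (a r)\<^sup>\<star> = (a r)\<^sup>\<star>"
  using Q_a_same[of r] a_Q_same[of r] aadj_Q_same[of r] Q_aadj_same[of r] r_pos r_less by (simp_all add: Q_def)

lemma zero_on_P: "\<lbrakk>T * b = 0; T * a r = 0\<rbrakk> \<Longrightarrow> T * P = 0"
  by (simp add: P_split distrib_left mult.assoc[symmetric])

lemma zero_on_Qr: "T * a r = 0 \<Longrightarrow> T * Q r = 0"
  by (simp add: a_r_normal[symmetric] mult.assoc[symmetric])


subsection \<open>A central unitary\<close>

lemma V_Q: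
  assumes "r < l" "l \<le> N"
  shows "V * Q l = Q l * V"
  unfolding Q_def by (intro commute_mult_right V_a V_aadj assms)

lemma Q_r_V: "Q r * V = a r"
proof -
  have "V * Q r = Q r * V"
    unfolding P_minus[symmetric] left_diff_distrib right_diff_distrib
    using V_Q[of "r + 1"] commute_mult_right[OF V_a[of "r + 1"] V_aadj[of "r + 1"]] r_less by simp
  then show ?thesis by (simp add: V_Q_r)
qed

lemma Vadj_a: "\<lbrakk>r < l; l \<le> N\<rbrakk> \<Longrightarrow> V\<^sup>\<star> * a l = a l * V\<^sup>\<star>"
  using arg_cong[OF V_aadj[of l], of adj] by simp

lemma Vadj_Q_r: "V\<^sup>\<star> * Q r = (a r)\<^sup>\<star>"
  using arg_cong[OF Q_r_V, of adj] by simp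

text \<open>\<open>V\<close> is unitary because it acts on the range of \<open>Q r\<close> as \<open>a r\<close>, which is unitary there.\<close>

lemma V_isometry: "V\<^sup>\<star> * V = 1"
proof -
  have "V\<^sup>\<star> * V - 1 = 0"
  proof (rule vanishI[of r])
    have "V\<^sup>\<star> * V * Q r = V\<^sup>\<star> * Q r * a r" by (simp add: V_Q_r mult.assoc Qr_a)
    then show "(V\<^sup>\<star> * V - 1) * Q r = 0" by (simp add: Vadj_Q_r Qr_a left_diff_distrib)
    fix l assume l: "r < l" "l \<le> N"
    have "(V\<^sup>\<star> * V - 1) * a l = a l * (V\<^sup>\<star> * V - 1)"
      using commute_mult_left[OF Vadj_a[OF l] V_a[OF l]] by (simp add: left_diff_distrib right_diff_distrib)
    then show "\<exists>L. (V\<^sup>\<star> * V - 1) * a l = L * (V\<^sup>\<star> * V - 1)" by blast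
  qed (use r_less in auto)
  then show ?thesis by simp
qed

lemma V_coisometry: "V * V\<^sup>\<star> = 1"
proof -
  have "V * V\<^sup>\<star> - 1 = 0"
  proof (rule vanishI[of r])
    have "V * V\<^sup>\<star> * Q r = V * Q r * (a r)\<^sup>\<star>" by (simp add: Vadj_Q_r mult.assoc Qr_a)
    then show "(V * V\<^sup>\<star> - 1) * Q r = 0" by (simp add: V_Q_r a_r_normal left_diff_distrib)
    fix l assume l: "r < l" "l \<le> N"
    have "(V * V\<^sup>\<star> - 1) * a l = a l * (V * V\<^sup>\<star> - 1)"
      using commute_mult_left[OF V_a[OF l] Vadj_a[OF l]] by (simp add: left_diff_distrib right_diff_distrib)
    then show "\<exists>L. (V * V\<^sup>\<star> - 1) * a l = L * (V * V\<^sup>\<star> - 1)" by blast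
  qed (use r_less in auto)
  then show ?thesis by simp
qed

lemma V_a_r: "V * a r = a r * V" "V * a r = a r * a r"
proof -
  show 1: "V * a r = a r * a r" using mult.assoc[of V "Q r" "a r"] by (simp add: V_Q_r Qr_a)
  have "a r * V = a r * a r" using mult.assoc[of "a r" "Q r" V] by (simp add: Q_r_V Qr_a)
  then show "V * a r = a r * V" using 1 by simp
qed

lemma V_a_all: "\<lbrakk>1 \<le> l; l \<le> N\<rbrakk> \<Longrightarrow> V * a l = a l * V"
  using V_a[of l] V_a_r(1) a_below[of l] by (cases l r rule: linorder_cases) auto

text \<open>For unitary \<open>V\<close> the condition on \<open>V\<^sup>\<star>\<close> is automatic (\<open>centralI\<close>); stating it makes closure under adjoints
  immediate.\<close>

definition central :: "'h bop \<Rightarrow> bool" where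
  "central T \<longleftrightarrow> T * V = V * T \<and> T * V\<^sup>\<star> = V\<^sup>\<star> * T"

lemma centralI: "T * V = V * T \<Longrightarrow> central T"
proof -
  assume T: "T * V = V * T"
  have "V\<^sup>\<star> * T = V\<^sup>\<star> * T * (V * V\<^sup>\<star>)" by (simp add: V_coisometry)
  also have "\<dots> = V\<^sup>\<star> * (T * V) * V\<^sup>\<star>" by (simp add: mult.assoc)
  also have "\<dots> = V\<^sup>\<star> * V * T * V\<^sup>\<star>" by (simp add: T mult.assoc)
  finally show ?thesis using T by (simp add: central_def V_isometry)
qed

lemma central_mult: "\<lbrakk>central S; central T\<rbrakk> \<Longrightarrow> central (S * T)"
  unfolding central_def using commute_mult_left by blast

lemma central_one: "central 1"
  by (simp add: central_def)

lemma central_adj: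
  assumes "central T"
  shows "central (T\<^sup>\<star>)"
  using assms unfolding central_def by (metis adj_mult adj_adj)

text \<open>As for \<open>preserves_upper\<close>, the commutator with \<open>a (j + 1)\<close> refers to column \<open>j + 1\<close>, so the induction starts
  at the last column.\<close>

lemma central_upper:
  assumes "i \<le> j" "j \<le> N" "1 \<le> i" "i < N"
  shows "Z i j * V = V * Z i j"
  using assms(2,1)
proof (induction j rule: inc_induct)
  case base
  have "Z i N * V - V * Z i N = 0"
  proof (rule vanishI[of r])
    have c: "Z i N * a r = a r * Z i N" "Z i N * (a r)\<^sup>\<star> = (a r)\<^sup>\<star> * Z i N"
      using Z_a_r[of i N] Z_a_adj[of i N r] assms r_pos r_less by auto
    then have "Z i N * Q r = Q r * Z i N" unfolding Q_def by (intro commute_mult_right)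
    then have "V * Z i N * Q r = a r * Z i N" by (simp only: mult.assoc mult_left_eq[OF V_Q_r])
    then show "(Z i N * V - V * Z i N) * Q r = 0"
      by (simp add: left_diff_distrib mult.assoc V_Q_r c(1))
    fix l assume l: "r < l" "l \<le> N"
    show "\<exists>L. (Z i N * V - V * Z i N) * a l = L * (Z i N * V - V * Z i N)"
    proof (cases "l = N")
      case True
      have z: "Z i N * a N = 0" using Z_a_same[of i N] assms by simp
      have "(Z i N * V - V * Z i N) * a N = Z i N * a N * V - V * (Z i N * a N)"
        using V_a[of N] l by (simp add: left_diff_distrib mult.assoc)
      then have "(Z i N * V - V * Z i N) * a N = 0" by (simp add: z)
      then show ?thesis using True by (intro exI[of _ 0]) simp
    next
      case False
      have "Z i N * a l = a l * Z i N" using Z_a_below[of i l N] assms l r_pos False by simp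
      then have "(Z i N * V - V * Z i N) * a l = a l * (Z i N * V - V * Z i N)"
        using commute_mult_left[OF _ V_a[OF l], of "Z i N"] commute_mult_left[OF V_a[OF l], of "Z i N"]
        by (simp add: left_diff_distrib right_diff_distrib)
      then show ?thesis by blast
    qed
  qed (use r_less in auto)
  then show ?case by simp
next
  case (step j)
  then have j: "i \<le> j" "j < N" "1 \<le> j" using assms by auto
  have IH: "Z i (j + 1) * V = V * Z i (j + 1)" using step j by (simp add: Suc_eq_plus1[symmetric])
  let ?C = "Z i j * V - V * Z i j"
  have "?C = 0"
  proof (rule vanishI[of r])
    show "?C * Q r = 0"
    proof (cases "j = r")
      case True
      have z: "Z i j * a r = 0" using Z_a_same[of i j] j assms True by simp
      then have "Z i j * Q r = 0" by (rule zero_on_Qr)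
      then show ?thesis by (simp add: left_diff_distrib mult.assoc V_Q_r z)
    next
      case False
      have c: "Z i j * a r = a r * Z i j" "Z i j * (a r)\<^sup>\<star> = (a r)\<^sup>\<star> * Z i j"
        using Z_a_r[of i j] Z_a_adj[of i j r] assms j False r_pos r_less by auto
      then have "Z i j * Q r = Q r * Z i j" unfolding Q_def by (intro commute_mult_right)
      then have "V * Z i j * Q r = a r * Z i j" by (simp only: mult.assoc mult_left_eq[OF V_Q_r])
      then show ?thesis by (simp add: left_diff_distrib mult.assoc V_Q_r c(1))
    qed
    fix l assume l: "r < l" "l \<le> N"
    have comm: "\<exists>L. ?C * a l = L * ?C" if "Z i j * a l = a l * Z i j"
    proof -
      have "?C * a l = a l * ?C"
        using commute_mult_left[OF that V_a[OF l]] commute_mult_left[OF V_a[OF l] that]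
        by (simp add: left_diff_distrib right_diff_distrib)
      then show ?thesis by blast
    qed
    have Cl: "?C * a l = Z i j * a l * V - V * (Z i j * a l)"
      using V_a[OF l] by (simp add: left_diff_distrib mult.assoc)
    consider "l < j" | "l = j" | "l = j + 1" | "j + 1 < l" by linarith
    then show "\<exists>L. ?C * a l = L * ?C"
    proof cases
      case 1
      then show ?thesis using comm Z_a_below[of i l j] assms j l r_pos by simp
    next
      case 2
      have "?C * a l = 0 * ?C" unfolding Cl using Z_a_same[of i j] 2 j assms by simp
      then show ?thesis by blast
    next
      case 3
      have z: "Z i j * a l = a l * Z i j + Z i (j + 1) * a j" using Z_a_next[of i j] 3 j assms by simp
      have "Z i (j + 1) * a j * V = V * (Z i (j + 1) * a j)"
        using j by (intro commute_mult_left IH V_a_all[symmetric]) auto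
      then have "?C * a l = a l * Z i j * V - V * a l * Z i j"
        unfolding Cl z by (simp add: distrib_left distrib_right mult.assoc)
      also have "\<dots> = a l * ?C" by (simp add: V_a[OF l] right_diff_distrib mult.assoc)
      finally show ?thesis by blast
    next
      case 4
      then show ?thesis using comm Z_a_above[of i j l] assms j l by simp
    qed
  qed (use r_less in auto)
  then show ?case by simp
qed

lemma central_Z:
  assumes "1 \<le> i" "i \<le> N" "1 \<le> j" "j \<le> N"
  shows "central (Z i j)"
proof -
  have up: "central (Z i j)" if "1 \<le> i" "i \<le> j" "j \<le> N" for i j
    using central_upper[of i j] V_a_all[of N] that r_less by (cases "i = N") (auto intro: centralI)
  have seg: "central (seg f k l)" if "\<And>m. k \<le> m \<Longrightarrow> m \<le> l \<Longrightarrow> central (f m)" for f k l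
    by (rule seg_closed[where P = central]) (use that central_one central_mult in auto)
  show ?thesis
  proof (cases "i \<le> j")
    case False
    have "central (D (j - 1) * U j (i - 1) * E (i + 1))"
      by (intro central_mult seg up) (use assms False in auto)
    then have "central ((Z i j)\<^sup>\<star>)" using star_lower[of j i] False assms by simp
    then show ?thesis using central_adj[of "(Z i j)\<^sup>\<star>"] by simp
  qed (use up assms in auto)
qed


subsection \<open>The commutant of the isometry\<close>

lemma X_Q_ge:
  assumes "r < l" "l \<le> N"
  shows "X * Q l = Q l * X"
proof -
  have *: "X * Q l = Q l * X" if "r + 1 < l" "l \<le> N" for l
    unfolding Q_def by (intro commute_mult_right X_a X_aadj that)
  show ?thesis
  proof (cases "l = r + 1")
    case True
    show ?thesis
    proof (cases "l = N")
      case False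
      have l: "r + 1 < l + 1" "l + 1 \<le> N" using True False assms by auto
      have e: "Q l = Q (l + 1) - a (l + 1) * (a (l + 1))\<^sup>\<star>"
        using Q_step[of "l + 1"] assms False by simp
      have "X * (a (l + 1) * (a (l + 1))\<^sup>\<star>) = a (l + 1) * (a (l + 1))\<^sup>\<star> * X"
        by (intro commute_mult_right X_a X_aadj l)
      then show ?thesis
        unfolding e left_diff_distrib right_diff_distrib using *[OF l] by simp
    qed (simp add: Q_top)
  qed (use * assms in auto)
qed

lemma P_X: "P * X = b"
  using X_Q_ge[of "r + 1"] X_Q r_less by simp

lemma X_b: "X * b = b * b" "X * a r = b * a r"
  using mult.assoc[of X P b] mult.assoc[of X P "a r"] by (simp_all add: X_Q P_a)

lemma Xadj_a: "\<lbrakk>r + 1 < l; l \<le> N\<rbrakk> \<Longrightarrow> X\<^sup>\<star> * a l = a l * X\<^sup>\<star>"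
  using arg_cong[OF X_aadj[of l], of adj] by simp

lemma Xadj_P: "X\<^sup>\<star> * P = b\<^sup>\<star>" "P * X\<^sup>\<star> = b\<^sup>\<star>"
  using arg_cong[OF P_X, of adj] arg_cong[OF X_Q, of adj] by simp_all

lemma X_isometry: "X\<^sup>\<star> * X = 1"
proof -
  have "X\<^sup>\<star> * X - 1 = 0"
  proof (rule vanishI[of "r + 1"])
    have "X\<^sup>\<star> * X * P = X\<^sup>\<star> * P * b" by (simp add: X_Q mult.assoc P_a)
    then show "(X\<^sup>\<star> * X - 1) * P = 0" by (simp add: Xadj_P Qr_a left_diff_distrib)
    fix l assume l: "r + 1 < l" "l \<le> N"
    have "(X\<^sup>\<star> * X - 1) * a l = a l * (X\<^sup>\<star> * X - 1)"
      using commute_mult_left[OF Xadj_a[OF l] X_a[OF l]] by (simp add: left_diff_distrib right_diff_distrib)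
    then show "\<exists>L. (X\<^sup>\<star> * X - 1) * a l = L * (X\<^sup>\<star> * X - 1)" by blast
  qed (use r_less in auto)
  then show ?thesis by simp
qed

lemma Xadj_b: "X\<^sup>\<star> * b = P" "X\<^sup>\<star> * a r = 0"
proof -
  have "X\<^sup>\<star> * b = X\<^sup>\<star> * P * b" "X\<^sup>\<star> * a r = X\<^sup>\<star> * P * a r" by (simp_all add: mult.assoc P_a)
  then show "X\<^sup>\<star> * b = P" "X\<^sup>\<star> * a r = 0" by (simp_all only: Xadj_P P_a Qr_a)
qed

lemma central_X: "central X"
proof -
  have "X * V - V * X = 0"
  proof (rule vanishI[of "r + 1"])
    have "X * V * P = X * P * V" using V_Q[of "r + 1"] r_less by (simp add: mult.assoc)
    then show "(X * V - V * X) * P = 0"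
      using V_a[of "r + 1"] r_less by (simp add: left_diff_distrib X_Q mult.assoc)
    fix l assume l: "r + 1 < l" "l \<le> N"
    have "(X * V - V * X) * a l = a l * (X * V - V * X)"
      using commute_mult_left[OF X_a[OF l] V_a[of l]] commute_mult_left[OF V_a[of l] X_a[OF l]] l
      by (simp add: left_diff_distrib right_diff_distrib)
    then show "\<exists>L. (X * V - V * X) * a l = L * (X * V - V * X)" by blast
  qed (use r_less in auto)
  then show ?thesis by (intro centralI) simp
qed

text \<open>\<open>G\<close> projects onto the vectors whose exponent of \<open>b\<close> is zero; on the range of \<open>P\<close> it is \<open>Q r\<close>.\<close>

definition G :: "'h bop" where "G = 1 - X * X\<^sup>\<star>"

lemma G_adj: "G\<^sup>\<star> = G"
  and G_X: "G * X = 0" and Xadj_G: "X\<^sup>\<star> * G = 0"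
proof -
  show "G\<^sup>\<star> = G" by (simp add: G_def)
  have "X * X\<^sup>\<star> * X = X" by (simp add: mult.assoc X_isometry)
  then show "G * X = 0" by (simp add: G_def left_diff_distrib)
  have "X\<^sup>\<star> * (X * X\<^sup>\<star>) = X\<^sup>\<star>" by (simp add: mult.assoc[symmetric] X_isometry)
  then show "X\<^sup>\<star> * G = 0" by (simp add: G_def right_diff_distrib)
qed

lemma G_a:
  assumes "r + 1 < l" "l \<le> N"
  shows "G * a l = a l * G"
  using commute_mult_left[OF X_a[OF assms] Xadj_a[OF assms]]
  unfolding G_def left_diff_distrib right_diff_distrib by simp

lemma G_b: "G * b = 0"
  using mult.assoc[of G X P] by (simp add: X_Q G_X)

lemma G_P: "G * P = Q r" "P * G = Q r"
proof -
  have "X * X\<^sup>\<star> * P = X * P * b\<^sup>\<star>" by (simp add: Xadj_P P_a mult.assoc)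
  then have "G * P = P - b * b\<^sup>\<star>" by (simp add: G_def left_diff_distrib X_Q)
  then show 1: "G * P = Q r" by (simp add: P_minus)
  show "P * G = Q r" using arg_cong[OF 1, of adj] by (simp add: G_adj)
qed

lemma central_G: "central G"
  using central_mult[OF central_X central_adj[OF central_X]]
  by (simp add: central_def G_def algebra_simps)

definition good :: "'h bop \<Rightarrow> bool" where
  "good T \<longleftrightarrow> T * X = X * T \<and> T * X\<^sup>\<star> = X\<^sup>\<star> * T"

lemma good_mult: "\<lbrakk>good S; good T\<rbrakk> \<Longrightarrow> good (S * T)"
  unfolding good_def using commute_mult_left by blast

lemma good_one: "good 1" and good_zero: "good 0"
  by (simp_all add: good_def)

lemma good_adj: "good T \<Longrightarrow> good (T\<^sup>\<star>)"
  unfolding good_def by (metis adj_mult adj_adj)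

lemma good_adjD: "good (T\<^sup>\<star>) \<Longrightarrow> good T"
  using good_adj[of "T\<^sup>\<star>"] by simp

lemma good_seg: "(\<And>m. \<lbrakk>k \<le> m; m \<le> l\<rbrakk> \<Longrightarrow> good (f m)) \<Longrightarrow> good (seg f k l)"
  by (rule seg_closed[where P = good]) (use good_one good_mult in auto)

lemma good_G: "good T \<Longrightarrow> T * G = G * T"
  using commute_mult_right[of T X "X\<^sup>\<star>"]
  unfolding good_def G_def left_diff_distrib right_diff_distrib by simp

lemma good_V: "good V"
  using central_X central_adj[OF central_X] by (simp add: central_def good_def)

lemma good_a: "\<lbrakk>r + 1 < l; l \<le> N\<rbrakk> \<Longrightarrow> good (a l)"
  by (simp add: good_def X_a Xadj_a)

lemma good_Q:
  assumes "r < l" "l \<le> N"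
  shows "good (Q l)"
proof -
  have "(X * Q l)\<^sup>\<star> = (Q l * X)\<^sup>\<star>" by (simp only: X_Q_ge[OF assms])
  then have "Q l * X\<^sup>\<star> = X\<^sup>\<star> * Q l" by simp
  then show ?thesis using X_Q_ge[OF assms] by (simp add: good_def)
qed

text \<open>The criterion for membership in the commutant of \<open>X\<close> and \<open>X\<^sup>\<star>\<close>, an instance of \<open>vanishI\<close> for the commutators:
  it is enough to compare on the range of \<open>P\<close> and to move \<open>T\<close> past the higher \<open>a l\<close> up to errors that already
  belong to the commutant.\<close>

lemma goodI_base:
  assumes base: "T * X * P = X * T * P" "T * X\<^sup>\<star> * P = X\<^sup>\<star> * T * P"
    and step: "\<And>l. \<lbrakk>r + 1 < l; l \<le> N\<rbrakk> \<Longrightarrow> good (T * a l - a l * T) \<or> good (T * a l)"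
  shows "good T"
proof -
  have *: "T * S = S * T"
    if S: "T * S * P = S * T * P" "\<And>l. \<lbrakk>r + 1 < l; l \<le> N\<rbrakk> \<Longrightarrow> S * a l = a l * S"
      "\<And>B. good B \<Longrightarrow> B * S = S * B" for S
  proof -
    have "T * S - S * T = 0"
    proof (rule vanishI[of "r + 1"])
      show "(T * S - S * T) * P = 0" using S(1) by (simp add: left_diff_distrib)
      fix l assume l: "r + 1 < l" "l \<le> N"
      have C: "(T * S - S * T) * a l = T * a l * S - S * (T * a l)"
        using S(2)[OF l] by (simp add: left_diff_distrib mult.assoc)
      from step[OF l] show "\<exists>L. (T * S - S * T) * a l = L * (T * S - S * T)"
      proof
        assume "good (T * a l - a l * T)"
        then have "(T * a l - a l * T) * S = S * (T * a l - a l * T)" by (rule S(3))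
        then have "T * a l * S - S * (T * a l) = a l * T * S - S * a l * T"
          by (simp add: algebra_simps)
        then have "(T * S - S * T) * a l = a l * (T * S - S * T)"
          unfolding C by (simp add: S(2)[OF l] right_diff_distrib mult.assoc)
        then show ?thesis by blast
      next
        assume "good (T * a l)"
        then have "(T * S - S * T) * a l = 0 * (T * S - S * T)" unfolding C using S(3) by simp
        then show ?thesis by blast
      qed
    qed (use r_less in auto)
    then show ?thesis by simp
  qed
  have "T * X = X * T"
    by (rule *[OF base(1) X_a]) (auto simp: good_def)
  moreover have "T * X\<^sup>\<star> = X\<^sup>\<star> * T"
    by (rule *[OF base(2) Xadj_a]) (auto simp: good_def)
  ultimately show ?thesis by (simp add: good_def)
qed

text \<open>The two ways in which the condition on the range of \<open>P\<close> will be met: \<open>T\<close> kills that range, or it commutes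
  with the operators \<open>b\<close> and \<open>a r\<close> whose ranges make it up.\<close>

lemma goodI_zero:
  assumes "T * a r = 0" "T * b = 0"
    and "\<And>l. \<lbrakk>r + 1 < l; l \<le> N\<rbrakk> \<Longrightarrow> good (T * a l - a l * T) \<or> good (T * a l)"
  shows "good T"
proof (rule goodI_base)
  have TP: "T * P = 0" by (rule zero_on_P) (use assms in auto)
  show "T * X * P = X * T * P" using assms TP by (simp add: mult.assoc X_Q)
  have "T * b\<^sup>\<star> = T * P * b\<^sup>\<star>" by (simp add: mult.assoc P_a)
  then show "T * X\<^sup>\<star> * P = X\<^sup>\<star> * T * P" using TP by (simp add: mult.assoc Xadj_P)
qed (fact assms(3))

lemma goodI:
  assumes comm: "T * a r = a r * T" "T * b = b * T"
    and "\<And>l. \<lbrakk>r + 1 < l; l \<le> N\<rbrakk> \<Longrightarrow> good (T * a l - a l * T) \<or> good (T * a l)"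
  shows "good T"
proof (rule goodI_base)
  have "T * P = b * T * b\<^sup>\<star> + a r * T * (a r)\<^sup>\<star>"
    by (simp add: P_split distrib_left mult.assoc[symmetric] comm)
  then have TP: "T * P = P * (T * P)"
    by (simp add: distrib_left mult.assoc[symmetric] P_a)
  have "X * (T * P) = X * P * (T * P)" using TP by (simp add: mult.assoc)
  also have "\<dots> = T * b" by (simp add: X_Q mult.assoc[symmetric] comm[symmetric]) (simp add: mult.assoc P_a)
  finally show "T * X * P = X * T * P" by (simp add: mult.assoc X_Q)
  have Tb: "T * b\<^sup>\<star> = P * (T * b\<^sup>\<star>)"
    using arg_cong[OF TP, of "\<lambda>S. S * b\<^sup>\<star>"] by (simp add: mult.assoc P_a)
  have "X\<^sup>\<star> * (T * P) = X\<^sup>\<star> * P * (T * P)" using TP by (simp add: mult.assoc)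
  also have "\<dots> = b\<^sup>\<star> * (T * b * b\<^sup>\<star>) + b\<^sup>\<star> * (T * a r * (a r)\<^sup>\<star>)"
    by (simp only: Xadj_P) (simp add: P_split distrib_left mult.assoc)
  also have "\<dots> = b\<^sup>\<star> * b * (T * b\<^sup>\<star>) + b\<^sup>\<star> * a r * (T * (a r)\<^sup>\<star>)"
    by (simp add: comm mult.assoc)
  also have "\<dots> = T * b\<^sup>\<star>" using Tb by (simp add: P_a Qr_a)
  finally show "T * X\<^sup>\<star> * P = X\<^sup>\<star> * T * P" by (simp add: mult.assoc Xadj_P)
qed (fact assms(3))

end


context crystal_factor begin

subsection \<open>Columns other than the exceptional two\<close>

text \<open>For \<open>j < r\<close> the adjoint \<open>(Z i j)\<^sup>\<star>\<close> commutes with every nonzero \<open>a l\<close>.\<close>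

lemma good_left:
  assumes "1 \<le> i" "i < N" "1 \<le> j" "j < r"
  shows "good (Z i j)"
proof (rule good_adjD, rule goodI)
  show "(Z i j)\<^sup>\<star> * a r = a r * (Z i j)\<^sup>\<star>" "(Z i j)\<^sup>\<star> * b = b * (Z i j)\<^sup>\<star>"
    using Zadj_a[of i j r] Zadj_a[of i j "r + 1"] assms r_less by auto
  show "good ((Z i j)\<^sup>\<star> * a l - a l * (Z i j)\<^sup>\<star>) \<or> good ((Z i j)\<^sup>\<star> * a l)" if "r + 1 < l" "l \<le> N" for l
    using Zadj_a[of i j l] assms that good_zero by simp
qed

text \<open>For \<open>j > r + 1\<close> and \<open>i \<le> j\<close> the adjoint trades a factor \<open>a j\<close> for \<open>a (j + 1)\<close> and moves to column
  \<open>j + 1\<close> (\<open>Zadj_a_same\<close>), leaving the exponent of \<open>b\<close> untouched.\<close>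

lemma good_upper:
  assumes "i \<le> j" "j \<le> N" "1 \<le> i" "i < N" "r + 1 < j"
  shows "good (Z i j)"
  using assms(2,1,5)
proof (induction j rule: inc_induct)
  case base
  show ?case
  proof (rule good_adjD, rule goodI)
    show "(Z i N)\<^sup>\<star> * a r = a r * (Z i N)\<^sup>\<star>" "(Z i N)\<^sup>\<star> * b = b * (Z i N)\<^sup>\<star>"
      using Zadj_a[of i N r] Zadj_a[of i N "r + 1"] assms base r_less r_pos by auto
    fix l assume l: "r + 1 < l" "l \<le> N"
    show "good ((Z i N)\<^sup>\<star> * a l - a l * (Z i N)\<^sup>\<star>) \<or> good ((Z i N)\<^sup>\<star> * a l)"
      using Zadj_a[of i N l] Zadj_a_top[of i] assms l good_zero by (cases "l = N") auto
  qed
next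
  case (step j)
  then have j: "i \<le> j" "j < N" "1 \<le> j" "r + 1 < j" using assms by auto
  have IH: "good (Z i (j + 1))" using step j by (simp add: Suc_eq_plus1[symmetric])
  show ?case
  proof (rule good_adjD, rule goodI)
    show "(Z i j)\<^sup>\<star> * a r = a r * (Z i j)\<^sup>\<star>" "(Z i j)\<^sup>\<star> * b = b * (Z i j)\<^sup>\<star>"
      using Zadj_a[of i j r] Zadj_a[of i j "r + 1"] assms j r_less r_pos by auto
    fix l assume l: "r + 1 < l" "l \<le> N"
    show "good ((Z i j)\<^sup>\<star> * a l - a l * (Z i j)\<^sup>\<star>) \<or> good ((Z i j)\<^sup>\<star> * a l)"
    proof (cases "l = j")
      case True
      have "good (a (j + 1) * Q j * (Z i (j + 1))\<^sup>\<star>)"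
        using j by (intro good_mult good_a good_Q good_adj IH) auto
      then show ?thesis using Zadj_a_same[of i j] True assms j by simp
    qed (use Zadj_a[of i j l] assms j l good_zero in simp)
  qed
qed

lemma good_diag_right: "\<lbrakk>r + 1 < m; m \<le> N\<rbrakk> \<Longrightarrow> good (Z m m)"
  using good_upper[of m m] good_a[of N] by (cases "m = N") auto

lemma Z_rr_b: "Z r r * b = b * Z r r + Z r (r + 1) * a r"
  using Z_a_next[of r r] r_pos r_less by simp

text \<open>Raising the exponent of \<open>b\<close> first makes \<open>Z r r\<close> commute with \<open>X\<close>; for higher exponents \<open>k\<^sub>l\<close> both sides
  vanish because \<open>b * a l = 0\<close>.\<close>

lemma good_Z_rr_b: "good (Z r r * b)"
proof (rule goodI_base)
  have za: "Z r r * a r = 0" using Z_a_same[of r r] r_pos r_less by simp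
  have zc: "Z r (r + 1) * a r = a r * Z r (r + 1)" using Z_a_below[of r r "r + 1"] r_pos r_less by simp
  have zb: "Z r r * b\<^sup>\<star> = b\<^sup>\<star> * Z r r" using Z_a_adj[of r r "r + 1"] r_pos r_less by simp
  have PF: "P * (Z r r * b) = Z r r * b"
    unfolding Z_rr_b zc by (simp add: distrib_left mult.assoc[symmetric] P_a)
  have "Z r r * b * X * P = Z r r * b * b" by (simp add: mult.assoc X_Q)
  also have "\<dots> = b * Z r r * b" by (simp add: Z_rr_b distrib_right mult.assoc P_a)
  also have "\<dots> = X * (P * (Z r r * b))" by (simp add: mult.assoc[symmetric] X_Q)
  also have "\<dots> = X * (Z r r * b) * P" by (simp add: PF mult.assoc P_a)
  finally show "Z r r * b * X * P = X * (Z r r * b) * P" .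
  have "Z r r * Q r = 0" by (rule zero_on_Qr[OF za])
  then have "Z r r * (b * b\<^sup>\<star>) = Z r r * P" by (simp add: P_minus[symmetric] right_diff_distrib)
  then have "Z r r * b * X\<^sup>\<star> * P = Z r r * P" by (simp add: mult.assoc Xadj_P)
  also have "\<dots> = b\<^sup>\<star> * (Z r r * b)" by (simp add: mult.assoc[symmetric] zb[symmetric]) (simp add: mult.assoc Qr_a)
  also have "\<dots> = X\<^sup>\<star> * (P * (Z r r * b))" by (simp add: mult.assoc[symmetric] Xadj_P)
  also have "\<dots> = X\<^sup>\<star> * (Z r r * b) * P" by (simp add: PF mult.assoc P_a)
  finally show "Z r r * b * X\<^sup>\<star> * P = X\<^sup>\<star> * (Z r r * b) * P" .
  fix l assume l: "r + 1 < l" "l \<le> N"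
  have "Z r r * b * a l = 0" using a_row[of "r + 1" l] l by (simp add: mult.assoc)
  then show "good (Z r r * b * a l - a l * (Z r r * b)) \<or> good (Z r r * b * a l)" using good_zero by simp
qed

text \<open>\<open>Z (r + 1) (r + 1)\<close> raises the exponent of \<open>b\<close> and \<open>Z r r\<close> lowers it, so neither commutes with \<open>X\<close> in
  general, but their product does.\<close>

lemma good_diag_pair: "good (Z r r * Z (r + 1) (r + 1))"
proof (cases "r + 1 = N")
  case True
  then show ?thesis using good_Z_rr_b by simp
next
  case False
  let ?z = "Z (r + 1) (r + 1)"
  show ?thesis
  proof (rule goodI_zero)
    have "?z * a r = 0" "?z * b = 0"
      using Z_a_below_zero[of "r + 1" r "r + 1"] Z_a_same[of "r + 1" "r + 1"] r_pos r_less False by auto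
    then show "Z r r * ?z * a r = 0" "Z r r * ?z * b = 0" by (simp_all add: mult.assoc)
    fix l assume l: "r + 1 < l" "l \<le> N"
    have zl: "Z r r * a l = a l * Z r r" using Z_a_above[of r r l] l r_pos by simp
    have "good (Z r r * ?z * a l - a l * (Z r r * ?z))"
    proof (cases "l = r + 2")
      case True
      let ?y = "Z (r + 1) (r + 2)"
      have "?z * a l = a l * ?z + ?y * b"
        using Z_a_next[of "r + 1" "r + 1"] True l by (simp add: add.assoc)
      moreover have "?y * b = b * ?y" using Z_a_below[of "r + 1" "r + 1" "r + 2"] True l by simp
      ultimately have zz: "?z * a l = a l * ?z + b * ?y" by simp
      have "Z r r * ?z * a l - a l * (Z r r * ?z) = Z r r * b * ?y"
        unfolding mult.assoc zz by (simp add: distrib_left zl mult.assoc[symmetric])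
      moreover have "good ?y" using good_upper[of "r + 1" "r + 2"] True l by simp
      ultimately show ?thesis using good_mult[OF good_Z_rr_b] by simp
    next
      case False
      then have "?z * a l = a l * ?z" using Z_a_above[of "r + 1" "r + 1" l] l by simp
      from commute_mult_left[OF zl this] show ?thesis using good_zero by simp
    qed
    then show "good (Z r r * ?z * a l - a l * (Z r r * ?z)) \<or> good (Z r r * ?z * a l)" by simp
  qed
qed

lemma good_D_left: "good (D (r - 1))"
  by (rule good_seg) (use good_left r_less in auto)

text \<open>For \<open>r + 1 < j < i\<close> the product that represents \<open>(Z i j)\<^sup>\<star>\<close> contains \<open>Z r r\<close> and \<open>Z (r + 1) (r + 1)\<close> only
  as the adjacent pair of \<open>good_diag_pair\<close>.\<close>

lemma good_other_columns:
  assumes "1 \<le> i" "i \<le> N" "1 \<le> j" "j \<le> N" "j \<noteq> r" "j \<noteq> r + 1"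
  shows "good (Z i j)"
proof -
  consider "i = N" "j < r" | "i = N" "r + 1 < j" | "i < N" "j < r" | "i < N" "i \<le> j" "r + 1 < j"
    | "r + 1 < j" "j < i" "i < N" using assms by linarith
  then show ?thesis
  proof cases
    case 5
    have "D (j - 1) = D r * seg (\<lambda>m. Z m m) (r + 1) (j - 1)"
      using seg_split[of 1 r "j - 1" "\<lambda>m. Z m m"] 5 r_pos by simp
    also have "D r = D (r - 1) * Z r r"
      using seg_last[of 1 "r - 1" "\<lambda>m. Z m m"] r_pos by simp
    also have "seg (\<lambda>m. Z m m) (r + 1) (j - 1) = Z (r + 1) (r + 1) * seg (\<lambda>m. Z m m) (r + 2) (j - 1)"
      using seg_first[of "r + 1" "j - 1" "\<lambda>m. Z m m"] 5 by (simp add: add.assoc)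
    finally have "D (j - 1) = D (r - 1) * (Z r r * Z (r + 1) (r + 1)) * seg (\<lambda>m. Z m m) (r + 2) (j - 1)"
      by (simp add: mult.assoc)
    moreover have "good (seg (\<lambda>m. Z m m) (r + 2) (j - 1))"
      by (rule good_seg) (use good_diag_right 5 in auto)
    moreover have "good (U j (i - 1))" by (rule good_seg) (use good_upper 5 in auto)
    moreover have "good (E (i + 1))" by (rule good_seg) (use good_diag_right 5 in auto)
    ultimately have "good (D (j - 1) * U j (i - 1) * E (i + 1))"
      using good_D_left good_diag_pair by (simp add: good_mult)
    then show ?thesis using star_lower[of j i] 5 assms good_adjD by simp
  qed (use assms a_below good_zero good_a good_left good_upper in auto)
qed


subsection \<open>The two exceptional columns\<close>

text \<open>\<open>W = V\<^sup>\<star> * X\<close> differs from \<open>X\<close> by the central unitary \<open>V\<close>, so most of the work is about \<open>X\<close>.  For \<open>i \<le> r\<close> the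
  operator \<open>Z i r\<close> lowers the exponent of \<open>b\<close>: its adjoint maps \<open>a r\<close> to \<open>b * Q r * (Z i (r + 1))\<^sup>\<star>\<close>.  It therefore
  kills the range of \<open>G\<close>, and \<open>Z i r * X\<close> keeps all exponents.\<close>

lemma upper_kills_G:
  assumes i: "1 \<le> i" "i \<le> r"
  shows "Z i r * G = 0"
proof -
  have "G * (Z i r)\<^sup>\<star> = 0"
  proof (rule vanishI[of "r + 1"])
    have "G * (Z i r)\<^sup>\<star> * b = G * b * (Z i r)\<^sup>\<star>"
      using Zadj_a[of i r "r + 1"] i r_less by (simp add: mult.assoc)
    moreover have "G * (Z i r)\<^sup>\<star> * a r = G * b * (Q r * (Z i (r + 1))\<^sup>\<star>)"
      using Zadj_a_same[of i r] i r_less by (simp add: mult.assoc)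
    ultimately show "G * (Z i r)\<^sup>\<star> * P = 0" by (intro zero_on_P) (simp_all add: G_b)
    fix l assume l: "r + 1 < l" "l \<le> N"
    have "(Z i r)\<^sup>\<star> * a l = a l * (Z i r)\<^sup>\<star>" using Zadj_a[of i r l] i l r_less by simp
    then show "\<exists>L. G * (Z i r)\<^sup>\<star> * a l = L * (G * (Z i r)\<^sup>\<star>)"
      using commute_mult_left[OF G_a[OF l]] by blast
  qed (use r_less in auto)
  from arg_cong[OF this, of adj] show ?thesis by (simp add: G_adj)
qed

lemma XX_G: "X * X\<^sup>\<star> = 1 - G"
  by (simp add: G_def)

lemma good_upper_r:
  assumes i: "1 \<le> i" "i \<le> r"
  shows "good (Z i r * X)"
proof (rule good_adjD, unfold adj_mult, rule goodI)
  let ?z = "(Z i r)\<^sup>\<star>" and ?y = "(Z i (r + 1))\<^sup>\<star>"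
  have zb: "?z * b = b * ?z" using Zadj_a[of i r "r + 1"] i r_less by simp
  have zr: "?z * a r = b * Q r * ?y" using Zadj_a_same[of i r] i r_less by simp
  have bz: "b\<^sup>\<star> * ?z = ?z * b\<^sup>\<star> + (a r)\<^sup>\<star> * ?y"
    using arg_cong[OF Z_a_next[of i r], of adj] i r_less by (simp add: algebra_simps)
  have "Z i r * a r = 0" using Z_a_same[of i r] i r_less by simp
  from arg_cong[OF zero_on_Qr[OF this], of adj] have Qz: "Q r * ?z = 0" by simp
  then have az: "a r * ?z = 0" using mult.assoc[of "a r" "Q r" ?z] by (simp add: Qr_a)
  have Gz: "G * ?z = 0" using arg_cong[OF upper_kills_G[OF i], of adj] by (simp add: G_adj)
  have "b * (X\<^sup>\<star> * ?z) = P * (X * X\<^sup>\<star>) * ?z" by (simp add: mult.assoc[symmetric] P_X)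
  also have "\<dots> = P * ?z" by (simp add: XX_G algebra_simps Gz)
  also have "\<dots> = X\<^sup>\<star> * ?z * b" by (simp add: mult.assoc zb) (simp add: mult.assoc[symmetric] Xadj_b)
  finally show "X\<^sup>\<star> * ?z * b = b * (X\<^sup>\<star> * ?z)" by simp
  have "a r * (X\<^sup>\<star> * ?z) = a r * (P * X\<^sup>\<star>) * ?z" by (simp add: mult.assoc[symmetric] P_a)
  also have "\<dots> = a r * (b\<^sup>\<star> * ?z)" by (simp add: Xadj_P mult.assoc)
  also have "\<dots> = a r * ?z * b\<^sup>\<star> + a r * (a r)\<^sup>\<star> * ?y" by (simp add: bz distrib_left mult.assoc)
  also have "\<dots> = Q r * ?y" by (simp add: az a_r_normal)
  also have "\<dots> = X\<^sup>\<star> * b * Q r * ?y" by (simp add: Xadj_b P_a)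
  also have "\<dots> = X\<^sup>\<star> * ?z * a r" by (simp add: zr mult.assoc)
  finally show "X\<^sup>\<star> * ?z * a r = a r * (X\<^sup>\<star> * ?z)" by simp
  fix l assume l: "r + 1 < l" "l \<le> N"
  have "?z * a l = a l * ?z" using Zadj_a[of i r l] i l r_less by simp
  from commute_mult_left[OF Xadj_a[OF l] this]
  show "good (X\<^sup>\<star> * ?z * a l - a l * (X\<^sup>\<star> * ?z)) \<or> good (X\<^sup>\<star> * ?z * a l)" using good_zero by simp
qed

text \<open>\<open>Z i (r + 1)\<close> either raises the exponent of \<open>b\<close>, which \<open>X\<^sup>\<star>\<close> undoes, or leaves it at zero, where
  \<open>X\<^sup>\<star>\<close> vanishes.\<close>

lemma good_upper_Suc_r:
  assumes i: "1 \<le> i" "i \<le> r"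
  shows "good (X\<^sup>\<star> * Z i (r + 1))"
proof (rule goodI_zero)
  let ?y = "Z i (r + 1)"
  have "?y * a r = a r * ?y" using Z_a_below[of i r "r + 1"] i r_less by simp
  then have "X\<^sup>\<star> * ?y * a r = X\<^sup>\<star> * a r * ?y" by (simp add: mult.assoc)
  then show "X\<^sup>\<star> * ?y * a r = 0" by (simp add: Xadj_b)
  have "?y * b = 0" using Z_a_same[of i "r + 1"] i r_less by simp
  then show "X\<^sup>\<star> * ?y * b = 0" by (simp add: mult.assoc)
  fix l assume l: "r + 1 < l" "l \<le> N"
  show "good (X\<^sup>\<star> * ?y * a l - a l * (X\<^sup>\<star> * ?y)) \<or> good (X\<^sup>\<star> * ?y * a l)"
  proof (cases "l = r + 2")
    case True
    let ?x = "Z i (r + 2)"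
    have "?y * a l = a l * ?y + ?x * b"
      using Z_a_next[of i "r + 1"] True l i by (simp add: add.assoc)
    moreover have "?x * b = b * ?x" using Z_a_below[of i "r + 1" "r + 2"] True l i by simp
    ultimately have y: "?y * a l = a l * ?y + b * ?x" by simp
    have "X\<^sup>\<star> * ?y * a l = X\<^sup>\<star> * a l * ?y + X\<^sup>\<star> * b * ?x"
      unfolding mult.assoc y by (simp add: distrib_left)
    then have "X\<^sup>\<star> * ?y * a l - a l * (X\<^sup>\<star> * ?y) = P * ?x"
      by (simp add: Xadj_b Xadj_a[OF l] mult.assoc)
    moreover have "good (P * ?x)" using good_upper[of i "r + 2"] True l i by (intro good_mult good_Q) auto
    ultimately show ?thesis by simp
  next
    case False
    then have "?y * a l = a l * ?y" using Z_a_above[of i "r + 1" l] i l by simp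
    from commute_mult_left[OF Xadj_a[OF l] this] show ?thesis using good_zero by simp
  qed
qed

text \<open>The two columns carry the same off-diagonal coefficient: the part of \<open>Z i (r + 1)\<close> that ends in exponent
  zero agrees, up to \<open>V\<close>, with what \<open>Z i r\<close> does to exponent one.\<close>

lemma columns_link:
  assumes i: "1 \<le> i" "i \<le> r"
  shows "G * Z i (r + 1) * V = G * Z i r * X"
proof -
  let ?z = "Z i r" and ?y = "Z i (r + 1)"
  let ?B = "?y * V - ?z * X"
  have zr: "?z * a r = 0" using Z_a_same[of i r] i r_less by simp
  have zb: "?z * b = b * ?z + ?y * a r" using Z_a_next[of i r] i r_less by simp
  have yb: "?y * b = 0" using Z_a_same[of i "r + 1"] i r_less by simp
  have Vb: "V * b = b * V" using V_a[of "r + 1"] r_less by simp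
  have "G * ?B = 0"
  proof (rule vanishI[of "r + 1"])
    have "?z * b * b = (b * ?z + ?y * a r) * b" by (simp only: zb)
    also have "\<dots> = b * (?z * b) + ?y * (a r * b)" by (simp only: distrib_right mult.assoc)
    also have "\<dots> = b * (?z * b)" by (simp add: P_a)
    finally have "?z * b * b = b * (?z * b)" .
    then have "?B * b = - (b * (?z * b))"
      by (simp add: left_diff_distrib mult.assoc Vb X_b) (simp add: mult.assoc[symmetric] yb)
    then have 1: "G * ?B * b = 0"
      using mult_left_eq[OF G_b] by (simp add: mult.assoc)
    have "?B * a r = ?y * (a r * a r) - ?z * b * a r"
      by (simp add: left_diff_distrib mult.assoc V_a_r(2) X_b)
    also have "\<dots> = 0" by (simp add: zb distrib_right mult.assoc zr)
    finally have 2: "G * ?B * a r = 0" by (simp add: mult.assoc)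
    show "G * ?B * P = 0" using 1 2 by (rule zero_on_P)
    fix l assume l: "r + 1 < l" "l \<le> N"
    have zl: "?z * a l = a l * ?z" using Z_a_above[of i r l] i l by simp
    have Bl: "?B * a l = ?y * a l * V - a l * (?z * X)"
      using V_a[of l] l by (simp add: left_diff_distrib mult.assoc X_a) (simp add: mult.assoc[symmetric] zl)
    have "G * (?y * a l) = G * a l * ?y"
    proof (cases "l = r + 2")
      case True
      let ?x = "Z i (r + 2)"
      have "?y * a l = a l * ?y + ?x * b"
        using Z_a_next[of i "r + 1"] True l i by (simp add: add.assoc)
      moreover have "?x * b = b * ?x" using Z_a_below[of i "r + 1" "r + 2"] True l i by simp
      ultimately have y: "?y * a l = a l * ?y + b * ?x" by simp
      show ?thesis unfolding y using mult_left_eq[OF G_b] by (simp add: distrib_left mult.assoc)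
    next
      case False
      then have "?y * a l = a l * ?y" using Z_a_above[of i "r + 1" l] i l by simp
      then show ?thesis by (simp add: mult.assoc)
    qed
    then have "G * ?B * a l = G * a l * ?y * V - G * a l * (?z * X)"
      unfolding mult.assoc[of G] Bl by (simp add: right_diff_distrib) (simp add: mult.assoc[symmetric])
    also have "\<dots> = a l * (G * ?B)" by (simp add: G_a[OF l] right_diff_distrib mult.assoc)
    finally show "\<exists>L. G * ?B * a l = L * (G * ?B)" by blast
  qed (use r_less in auto)
  then show ?thesis by (simp add: right_diff_distrib mult.assoc)
qed

text \<open>Below row \<open>r\<close> the adjoints of both columns share the right factor \<open>H\<close>, which lies in the
  commutant.\<close>

lemma lower_columns:
  assumes i: "r < i" "i < N"
  obtains H where "good H" "central H"
    "(Z i r)\<^sup>\<star> = D (r - 1) * Z r (r + 1) * H" "(Z i (r + 1))\<^sup>\<star> = D (r - 1) * Z r r * H"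
proof -
  define H where "H = U (r + 1) (i - 1) * E (i + 1)"
  have "good (U (r + 1) (i - 1))" by (rule good_seg) (use good_upper i in auto)
  moreover have "good (E (i + 1))" by (rule good_seg) (use good_diag_right i in auto)
  ultimately have 1: "good H" by (simp add: H_def good_mult)
  have seg: "central (seg f k l)" if "\<And>m. k \<le> m \<Longrightarrow> m \<le> l \<Longrightarrow> central (f m)" for f k l
    by (rule seg_closed[where P = central]) (use that central_one central_mult in auto)
  have 2: "central H" unfolding H_def
    by (intro central_mult seg central_Z) (use i r_pos in auto)
  have "U r (i - 1) = Z r (r + 1) * U (r + 1) (i - 1)"
    using seg_first[of r "i - 1" "\<lambda>m. Z m (m + 1)"] i by simp
  then have 3: "(Z i r)\<^sup>\<star> = D (r - 1) * Z r (r + 1) * H"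
    using star_lower[of r i] i r_pos by (simp add: H_def mult.assoc)
  have D: "D r = D (r - 1) * Z r r"
    using seg_last[of 1 "r - 1" "\<lambda>m. Z m m"] r_pos by simp
  have "(Z i (r + 1))\<^sup>\<star> = D r * (U (r + 1) (i - 1) * E (i + 1))"
    using star_lower[of "r + 1" i] star_diag[of i] i by (cases "i = r + 1") (auto simp: mult.assoc)
  then have 4: "(Z i (r + 1))\<^sup>\<star> = D (r - 1) * Z r r * H"
    by (simp add: D H_def mult.assoc)
  show thesis by (rule that[OF 1 2 3 4])
qed

lemma good_columns:
  assumes i: "1 \<le> i" "i \<le> N"
  shows "good (Z i r * X)" "good (X\<^sup>\<star> * Z i (r + 1))"
proof -
  consider "i \<le> r" | "r < i" "i < N" | "i = N" using i by linarith
  then have "good (Z i r * X) \<and> good (X\<^sup>\<star> * Z i (r + 1))"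
  proof cases
    case 1
    then show ?thesis using good_upper_r good_upper_Suc_r i by simp
  next
    case 2
    obtain H where H: "good H" "(Z i r)\<^sup>\<star> = D (r - 1) * Z r (r + 1) * H"
      "(Z i (r + 1))\<^sup>\<star> = D (r - 1) * Z r r * H"
      by (rule lower_columns[OF 2])
    have DX: "X\<^sup>\<star> * D (r - 1) = D (r - 1) * X\<^sup>\<star>" and HX: "H * X = X * H"
      using good_D_left H(1) by (simp_all add: good_def)
    have "(Z i r * X)\<^sup>\<star> = D (r - 1) * (X\<^sup>\<star> * Z r (r + 1)) * H"
      by (simp add: H(2) mult.assoc[symmetric] DX)
    moreover have "(X\<^sup>\<star> * Z i (r + 1))\<^sup>\<star> = D (r - 1) * (Z r r * X) * H"
      by (simp add: H(3) mult.assoc HX)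
    moreover have "good (D (r - 1) * (X\<^sup>\<star> * Z r (r + 1)) * H)" "good (D (r - 1) * (Z r r * X) * H)"
      using good_D_left H(1) good_upper_r[of r] good_upper_Suc_r[of r] r_pos by (auto intro: good_mult)
    ultimately show ?thesis by (metis good_adjD)
  next
    case 3
    have "a r * X = a r * (P * X)" by (simp only: mult.assoc[symmetric] P_a)
    then have "a r * X = 0" by (simp add: P_X P_a)
    then show ?thesis using 3 good_zero Xadj_b good_Q[of "r + 1"] r_less by simp
  qed
  then show "good (Z i r * X)" "good (X\<^sup>\<star> * Z i (r + 1))" by auto
qed

definition W :: "'h bop" where "W = V\<^sup>\<star> * X"

lemma VX: "V * X = X * V" "V * X\<^sup>\<star> = X\<^sup>\<star> * V" "V\<^sup>\<star> * X = X * V\<^sup>\<star>" "V\<^sup>\<star> * X\<^sup>\<star> = X\<^sup>\<star> * V\<^sup>\<star>"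
  using central_X central_adj[OF central_X] by (simp_all add: central_def)

lemma W_adj: "W\<^sup>\<star> = V * X\<^sup>\<star>"
  by (simp add: W_def VX)

lemma WW: "W * W\<^sup>\<star> = 1 - G"
proof -
  have "W * W\<^sup>\<star> = X * (V\<^sup>\<star> * V) * X\<^sup>\<star>" unfolding W_adj unfolding W_def by (simp add: VX mult.assoc)
  then show ?thesis by (simp add: V_isometry G_def)
qed

lemma commute_W:
  assumes "good T" "central T"
  shows "T * W = W * T" "T * W\<^sup>\<star> = W\<^sup>\<star> * T"
  unfolding W_adj unfolding W_def
  using assms by (auto simp only: good_def central_def intro!: commute_mult_right)

lemma Y_column_r:
  assumes "1 \<le> i" "i \<le> N"
  shows "good (Z i r * W)" "central (Z i r * W)"
proof -
  have c: "central (Z i r)" using central_Z assms r_pos r_less by simp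
  have cV: "central (V\<^sup>\<star>)" by (simp add: central_def V_isometry V_coisometry)
  have "Z i r * W = V\<^sup>\<star> * (Z i r * X)" using c by (simp add: W_def central_def mult.assoc[symmetric])
  then show "good (Z i r * W)" using good_mult[OF good_adj[OF good_V] good_columns(1)[OF assms]] by simp
  show "central (Z i r * W)" unfolding W_def by (intro central_mult c cV central_X)
qed

lemma Y_column_Suc_r:
  assumes "1 \<le> i" "i \<le> N"
  shows "good (W\<^sup>\<star> * Z i (r + 1))" "central (W\<^sup>\<star> * Z i (r + 1))"
proof -
  have c: "central (Z i (r + 1))" using central_Z assms r_less by simp
  have cV: "central V" by (simp add: central_def V_isometry V_coisometry)
  show "good (W\<^sup>\<star> * Z i (r + 1))"
    using good_mult[OF good_V good_columns(2)[OF assms]] by (simp add: W_adj mult.assoc)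
  show "central (W\<^sup>\<star> * Z i (r + 1))" unfolding W_adj by (intro central_mult c cV central_adj central_X)
qed

lemma WZW: "1 \<le> i \<Longrightarrow> i \<le> N \<Longrightarrow> W\<^sup>\<star> * Z i (r + 1) * W = X\<^sup>\<star> * Z i (r + 1) * X"
proof -
  assume i: "1 \<le> i" "i \<le> N"
  have c: "Z i (r + 1) * V\<^sup>\<star> = V\<^sup>\<star> * Z i (r + 1)" using central_Z[of i "r + 1"] i r_less by (simp add: central_def)
  have "W\<^sup>\<star> * Z i (r + 1) * W = X\<^sup>\<star> * V * (Z i (r + 1) * V\<^sup>\<star>) * X"
    unfolding W_adj VX(2) unfolding W_def by (simp only: mult.assoc)
  also have "\<dots> = X\<^sup>\<star> * (V * V\<^sup>\<star>) * Z i (r + 1) * X" by (simp add: c mult.assoc)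
  finally show ?thesis by (simp add: V_coisometry)
qed

text \<open>With \<open>G = 1 - W * W\<^sup>\<star>\<close>, the next three lemmas are the factorization of the columns \<open>r\<close> and \<open>r + 1\<close>; the
  summand with \<open>G\<close> is present exactly when both \<open>r\<close> and \<open>r + 1\<close> lie between \<open>i\<close> and \<open>j\<close>.\<close>

lemma factor_r_upper:
  assumes i: "1 \<le> i" "i \<le> r"
  shows "Z i r = Z i r * W * W\<^sup>\<star>"
  using upper_kills_G[OF i] by (simp add: mult.assoc WW right_diff_distrib)

lemma factor_Suc_r_upper:
  assumes i: "1 \<le> i" "i \<le> r"
  shows "Z i (r + 1) = Z i r * W * G + W\<^sup>\<star> * Z i (r + 1) * W"
proof -
  let ?y = "Z i (r + 1)"
  have iN: "i \<le> N" using i r_less by simp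
  have c: "central (Z i r)" using central_Z i iN r_pos r_less by simp
  have "X\<^sup>\<star> * ?y * X = X * (X\<^sup>\<star> * ?y)" using good_columns(2)[OF i(1) iN] by (simp add: good_def)
  also have "\<dots> = ?y - G * ?y" by (simp add: mult.assoc[symmetric] XX_G left_diff_distrib)
  finally have 1: "W\<^sup>\<star> * ?y * W = ?y - G * ?y" using WZW[OF i(1) iN] by simp
  have "Z i r * W * G = V\<^sup>\<star> * (Z i r * X * G)" using c by (simp add: W_def central_def mult.assoc[symmetric])
  also have "\<dots> = V\<^sup>\<star> * (G * Z i r * X)" using good_G[OF good_columns(1)[OF i(1) iN]] by (simp add: mult.assoc)
  also have "\<dots> = V\<^sup>\<star> * (G * ?y * V)" by (simp only: columns_link[OF i])
  also have "\<dots> = V\<^sup>\<star> * (G * ?y) * V" by (simp only: mult.assoc)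
  also have "V\<^sup>\<star> * (G * ?y) = G * ?y * V\<^sup>\<star>"
    using central_mult[OF central_G central_Z[of i "r + 1"]] i iN r_less by (simp add: central_def)
  also have "G * ?y * V\<^sup>\<star> * V = G * ?y" by (simp only: mult.assoc V_isometry mult_1_right)
  finally show ?thesis using 1 by simp
qed

text \<open>For \<open>i < N\<close> both identities are the ones of row \<open>r\<close>, multiplied by \<open>D (r - 1)\<close> and \<open>H\<close>.\<close>

lemma factor_lower:
  assumes i: "r < i" "i \<le> N"
  shows "Z i r = Z i r * W * W\<^sup>\<star> + W\<^sup>\<star> * Z i (r + 1) * G"
    and "Z i (r + 1) = W\<^sup>\<star> * Z i (r + 1) * W"
proof -
  let ?z = "Z i r" and ?y = "Z i (r + 1)"
  have i1: "1 \<le> i" using i by simp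
  have "G * ?z\<^sup>\<star> * V = G * ?y\<^sup>\<star> * X \<and> ?y = X\<^sup>\<star> * ?y * X"
  proof (cases "i = N")
    case True
    have "P * (a r)\<^sup>\<star> = (a r)\<^sup>\<star>" using arg_cong[OF P_a(4), of adj] by simp
    then have "G * (a r)\<^sup>\<star> = G * P * (a r)\<^sup>\<star>" by (simp add: mult.assoc)
    then have "G * (a r)\<^sup>\<star> = (a r)\<^sup>\<star>" by (simp only: G_P Qr_a)
    moreover have "G * b\<^sup>\<star> * X = G * P * (X\<^sup>\<star> * X)" by (simp only: Xadj_P(2)[symmetric] mult.assoc)
    moreover have "(a r)\<^sup>\<star> * V = Q r"
    proof -
      have "(a r)\<^sup>\<star> * V = V\<^sup>\<star> * (Q r * V)" by (simp only: Vadj_Q_r[symmetric] mult.assoc)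
      also have "\<dots> = V\<^sup>\<star> * Q r * a r" by (simp only: Q_r_V mult.assoc Qr_a)
      finally show ?thesis by (simp only: Vadj_Q_r Qr_a)
    qed
    moreover have "X\<^sup>\<star> * b * X = b" by (simp add: Xadj_b P_X)
    ultimately show ?thesis using True by (simp add: X_isometry G_P)
  next
    case False
    then have "i < N" using i by simp
    obtain H where H: "good H" "central H" "?z\<^sup>\<star> = D (r - 1) * Z r (r + 1) * H"
      "?y\<^sup>\<star> = D (r - 1) * Z r r * H"
      by (rule lower_columns[OF i(1) \<open>i < N\<close>])
    have DG: "G * D (r - 1) = D (r - 1) * G" and HG: "H * G = G * H" and HX: "H * X = X * H"
      and HV: "H * V = V * H"
      using good_G[OF good_D_left] good_G[OF H(1)] H(1,2) by (simp_all add: good_def central_def)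
    have "G * ?z\<^sup>\<star> * V = G * D (r - 1) * Z r (r + 1) * (H * V)" by (simp add: H(3) mult.assoc)
    also have "\<dots> = D (r - 1) * (G * Z r (r + 1) * V) * H" by (simp add: DG HV mult.assoc)
    also have "\<dots> = D (r - 1) * (G * Z r r * X) * H" using columns_link[of r] r_pos by simp
    also have "\<dots> = G * D (r - 1) * Z r r * (H * X)" by (simp add: DG HX mult.assoc)
    also have "\<dots> = G * ?y\<^sup>\<star> * X" by (simp add: H(4) mult.assoc)
    finally have 1: "G * ?z\<^sup>\<star> * V = G * ?y\<^sup>\<star> * X" .
    have "?y\<^sup>\<star> * G = D (r - 1) * (Z r r * G) * H" by (simp add: H(4) HG mult.assoc)
    then have "?y\<^sup>\<star> * G = 0" using upper_kills_G[of r] r_pos by simp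
    then have "?y\<^sup>\<star> = ?y\<^sup>\<star> * X * X\<^sup>\<star>" by (simp add: mult.assoc XX_G right_diff_distrib)
    also have "\<dots> = X\<^sup>\<star> * (?y\<^sup>\<star> * X)"
      using good_adj[OF good_columns(2)[OF i1 i(2)]] by (simp add: good_def)
    finally have "?y\<^sup>\<star> = (X\<^sup>\<star> * ?y * X)\<^sup>\<star>" by (simp add: mult.assoc)
    then show ?thesis using 1 by (simp only: adj_eq_iff)
  qed
  then have 1: "G * ?z\<^sup>\<star> * V = G * ?y\<^sup>\<star> * X" and 2: "?y = X\<^sup>\<star> * ?y * X" by auto
  show "?y = W\<^sup>\<star> * ?y * W" using WZW[OF i1 i(2)] 2 by simp
  have "V\<^sup>\<star> * (?z * G) = X\<^sup>\<star> * (?y * G)" using arg_cong[OF 1, of adj] by (simp add: G_adj)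
  then have "V * (V\<^sup>\<star> * (?z * G)) = V * (X\<^sup>\<star> * (?y * G))" by simp
  then have "?z * G = W\<^sup>\<star> * ?y * G" by (simp add: W_adj mult.assoc[symmetric] V_coisometry)
  then show "?z = ?z * W * W\<^sup>\<star> + W\<^sup>\<star> * ?y * G"
    by (simp add: mult.assoc WW right_diff_distrib)
qed

end


section \<open>Representations are contractive\<close>

text \<open>If \<open>\<parallel>T\<parallel>\<^sup>2 = m\<close>, then \<open>m\<close> is an approximate eigenvalue of \<open>T\<^sup>\<star> T\<close>, so \<open>m - T\<^sup>\<star> T\<close> has no bounded left
  inverse.\<close>

lemma no_left_inverse_at_norm:
  fixes T S :: "'h::complex_hilbert_space bop"
  assumes M: "M = onorm (app T)" "M > 0"
    and S: "\<And>x. app S (M\<^sup>2 *\<^sub>R x - app (T\<^sup>\<star> * T) x) = x"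
  shows False
proof -
  have T: "norm (app T x) \<le> M * norm x" for x
    unfolding M(1) by (rule onorm[OF bounded_linear_app])
  obtain K where K: "K \<ge> 0" "\<And>x. norm (app S x) \<le> K * norm x" using app_bound[of S] by blast
  define L where "L = K + 1"
  have L: "L > 0" "\<And>x. norm (app S x) \<le> L * norm x"
    using K by (auto simp: L_def algebra_simps intro!: add_increasing)
  \<comment> \<open>The bound \<open>L\<close> on \<open>S\<close> keeps \<open>\<parallel>T x\<parallel>\<^sup>2\<close> below \<open>q * \<parallel>x\<parallel>\<^sup>2\<close>, with \<open>q < M\<^sup>2\<close>.\<close>
  define q where "q = max 0 (M\<^sup>2 - 1 / (L\<^sup>2 * M\<^sup>2))"
  have pos: "L\<^sup>2 * M\<^sup>2 > 0" using L M by simp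
  have q: "0 \<le> q" by (simp add: q_def)
  have sq: "(norm (app T x))\<^sup>2 \<le> q * (norm x)\<^sup>2" for x
  proof -
    let ?d = "M\<^sup>2 *\<^sub>R x - app (T\<^sup>\<star> * T) x"
    have r: "Re (cinner (M\<^sup>2 *\<^sub>R x) (app (T\<^sup>\<star> * T) x)) = M\<^sup>2 * (norm (app T x))\<^sup>2"
      by (simp add: scaleR_scaleC cinner_scaleC_left norm_app_sq del: app_simps of_real_power)
    have "norm (app (T\<^sup>\<star>) (app T x)) \<le> M * norm (app T x)" by (rule norm_adj_le[OF T])
    then have t: "(norm (app (T\<^sup>\<star> * T) x))\<^sup>2 \<le> M\<^sup>2 * (norm (app T x))\<^sup>2"
      by (metis app_simps(6) power_mono norm_ge_zero power_mult_distrib)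
    have n: "(norm (M\<^sup>2 *\<^sub>R x))\<^sup>2 = M\<^sup>2 * (M\<^sup>2 * (norm x)\<^sup>2)"
      by (simp add: power_mult_distrib power2_eq_square mult_ac)
    have d: "(norm ?d)\<^sup>2 \<le> M\<^sup>2 * (M\<^sup>2 * (norm x)\<^sup>2 - (norm (app T x))\<^sup>2)"
      unfolding norm_diff_sq r n using t by (simp add: right_diff_distrib)
    have "norm x \<le> L * norm ?d" using L(2)[of ?d] unfolding S .
    then have "(norm x)\<^sup>2 \<le> L\<^sup>2 * (norm ?d)\<^sup>2" by (metis power_mono norm_ge_zero power_mult_distrib)
    also have "\<dots> \<le> L\<^sup>2 * (M\<^sup>2 * (M\<^sup>2 * (norm x)\<^sup>2 - (norm (app T x))\<^sup>2))"
      using d by (intro mult_left_mono) auto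
    finally have "(norm x)\<^sup>2 / (L\<^sup>2 * M\<^sup>2) \<le> M\<^sup>2 * (norm x)\<^sup>2 - (norm (app T x))\<^sup>2"
      using pos by (simp add: divide_le_eq mult_ac)
    then have "(norm (app T x))\<^sup>2 \<le> (M\<^sup>2 - 1 / (L\<^sup>2 * M\<^sup>2)) * (norm x)\<^sup>2"
      by (simp add: left_diff_distrib)
    also have "\<dots> \<le> q * (norm x)\<^sup>2" by (intro mult_right_mono) (auto simp: q_def)
    finally show ?thesis .
  qed
  have "norm (app T x) \<le> sqrt q * norm x" for x
    by (rule power2_le_imp_le) (use sq[of x] q in \<open>simp_all add: power_mult_distrib\<close>)
  then have "M \<le> sqrt q" unfolding M(1) using q by (intro onorm_bound) simp_all
  then have "M\<^sup>2 \<le> (sqrt q)\<^sup>2" using M(2) by (intro power_mono) simp_all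
  then have "M\<^sup>2 \<le> q" using q by simp
  moreover have "q < M\<^sup>2" using M(2) pos by (auto simp: q_def)
  ultimately show False by simp
qed

context unital_cstar_algebra begin

lemma cnorm_minus:
  assumes x: "x \<in> carrier A"
  shows "cnorm A (\<ominus> x) = cnorm A x"
proof -
  have "cscale A 0 x \<oplus> cscale A 0 x = cscale A 0 x" using scale_add_left[of x 0 0] x by simp
  then have 0: "cscale A 0 x = \<zero>" using x scale_closed by (metis add.l_cancel_one)
  have "cscale A (-1) x \<oplus> x = cscale A 0 x" using scale_add_left[of x "-1" 1] x scale_one by simp
  then have "\<ominus> x = cscale A (-1) x" using 0 x scale_closed minus_equality by metis
  then show ?thesis using norm_scale[OF x, of "-1"] by simp
qed

lemma cnorm_nonneg:
  assumes x: "x \<in> carrier A"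
  shows "0 \<le> cnorm A x"
proof -
  have "cnorm A (x \<oplus> \<ominus> x) \<le> cnorm A x + cnorm A (\<ominus> x)" using x by (intro norm_triangle) auto
  moreover have "cnorm A (x \<oplus> \<ominus> x) = 0" using x norm_eq_zero[of \<zero>] by (simp add: r_neg)
  ultimately show ?thesis using cnorm_minus[OF x] by simp
qed

lemma cnorm_diff_le:
  assumes "x \<in> carrier A" "y \<in> carrier A" "w \<in> carrier A"
  shows "cnorm A (x \<ominus> w) \<le> cnorm A (x \<ominus> y) + cnorm A (y \<ominus> w)"
proof -
  have "x \<ominus> w = (x \<ominus> y) \<oplus> (y \<ominus> w)"
    using assms by (simp add: minus_eq a_assoc) (metis a_assoc a_inv_closed l_neg l_zero)
  then show ?thesis using norm_triangle[of "x \<ominus> y" "y \<ominus> w"] assms by simp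
qed

lemma cnorm_diff_commute:
  assumes "x \<in> carrier A" "y \<in> carrier A"
  shows "cnorm A (x \<ominus> y) = cnorm A (y \<ominus> x)"
proof -
  have "\<ominus> (x \<ominus> y) = y \<ominus> x" using assms by (simp add: minus_eq minus_add a_comm)
  then show ?thesis using cnorm_minus[of "x \<ominus> y"] assms by simp
qed

text \<open>The Neumann series, obtained as a fixed point of the contraction \<open>y \<mapsto> 1 + y b\<close>.\<close>

lemma Neumann:
  assumes b: "b \<in> carrier A" and lt: "cnorm A b < 1"
  shows "\<exists>y\<in>carrier A. y = \<one> \<oplus> y \<otimes> b"
proof -
  let ?\<beta> = "cnorm A b"
  have \<beta>: "0 \<le> ?\<beta>" by (rule cnorm_nonneg[OF b])
  define F where "F y = \<one> \<oplus> y \<otimes> b" for y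
  define y where "y k = (F ^^ k) \<one>" for k :: nat
  have F_closed: "u \<in> carrier A \<Longrightarrow> F u \<in> carrier A" for u using b by (simp add: F_def)
  have y_closed: "y k \<in> carrier A" for k by (induction k) (auto simp: y_def F_closed)
  have F_diff: "F u \<ominus> F v = (u \<ominus> v) \<otimes> b" if "u \<in> carrier A" "v \<in> carrier A" for u v
  proof -
    have "F u \<ominus> F v = (u \<otimes> b \<oplus> \<one>) \<oplus> (\<ominus> \<one> \<oplus> \<ominus> (v \<otimes> b))"
      using that b by (simp add: F_def minus_eq minus_add a_comm)
    also have "\<dots> = u \<otimes> b \<oplus> (\<one> \<oplus> \<ominus> \<one>) \<oplus> \<ominus> (v \<otimes> b)"
      using that b by (simp add: a_assoc)
    also have "\<dots> = (u \<ominus> v) \<otimes> b" using that b by (simp add: r_neg minus_eq l_distr l_minus)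
    finally show ?thesis .
  qed
  have F_contr: "cnorm A (F u \<ominus> F v) \<le> cnorm A (u \<ominus> v) * ?\<beta>" if "u \<in> carrier A" "v \<in> carrier A" for u v
    unfolding F_diff[OF that] using that b by (intro norm_mult) auto
  define R where "R = cnorm A \<one> / (1 - ?\<beta>)"
  have R: "cnorm A \<one> + R * ?\<beta> = R" using lt by (simp add: R_def field_simps)
  have R0: "cnorm A \<one> \<le> R" "0 \<le> R"
  proof -
    show "0 \<le> R" unfolding R_def using lt cnorm_nonneg[of \<one>] by simp
    then show "cnorm A \<one> \<le> R" using R \<beta> by (metis add.commute add_increasing mult_nonneg_nonneg order_refl)
  qed
  have y_bound: "cnorm A (y k) \<le> R" for k
  proof (induction k)
    case 0
    then show ?case using R0 by (simp add: y_def)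
  next
    case (Suc k)
    have "cnorm A (y (Suc k)) \<le> cnorm A \<one> + cnorm A (y k \<otimes> b)"
      using y_closed b by (simp add: y_def F_def norm_triangle del: funpow.simps add: funpow.simps(2))
    also have "\<dots> \<le> cnorm A \<one> + cnorm A (y k) * ?\<beta>" using norm_mult y_closed b by simp
    also have "\<dots> \<le> cnorm A \<one> + R * ?\<beta>" using Suc \<beta> by (simp add: mult_right_mono)
    finally show ?case by (simp add: R)
  qed
  have y_Suc: "y (Suc k) = F (y k)" for k by (simp add: y_def)
  \<comment> \<open>Applying \<open>F\<close> another \<open>p\<close> times shrinks the distance of two iterates, at most \<open>2 * R\<close>, by \<open>\<beta> ^ p\<close>.\<close>
  have y_diff: "cnorm A (y (p + k) \<ominus> y (p + l)) \<le> 2 * R * ?\<beta> ^ p" for p k l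
  proof (induction p)
    case 0
    have "cnorm A (y k \<ominus> y l) \<le> cnorm A (y k) + cnorm A (\<ominus> y l)"
      unfolding minus_eq using y_closed by (intro norm_triangle) auto
    then show ?case using y_bound[of k] y_bound[of l] cnorm_minus[OF y_closed, of l] by simp
  next
    case (Suc p)
    have "cnorm A (y (Suc p + k) \<ominus> y (Suc p + l)) \<le> cnorm A (y (p + k) \<ominus> y (p + l)) * ?\<beta>"
      using F_contr y_closed by (simp add: y_Suc)
    also have "\<dots> \<le> 2 * R * ?\<beta> ^ p * ?\<beta>" using Suc \<beta> by (intro mult_right_mono) auto
    finally show ?case by (simp add: mult_ac)
  qed
  have "\<exists>x\<in>carrier A. (\<lambda>k. cnorm A (y k \<ominus> x)) \<longlonglongrightarrow> 0"
  proof (rule complete)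
    fix e :: real assume e: "e > 0"
    have "(\<lambda>p. 2 * R * ?\<beta> ^ p) \<longlonglongrightarrow> 2 * R * 0"
      using \<beta> lt by (intro tendsto_mult tendsto_const LIMSEQ_realpow_zero) auto
    then have "\<forall>\<^sub>F p in sequentially. 2 * R * ?\<beta> ^ p < e" using e by (intro order_tendstoD) auto
    then obtain p where p: "2 * R * ?\<beta> ^ p < e" by (auto simp: eventually_sequentially)
    have "cnorm A (y k \<ominus> y l) < e" if "k \<ge> p" "l \<ge> p" for k l
      using y_diff[of p "k - p" "l - p"] p that by simp
    then show "\<exists>N. \<forall>k\<ge>N. \<forall>m\<ge>N. cnorm A (y k \<ominus> y m) < e" by blast
  qed (rule y_closed)
  then obtain x where x: "x \<in> carrier A" "(\<lambda>k. cnorm A (y k \<ominus> x)) \<longlonglongrightarrow> 0" by blast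
  have "cnorm A (x \<ominus> F x) \<le> 0"
  proof (rule LIMSEQ_le_const)
    show "(\<lambda>k. cnorm A (y (Suc k) \<ominus> x) + cnorm A (y k \<ominus> x) * ?\<beta>) \<longlonglongrightarrow> 0"
      using tendsto_add[OF LIMSEQ_Suc[OF x(2)] tendsto_mult_right[OF x(2), of ?\<beta>]] by simp
    have "cnorm A (x \<ominus> F x) \<le> cnorm A (y (Suc k) \<ominus> x) + cnorm A (y k \<ominus> x) * ?\<beta>" for k
      using cnorm_diff_le[OF x(1) y_closed[of "Suc k"] F_closed[OF x(1)]] F_contr[OF y_closed[of k] x(1)]
        cnorm_diff_commute[OF x(1) y_closed[of "Suc k"]] by (simp add: y_Suc)
    then show "\<exists>N. \<forall>k\<ge>N. cnorm A (x \<ominus> F x) \<le> cnorm A (y (Suc k) \<ominus> x) + cnorm A (y k \<ominus> x) * ?\<beta>" by blast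
  qed
  then have "cnorm A (x \<ominus> F x) = 0" using cnorm_nonneg[of "x \<ominus> F x"] x(1) F_closed by simp
  then have "x \<ominus> F x = \<zero>" using norm_eq_zero[of "x \<ominus> F x"] x(1) F_closed by simp
  then have "x = F x" using x(1) F_closed r_right_minus_eq by blast
  then show ?thesis using x(1) by (auto simp: F_def)
qed

end

locale cstar_representation = unital_cstar_algebra A for A :: "'a cstar_alg" (structure) +
  fixes \<pi> :: "'a \<Rightarrow> 'h::complex_hilbert_space \<Rightarrow> 'h"
  assumes representation: "representation A \<pi>"
begin

definition \<rho> :: "'a \<Rightarrow> 'h bop" where "\<rho> x = Bop (\<pi> x)"

lemma app_rho: "x \<in> carrier A \<Longrightarrow> app (\<rho> x) = \<pi> x"
  using representation Bop_inverse[of "\<pi> x"]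
  by (auto simp: representation_def unital_star_hom_def ring_hom_def bounded_ops_def \<rho>_def)

lemma rho_mult: "\<lbrakk>x \<in> carrier A; y \<in> carrier A\<rbrakk> \<Longrightarrow> \<rho> (x \<otimes> y) = \<rho> x * \<rho> y"
  and rho_add: "\<lbrakk>x \<in> carrier A; y \<in> carrier A\<rbrakk> \<Longrightarrow> \<rho> (x \<oplus> y) = \<rho> x + \<rho> y"
  and rho_one: "\<rho> \<one> = 1"
  and app_rho_scale: "x \<in> carrier A \<Longrightarrow> app (\<rho> (cscale A c x)) v = c *\<^sub>C app (\<rho> x) v"
  and rho_star: "x \<in> carrier A \<Longrightarrow> \<rho> (cstar A x) = (\<rho> x)\<^sup>\<star>"
  using representation
  by (auto intro!: bop_eqI simp: app_rho scale_closed star_closed hadj_app[symmetric]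
      representation_def unital_star_hom_def ring_hom_def bounded_ops_def fun_eq_iff)

lemma rho_zero: "\<rho> \<zero> = 0"
  using rho_add[of \<zero> \<zero>] by simp

lemma rho_diff:
  assumes "x \<in> carrier A" "y \<in> carrier A"
  shows "\<rho> (x \<ominus> y) = \<rho> x - \<rho> y"
proof -
  have "\<rho> (x \<ominus> y) + \<rho> y = \<rho> ((x \<ominus> y) \<oplus> y)" using assms by (simp add: rho_add)
  also have "(x \<ominus> y) \<oplus> y = x" using assms by (simp add: minus_eq a_assoc l_neg)
  finally show ?thesis by (simp add: eq_diff_eq)
qed

text \<open>If \<open>\<parallel>\<rho> a\<parallel>\<close> exceeded the norm of \<open>a\<close>, the Neumann series would invert \<open>\<parallel>\<rho> a\<parallel>\<^sup>2 - a\<^sup>\<star> a\<close> in the algebra,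
  and the image of the inverse would contradict \<open>no_left_inverse_at_norm\<close>.\<close>

lemma contractive:
  assumes a: "a \<in> carrier A"
  shows "norm (app (\<rho> a) v) \<le> cnorm A a * norm v"
proof -
  define M where "M = onorm (app (\<rho> a))"
  have T: "norm (app (\<rho> a) x) \<le> M * norm x" for x
    unfolding M_def by (rule onorm[OF bounded_linear_app])
  have "M \<le> cnorm A a"
  proof (rule ccontr)
    assume "\<not> M \<le> cnorm A a"
    then have M: "cnorm A a < M" "0 < M" using cnorm_nonneg[OF a] by auto
    let ?b = "cstar A a \<otimes> a"
    have bc: "?b \<in> carrier A" using a star_closed by simp
    define b' where "b' = cscale A (complex_of_real (1 / M\<^sup>2)) ?b"
    have b': "b' \<in> carrier A" using bc scale_closed by (simp add: b'_def)
    have "cnorm A b' = (cnorm A a)\<^sup>2 / M\<^sup>2"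
      using norm_scale[OF bc] cstar_identity[OF a] M by (simp add: b'_def norm_divide norm_power)
    also have "\<dots> < 1" using M cnorm_nonneg[OF a] by (simp add: power_strict_mono)
    finally obtain y where y: "y \<in> carrier A" "y = \<one> \<oplus> y \<otimes> b'" using Neumann[OF b'] by blast
    have r: "\<rho> y = 1 + \<rho> y * \<rho> b'"
      using arg_cong[OF y(2), of \<rho>] y(1) b' by (simp add: rho_add rho_mult rho_one)
    define S where "S = \<rho> (cscale A (complex_of_real (1 / M\<^sup>2)) y)"
    have b'v: "app (\<rho> b') x = (1 / M\<^sup>2) *\<^sub>R app ((\<rho> a)\<^sup>\<star> * \<rho> a) x" for x
      unfolding b'_def scaleR_scaleC using a bc star_closed
      by (simp only: app_rho_scale rho_mult rho_star)
    have Sv: "app S x = (1 / M\<^sup>2) *\<^sub>R app (\<rho> y) x" for x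
      unfolding S_def scaleR_scaleC using y(1) by (simp only: app_rho_scale)
    have "app S (M\<^sup>2 *\<^sub>R x - app ((\<rho> a)\<^sup>\<star> * \<rho> a) x) = x" for x
    proof -
      have "M\<^sup>2 *\<^sub>R x - app ((\<rho> a)\<^sup>\<star> * \<rho> a) x = M\<^sup>2 *\<^sub>R (x - app (\<rho> b') x)"
        unfolding b'v using M(2) by (simp add: scaleR_diff_right del: app_simps(6))
      then have "app S (M\<^sup>2 *\<^sub>R x - app ((\<rho> a)\<^sup>\<star> * \<rho> a) x)
          = (1 / M\<^sup>2) *\<^sub>R app (\<rho> y) (M\<^sup>2 *\<^sub>R (x - app (\<rho> b') x))" by (simp only: Sv)
      also have "\<dots> = app (\<rho> y) (x - app (\<rho> b') x)"
        using M(2) linear_simps(5)[OF bounded_linear_app, of "\<rho> y" "M\<^sup>2"] by (simp del: app_linear)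
      also have "\<dots> = app (\<rho> y - \<rho> y * \<rho> b') x" by simp
      also have "\<rho> y - \<rho> y * \<rho> b' = 1" using r by (metis add_diff_cancel_right')
      finally show ?thesis by simp
    qed
    then show False using no_left_inverse_at_norm[of M "\<rho> a" S] M(2) by (simp add: M_def)
  qed
  then have "M * norm v \<le> cnorm A a * norm v" by (simp add: mult_right_mono)
  then show ?thesis using T[of v] by linarith
qed

end


section \<open>From representations to operators\<close>

context cstar_representation begin

text \<open>By contractivity, invariance under the generators and their adjoints extends to the closed
  \<open>\<^sup>\<star>\<close>-algebra that they generate.\<close>

lemma invariant_if_generators_invariant:
  assumes K: "closed_csubspace K" and gen: "X \<subseteq> carrier A"
    "\<And>S. \<lbrakk>cstar_subalgebra S A; X \<subseteq> S\<rbrakk> \<Longrightarrow> S = carrier A"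
    and inva: "\<And>g x. \<lbrakk>g \<in> X; x \<in> K\<rbrakk> \<Longrightarrow> app (\<rho> g) x \<in> K \<and> app ((\<rho> g)\<^sup>\<star>) x \<in> K"
    and a: "a \<in> carrier A"
  shows "\<pi> a ` K \<subseteq> K"
proof -
  define S where "S = {a \<in> carrier A. \<forall>x\<in>K. app (\<rho> a) x \<in> K \<and> app ((\<rho> a)\<^sup>\<star>) x \<in> K}"
  have K_add: "x \<in> K \<Longrightarrow> y \<in> K \<Longrightarrow> x + y \<in> K" and K_scale: "x \<in> K \<Longrightarrow> c *\<^sub>C x \<in> K" for x y c
    using K by (auto simp: closed_csubspace_def)
  have K_closed: "closed K" using K by (simp add: closed_csubspace_def)
  have K_neg: "x \<in> K \<Longrightarrow> - x \<in> K" for x using K by (rule closed_csubspace_uminus)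
  have "cstar_subalgebra S A"
    unfolding cstar_subalgebra_def
  proof (intro conjI allI ballI impI)
    show "subring S A"
    proof (rule subringI)
      show "\<ominus> h \<in> S" if "h \<in> S" for h
      proof -
        have "\<rho> (\<ominus> h) = 0 - \<rho> h"
          using that rho_diff[of \<zero> h] by (simp add: S_def minus_eq rho_zero)
        then show ?thesis using that K_neg by (simp add: S_def)
      qed
    qed (auto simp: S_def rho_one rho_mult rho_add K_add)
    show "cscale A c x \<in> S" if "x \<in> S" for c x
    proof -
      have x: "x \<in> carrier A" using that by (simp add: S_def)
      have "(\<rho> (cscale A c x))\<^sup>\<star> = \<rho> (cscale A (cnj c) (cstar A x))"
        using x by (simp add: rho_star[symmetric] scale_closed star_scale)
      then show ?thesis
        using that x by (simp add: S_def scale_closed star_closed app_rho_scale rho_star K_scale)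
    qed
    show "cstar A x \<in> S" if "x \<in> S" for x
      using that by (simp add: S_def star_closed rho_star)
    fix s x assume "(\<forall>k::nat. s k \<in> S) \<and> x \<in> carrier A \<and> (\<lambda>k. cnorm A (s k \<ominus> x)) \<longlonglongrightarrow> 0"
    then have s: "\<And>k. s k \<in> S" "\<And>k. s k \<in> carrier A" "x \<in> carrier A" "(\<lambda>k. cnorm A (s k \<ominus> x)) \<longlonglongrightarrow> 0"
      by (auto simp: S_def)
    have lim: "f \<longlonglongrightarrow> l" if "\<And>k. norm (f k - l) \<le> cnorm A (s k \<ominus> x) * norm v" for f and l v :: 'h
    proof -
      have "(\<lambda>k. cnorm A (s k \<ominus> x) * norm v) \<longlonglongrightarrow> 0"
        using tendsto_mult_right[OF s(4), of "norm v"] by simp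
      then have "(\<lambda>k. f k - l) \<longlonglongrightarrow> 0"
        by (rule Lim_null_comparison[rotated]) (simp add: that)
      then show ?thesis by (rule LIM_zero_cancel)
    qed
    have "app (\<rho> x) v \<in> K \<and> app ((\<rho> x)\<^sup>\<star>) v \<in> K" if v: "v \<in> K" for v
    proof -
      have d: "\<rho> (s k \<ominus> x) = \<rho> (s k) - \<rho> x" for k using s by (simp add: rho_diff)
      have b: "norm (app (\<rho> (s k \<ominus> x)) w) \<le> cnorm A (s k \<ominus> x) * norm w" for k w
        using s by (intro contractive) auto
      have l1: "(\<lambda>k. app (\<rho> (s k)) v) \<longlonglongrightarrow> app (\<rho> x) v"
        by (rule lim[of _ _ v]) (use b[of _ v] in \<open>simp add: d\<close>)
      have l2: "(\<lambda>k. app ((\<rho> (s k))\<^sup>\<star>) v) \<longlonglongrightarrow> app ((\<rho> x)\<^sup>\<star>) v"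
        by (rule lim[of _ _ v]) (use norm_adj_le[OF b, of _ v] in \<open>simp add: d\<close>)
      have k: "app (\<rho> (s k)) v \<in> K" "app ((\<rho> (s k))\<^sup>\<star>) v \<in> K" for k
        using s(1)[of k] v by (auto simp: S_def)
      show ?thesis
        using closed_sequentially[OF K_closed k(1) l1] closed_sequentially[OF K_closed k(2) l2] by simp
    qed
    then show "x \<in> S" using s(3) by (simp add: S_def)
  qed
  moreover have "X \<subseteq> S" using gen(1) inva by (auto simp: S_def)
  ultimately have "a \<in> S" using gen(2) a by blast
  then show ?thesis using a by (auto simp: S_def app_rho)
qed

lemma rho_oprod:
  assumes "\<And>m. \<lbrakk>k \<le> m; m \<le> l\<rbrakk> \<Longrightarrow> f m \<in> carrier A"
  shows "oprod A f k l \<in> carrier A" "\<rho> (oprod A f k l) = seg (\<lambda>m. \<rho> (f m)) k l"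
proof -
  have "foldr (\<otimes>) (map f xs) \<one> \<in> carrier A \<and> \<rho> (foldr (\<otimes>) (map f xs) \<one>) = prod_list (map (\<lambda>m. \<rho> (f m)) xs)"
    if "\<And>m. m \<in> set xs \<Longrightarrow> f m \<in> carrier A" for xs
    using that by (induction xs) (auto simp: rho_one rho_mult)
  from this[of "[k..<Suc l]"] assms
  show "oprod A f k l \<in> carrier A" "\<rho> (oprod A f k l) = seg (\<lambda>m. \<rho> (f m)) k l"
    by (simp_all add: oprod_def seg_def del: upt_Suc)
qed

lemma crystal_relations_rho:
  assumes rel: "SU0_relations n A z"
  shows "crystal_relations (n + 1) (\<lambda>i j. \<rho> (z i j))"
proof -
  note rel' = rel[unfolded SU0_relations_def]
  have z: "z i j \<in> carrier A" if "1 \<le> i" "i \<le> n + 1" "1 \<le> j" "j \<le> n + 1" for i j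
    using rel' that by simp
  have row: "z i j \<otimes> z i l = \<zero>" if "1 \<le> i" "i \<le> n + 1" "1 \<le> j" "j < l" "l \<le> n + 1" for i j l
    using rel' that by simp
  have col: "z i j \<otimes> z k j = \<zero>" if "1 \<le> i" "i < k" "k \<le> n + 1" "1 \<le> j" "j \<le> n + 1" for i j k
    using rel' that by simp
  have four: "z i l \<otimes> z k j = z k j \<otimes> z i l"
      "min k l \<le> max i j \<Longrightarrow> z i l \<otimes> z k j = \<zero>"
      "max i j + 1 = min k l \<Longrightarrow> z i j \<otimes> z k l \<ominus> z k l \<otimes> z i j = z i l \<otimes> z k j"
      "max i j + 1 < min k l \<Longrightarrow> z i j \<otimes> z k l = z k l \<otimes> z i j"
    if "1 \<le> i" "i < k" "k \<le> n + 1" "1 \<le> j" "j < l" "l \<le> n + 1" for i j k l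
  proof -
    have m: "i \<in> {1..n+1}" "k \<in> {1..n+1}" "j \<in> {1..n+1}" "l \<in> {1..n+1}" "i < k \<and> j < l" using that by auto
    have "\<forall>i\<in>{1..n+1}. \<forall>k\<in>{1..n+1}. \<forall>j\<in>{1..n+1}. \<forall>l\<in>{1..n+1}. i < k \<and> j < l \<longrightarrow>
       z i l \<otimes> z k j = z k j \<otimes> z i l \<and>
       (max i j \<ge> min k l \<longrightarrow> z i l \<otimes> z k j = \<zero>) \<and>
       (max i j + 1 = min k l \<longrightarrow> z i j \<otimes> z k l \<ominus> z k l \<otimes> z i j = z i l \<otimes> z k j) \<and>
       (max i j + 1 < min k l \<longrightarrow> z i j \<otimes> z k l = z k l \<otimes> z i j)"
      using rel' by (elim conjE)
    from this[rule_format, OF m(1-4)] m(5)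
    show "z i l \<otimes> z k j = z k j \<otimes> z i l"
      "min k l \<le> max i j \<Longrightarrow> z i l \<otimes> z k j = \<zero>"
      "max i j + 1 = min k l \<Longrightarrow> z i j \<otimes> z k l \<ominus> z k l \<otimes> z i j = z i l \<otimes> z k j"
      "max i j + 1 < min k l \<Longrightarrow> z i j \<otimes> z k l = z k l \<otimes> z i j" by blast+
  qed
  have one: "oprod A (\<lambda>m. z m m) 1 (n + 1) = \<one>" using rel' by (elim conjE)
  have star: "z i j \<otimes> cstar A (z k l) = cstar A (z k l) \<otimes> z i j"
    if "1 \<le> i" "i \<le> n + 1" "1 \<le> j" "j \<le> n + 1" "1 \<le> k" "k \<le> n + 1" "1 \<le> l" "l \<le> n + 1" "i \<noteq> k" "j \<noteq> l" for i j k l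
    using rel' that by simp
  have adj: "r > s \<longrightarrow> cstar A (z r s) = oprod A (\<lambda>m. z m m) 1 (s-1) \<otimes> oprod A (\<lambda>m. z m (m+1)) s (r-1)
            \<otimes> oprod A (\<lambda>m. z m m) (r+1) (n+1)"
       "r = s \<longrightarrow> cstar A (z r s) = oprod A (\<lambda>m. z m m) 1 (r-1) \<otimes> oprod A (\<lambda>m. z m m) (r+1) (n+1)"
    if "1 \<le> r" "r \<le> n + 1" "1 \<le> s" "s \<le> n + 1" for r s
    using rel' that by simp_all
  have D: "oprod A (\<lambda>m. z m m) k l \<in> carrier A"
      "\<rho> (oprod A (\<lambda>m. z m m) k l) = seg (\<lambda>m. \<rho> (z m m)) k l" if "1 \<le> k" "l \<le> n + 1" for k l
    using that by (auto intro!: rho_oprod z)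
  have U: "oprod A (\<lambda>m. z m (m + 1)) k l \<in> carrier A"
      "\<rho> (oprod A (\<lambda>m. z m (m + 1)) k l) = seg (\<lambda>m. \<rho> (z m (m + 1))) k l" if "1 \<le> k" "l \<le> n" for k l
    by (rule rho_oprod; use that z in simp)+
  show ?thesis
  proof
    show "1 \<le> n + 1" by simp
    show "\<rho> (z i j) * \<rho> (z i l) = 0" if "1 \<le> i" "i \<le> n + 1" "1 \<le> j" "j < l" "l \<le> n + 1" for i j l
      using arg_cong[OF row[OF that], of \<rho>] z that by (simp add: rho_mult rho_zero)
    show "\<rho> (z i j) * \<rho> (z k j) = 0" if "1 \<le> i" "i < k" "k \<le> n + 1" "1 \<le> j" "j \<le> n + 1" for i j k
      using arg_cong[OF col[OF that], of \<rho>] z that by (simp add: rho_mult rho_zero)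
    fix i j k l assume i: "1 \<le> i" "i < k" "k \<le> n + 1" "1 \<le> j" "j < l" "l \<le> n + 1"
    show "\<rho> (z i l) * \<rho> (z k j) = \<rho> (z k j) * \<rho> (z i l)"
      using arg_cong[OF four(1)[OF i], of \<rho>] z i by (simp add: rho_mult)
    show "\<rho> (z i l) * \<rho> (z k j) = 0" if "min k l \<le> max i j"
      using arg_cong[OF four(2)[OF i that], of \<rho>] z i by (simp add: rho_mult rho_zero)
    show "\<rho> (z i j) * \<rho> (z k l) - \<rho> (z k l) * \<rho> (z i j) = \<rho> (z i l) * \<rho> (z k j)" if "max i j + 1 = min k l"
      using arg_cong[OF four(3)[OF i that], of \<rho>] z i by (simp add: rho_mult rho_diff)
    show "\<rho> (z i j) * \<rho> (z k l) = \<rho> (z k l) * \<rho> (z i j)" if "max i j + 1 < min k l"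
      using arg_cong[OF four(4)[OF i that], of \<rho>] z i by (simp add: rho_mult)
  next
    show "seg (\<lambda>m. \<rho> (z m m)) 1 (n + 1) = 1"
      using arg_cong[OF one, of \<rho>] by (simp only: D rho_one le_refl)
  next
    fix i j k l
    assume i: "1 \<le> i" "i \<le> n + 1" "1 \<le> j" "j \<le> n + 1" "1 \<le> k" "k \<le> n + 1" "1 \<le> l" "l \<le> n + 1" "i \<noteq> k" "j \<noteq> l"
    show "\<rho> (z i j) * (\<rho> (z k l))\<^sup>\<star> = (\<rho> (z k l))\<^sup>\<star> * \<rho> (z i j)"
      using arg_cong[OF star[OF i], of \<rho>] z i by (simp add: rho_mult rho_star[symmetric] star_closed)
  next
    fix i j assume i: "1 \<le> j" "j < i" "i \<le> n + 1"
    have "cstar A (z i j) = oprod A (\<lambda>m. z m m) 1 (j-1) \<otimes> oprod A (\<lambda>m. z m (m+1)) j (i-1)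
            \<otimes> oprod A (\<lambda>m. z m m) (i+1) (n+1)" using adj(1)[of i j] i by simp
    from arg_cong[OF this, of \<rho>]
    show "(\<rho> (z i j))\<^sup>\<star> = seg (\<lambda>m. \<rho> (z m m)) 1 (j - 1) * seg (\<lambda>m. \<rho> (z m (m + 1))) j (i - 1)
        * seg (\<lambda>m. \<rho> (z m m)) (i + 1) (n + 1)"
      using i z[of i j] D[of 1 "j - 1"] D[of "i + 1" "n + 1"] U[of j "i - 1"]
      by (simp add: rho_mult rho_star del: One_nat_def Suc_eq_plus1)
  next
    fix i assume i: "1 \<le> i" "i \<le> n + 1"
    have "cstar A (z i i) = oprod A (\<lambda>m. z m m) 1 (i-1) \<otimes> oprod A (\<lambda>m. z m m) (i+1) (n+1)"
      using adj(2)[of i i] i by simp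
    from arg_cong[OF this, of \<rho>]
    show "(\<rho> (z i i))\<^sup>\<star> = seg (\<lambda>m. \<rho> (z m m)) 1 (i - 1) * seg (\<lambda>m. \<rho> (z m m)) (i + 1) (n + 1)"
      using i z[of i i] D[of 1 "i - 1"] D[of "i + 1" "n + 1"]
      by (simp add: rho_mult rho_star del: One_nat_def)
  qed
qed

end

text \<open>\<open>Y2\<close> is the identity matrix outside a block of size two, so a sum over \<open>k\<close> reduces to \<open>k = j\<close> or to
  \<open>k \<in> {r, r + 1}\<close>.\<close>

lemma (in crystal_factor) factorization:
  assumes i: "1 \<le> i" "i \<le> N" and j: "1 \<le> j" "j \<le> N"
  shows "app (Z i j) =
    (\<lambda>x. \<Sum>k=min i j..max i j. Y1 r (app W) (\<lambda>i j. app (Z i j)) i k (Y2 r (app W) k j x))"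
proof (rule ext)
  fix x
  define F where "F k = Y1 r (app W) (\<lambda>i j. app (Z i j)) i k (Y2 r (app W) k j x)" for k
  have WWx: "x - app W (app (W\<^sup>\<star>) x) = app G x" using arg_cong[OF WW, of "\<lambda>T. app T x"] by simp
  have Y1_0: "Y1 r (app W) (\<lambda>i j. app (Z i j)) i k 0 = 0" for k
    by (simp add: Y1_def hadj_app)
  have sum_eq: "(\<Sum>k=min i j..max i j. F k) = sum F T"
    if "T \<subseteq> {min i j..max i j}" "\<And>k. k \<in> {min i j..max i j} - T \<Longrightarrow> F k = 0" for T
    using that by (intro sum.mono_neutral_right) auto
  consider "j \<noteq> r" "j \<noteq> r + 1" | "j = r" "i \<le> r" | "j = r" "r < i" | "j = r + 1" "i \<le> r" | "j = r + 1" "r < i"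
    by linarith
  then have "app (Z i j) x = (\<Sum>k=min i j..max i j. F k)"
  proof cases
    case 1
    have "(\<Sum>k=min i j..max i j. F k) = sum F {j}"
      by (rule sum_eq) (use 1 Y1_0 in \<open>auto simp: F_def Y2_def\<close>)
    then show ?thesis using 1 by (simp add: F_def Y1_def Y2_def)
  next
    case 2
    have "(\<Sum>k=min i j..max i j. F k) = sum F {r}"
      by (rule sum_eq) (use 2 Y1_0 in \<open>auto simp: F_def Y2_def\<close>)
    then show ?thesis using 2 arg_cong[OF factor_r_upper[of i], of "\<lambda>T. app T x"] i
      by (simp add: F_def Y1_def Y2_def hadj_app)
  next
    case 3
    have "(\<Sum>k=min i j..max i j. F k) = sum F {r, r + 1}"
      by (rule sum_eq) (use 3 Y1_0 in \<open>auto simp: F_def Y2_def\<close>)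
    then show ?thesis using 3 arg_cong[OF factor_lower(1)[of i], of "\<lambda>T. app T x"] i
      by (simp add: F_def Y1_def Y2_def hadj_app WWx)
  next
    case 4
    have "(\<Sum>k=min i j..max i j. F k) = sum F {r, r + 1}"
      by (rule sum_eq) (use 4 Y1_0 in \<open>auto simp: F_def Y2_def\<close>)
    then show ?thesis using 4 arg_cong[OF factor_Suc_r_upper[of i], of "\<lambda>T. app T x"] i
      by (simp add: F_def Y1_def Y2_def hadj_app WWx)
  next
    case 5
    have "(\<Sum>k=min i j..max i j. F k) = sum F {r + 1}"
      by (rule sum_eq) (use 5 Y1_0 in \<open>auto simp: F_def Y2_def\<close>)
    then show ?thesis using 5 arg_cong[OF factor_lower(2)[of i], of "\<lambda>T. app T x"] i
      by (simp add: F_def Y1_def Y2_def hadj_app)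
  qed
  then show "app (Z i j) x = (\<Sum>k=min i j..max i j. Y1 r (app W) (\<lambda>i j. app (Z i j)) i k (Y2 r (app W) k j x))"
    by (simp add: F_def)
qed

lemma (in crystal_factor) Y1_in_commutant:
  assumes i: "1 \<le> i" "i \<le> N" and j: "1 \<le> j" "j \<le> N"
  shows "Y1 r (app W) (\<lambda>i j. app (Z i j)) i j \<in> commutant {app W, hadj (app W)}"
proof -
  have comm: "app T \<in> commutant {app W, hadj (app W)}" if "good T" "central T" for T
  proof -
    have "app T (app W x) = app W (app T x)" "app T (app (W\<^sup>\<star>) x) = app (W\<^sup>\<star>) (app T x)" for x
      using arg_cong[OF commute_W(1)[OF that], of "\<lambda>T. app T x"]
        arg_cong[OF commute_W(2)[OF that], of "\<lambda>T. app T x"] by simp_all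
    then show ?thesis by (auto simp: commutant_def bounded_clinear_app hadj_app fun_eq_iff)
  qed
  consider "j = r" | "j = r + 1" | "j \<noteq> r" "j \<noteq> r + 1" by blast
  then show ?thesis
  proof cases
    case 1
    have "Y1 r (app W) (\<lambda>i j. app (Z i j)) i j = app (Z i r * W)" using 1 by (auto simp: Y1_def)
    then show ?thesis using comm Y_column_r[OF i] by simp
  next
    case 2
    have "Y1 r (app W) (\<lambda>i j. app (Z i j)) i j = app (W\<^sup>\<star> * Z i (r + 1))"
      using 2 by (auto simp: Y1_def hadj_app)
    then show ?thesis using comm Y_column_Suc_r[OF i] by simp
  next
    case 3
    have "Y1 r (app W) (\<lambda>i j. app (Z i j)) i j = app (Z i j)" using 3 by (simp add: Y1_def)
    then show ?thesis using comm good_other_columns[OF i j 3] central_Z[OF i j] by simp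
  qed
qed

section \<open>Factorization of irreducible representations\<close>

theorem theorem6p8:
  fixes n r :: nat
    and A :: "'a cstar_alg"
    and z :: "nat \<Rightarrow> nat \<Rightarrow> 'a"
    and \<pi> :: "'a \<Rightarrow> 'h::complex_hilbert_space \<Rightarrow> 'h"
    and Z :: "nat \<Rightarrow> nat \<Rightarrow> 'h \<Rightarrow> 'h"
    and W :: "'h \<Rightarrow> 'h"
  assumes "n \<ge> 2"
    and "universal_CSU0 n A z"
    and "irreducible_representation A \<pi>"
    and "Z = (\<lambda>i j. \<pi> (z i j))"
    and "r = Min {i \<in> {1..n+1}. Z (n+1) i \<noteq> (\<lambda>x. 0)}"
    and "r \<le> n"
    and "W = hadj (Wop n Z (n+1) r) \<circ> Wop n Z (n+1) (r+1)"
  shows "(\<forall>i\<in>{1..n+1}. \<forall>j\<in>{1..n+1}. Y1 r W Z i j \<in> commutant {W, hadj W}) \<and>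
    (\<forall>i\<in>{1..n+1}. \<forall>j\<in>{1..n+1}.
       Z i j = (\<lambda>x. \<Sum>k=min i j..max i j. Y1 r W Z i k (Y2 r W k j x)))"
proof -
  have univ: "unital_cstar_algebra A" "SU0_relations n A z"
    "\<And>S. \<lbrakk>cstar_subalgebra S A; \<forall>i\<in>{1..n+1}. \<forall>j\<in>{1..n+1}. z i j \<in> S\<rbrakk> \<Longrightarrow> S = carrier A"
    using assms(2) unfolding universal_CSU0_def by auto
  have irr: "representation A \<pi>" "\<exists>x::'h. x \<noteq> 0"
    "\<And>K. \<lbrakk>closed_csubspace K; \<forall>a\<in>carrier A. \<pi> a ` K \<subseteq> K\<rbrakk> \<Longrightarrow> K = {0} \<or> K = UNIV"
    using assms(3) unfolding irreducible_representation_def by auto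
  interpret cstar_representation A \<pi>
    by (intro cstar_representation.intro cstar_representation_axioms.intro univ irr)
  let ?N = "n + 1" and ?z = "\<lambda>i j. \<rho> (z i j)"
  interpret crystal_relations ?N ?z by (rule crystal_relations_rho[OF univ(2)])
  have zc: "z i j \<in> carrier A" if "1 \<le> i" "i \<le> ?N" "1 \<le> j" "j \<le> ?N" for i j
    using univ(2) that by (simp add: SU0_relations_def)
  have Zz: "Z i j = app (?z i j)" if "1 \<le> i" "i \<le> ?N" "1 \<le> j" "j \<le> ?N" for i j
    using assms(4) app_rho[OF zc[OF that]] by simp
  have nonzero_iff: "Z ?N i \<noteq> (\<lambda>x. 0) \<longleftrightarrow> ?z ?N i \<noteq> 0" if "1 \<le> i" "i \<le> ?N" for i
    using Zz[of ?N i] that by (simp add: app_eq_zero_iff)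
  let ?R = "{i \<in> {1..n+1}. Z ?N i \<noteq> (\<lambda>x. 0)}"
  obtain x :: 'h where "x \<noteq> 0" using irr(2) by blast
  then have "(1 :: 'h bop) \<noteq> 0" by (metis app_simps(1,2))
  then have "?z ?N ?N \<noteq> 0" using Q_top by (auto simp: Q_def)
  then have ne: "?N \<in> ?R" using nonzero_iff[of ?N] by simp
  have r: "r \<in> ?R" unfolding assms(5) by (rule Min_in) (use ne in auto)
  have r_least: "r \<le> i" if "i \<in> ?R" for i unfolding assms(5) by (rule Min_le) (use that in auto)
  interpret crystal_irrep ?N ?z r
  proof
    show "1 \<le> r" "r < ?N" "?z ?N r \<noteq> 0" using r assms(6) nonzero_iff[of r] by auto
    show "?z ?N l = 0" if "1 \<le> l" "l < r" for l
      using r_least[of l] nonzero_iff[of l] that assms(6) by auto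
    fix K assume K: "closed_csubspace K"
      and inv: "\<And>i j x. \<lbrakk>1 \<le> i; i \<le> ?N; 1 \<le> j; j \<le> ?N; x \<in> K\<rbrakk> \<Longrightarrow>
        app (?z i j) x \<in> K \<and> app ((?z i j)\<^sup>\<star>) x \<in> K"
    let ?X = "{z i j | i j. i \<in> {1..n+1} \<and> j \<in> {1..n+1}}"
    have "\<pi> a ` K \<subseteq> K" if "a \<in> carrier A" for a
    proof (rule invariant_if_generators_invariant[OF K, of ?X])
      show "?X \<subseteq> carrier A" using zc by auto
      show "S = carrier A" if "cstar_subalgebra S A" "?X \<subseteq> S" for S
        using univ(3)[OF that(1)] that(2) by blast
      show "app (\<rho> g) x \<in> K \<and> app ((\<rho> g)\<^sup>\<star>) x \<in> K" if "g \<in> ?X" "x \<in> K" for g x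
        using inv that by auto
    qed (rule that)
    then show "K = {0} \<or> K = UNIV" using irr(3) K by blast
  qed
  \<comment> \<open>\<open>Z\<close> and the operators of the locale agree on the index range only, and \<open>Wop\<close> stays inside it.\<close>
  have Wop_cong: "Wop n Z i j = Wop n (\<lambda>i j. app (?z i j)) i j" if "1 \<le> j" "j \<le> i" "i \<le> ?N" for i j
    using that(2,3)
  proof (induction i rule: dec_induct)
    case base
    then show ?case using Zz[of ?N j] that by simp
  next
    case (step i)
    then show ?case using Zz[of ?N "Suc i"] that by simp
  qed
  obtain V where V: "Wop n Z ?N r = app V" "V * Q r = \<rho> (z ?N r)"
    "\<And>l. \<lbrakk>r < l; l \<le> ?N\<rbrakk> \<Longrightarrow> V * \<rho> (z ?N l) = \<rho> (z ?N l) * V"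
    "\<And>l. \<lbrakk>r < l; l \<le> ?N\<rbrakk> \<Longrightarrow> V * (\<rho> (z ?N l))\<^sup>\<star> = (\<rho> (z ?N l))\<^sup>\<star> * V"
    using Wop_bop[of n r ?N] Wop_cong[of r ?N] r_pos r_less by auto
  obtain X where X: "Wop n Z ?N (r + 1) = app X" "X * Q (r + 1) = \<rho> (z ?N (r + 1))"
    "\<And>l. \<lbrakk>r + 1 < l; l \<le> ?N\<rbrakk> \<Longrightarrow> X * \<rho> (z ?N l) = \<rho> (z ?N l) * X"
    "\<And>l. \<lbrakk>r + 1 < l; l \<le> ?N\<rbrakk> \<Longrightarrow> X * (\<rho> (z ?N l))\<^sup>\<star> = (\<rho> (z ?N l))\<^sup>\<star> * X"
    using Wop_bop[of n "r + 1" ?N] Wop_cong[of "r + 1" ?N] r_less by auto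
  interpret F: crystal_factor ?N ?z r V X by unfold_locales (rule V X; assumption?)+
  have W: "W = app F.W" unfolding assms(7) V(1) X(1) F.W_def by (auto simp: hadj_app)
  have Y1_eq: "Y1 r W Z i k = Y1 r (app F.W) (\<lambda>i j. app (?z i j)) i k"
    if "1 \<le> i" "i \<le> ?N" "1 \<le> k" "k \<le> ?N" for i k
    using Zz that r_pos r_less by (simp add: Y1_def W)
  show ?thesis
  proof (intro conjI ballI)
    fix i j assume ij: "i \<in> {1..n+1}" "j \<in> {1..n+1}"
    show "Y1 r W Z i j \<in> commutant {W, hadj W}"
      using F.Y1_in_commutant[of i j] Y1_eq[of i j] ij by (simp add: W)
    show "Z i j = (\<lambda>x. \<Sum>k=min i j..max i j. Y1 r W Z i k (Y2 r W k j x))"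
    proof (rule ext)
      fix x
      have "Z i j x = (\<Sum>k=min i j..max i j.
          Y1 r (app F.W) (\<lambda>i j. app (?z i j)) i k (Y2 r (app F.W) k j x))"
        using fun_cong[OF F.factorization[of i j], of x] Zz[of i j] ij by simp
      also have "\<dots> = (\<Sum>k=min i j..max i j. Y1 r W Z i k (Y2 r W k j x))"
        by (rule sum.cong) (use ij in \<open>auto simp: Y1_eq[unfolded W] W\<close>)
      finally show "Z i j x = (\<Sum>k=min i j..max i j. Y1 r W Z i k (Y2 r W k j x))" .
    qed
  qed
qed

end
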